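(* Let $1\le n\le m\le l$ be integers and let $G=\mathbb{Z}_2$ act freely on a finite CW-complex $X$ with $X\sim_{\mathbb{Z}_2}\mathbb{S}^n\vee\mathbb{S}^m\vee\mathbb{S}^l$. Then the graded commutative algebra $H^*(X/G;\mathbb{Z}_2)$ of the orbit space is isomorphic to one of the following: (1) $\mathbb{Z}_2[y,z]/\langle y^{l+1},\ z^2+a_0y^{2n}+a_1y^nz,\ y^{m-n+1}z+a_2y^{m+1}\rangle$, where $\deg y=1$, $\deg z=n$, $a_0,a_1,a_2\in\mathbb{Z}_2$, with $a_0=0$ if $l<2n$, $a_1=0$ if $m<2n$, and $a_2=0$ if $l=m$; (2) $\mathbb{Z}_2[y,z]/\langle y^{n+1},\ z^2+a_0y^nz,\ y^{l-m+1}z\rangle$, where $\deg y=1$, $\deg z=m$, $a_0\in\mathbb{Z}_2$, with $a_0=0$ if $n<m$ or if ($l<2n$ and $n=m$); (3) $\mathbb{Z}_2[y,z]/\langle y^{m+1},\ z^2+a_0y^{2n}+a_1y^nz,\ y^{l-n+1}z\rangle$, where $\deg y=1$, $\deg z=n$, $a_0,a_1\in\mathbb{Z}_2$, with $a_0=0$ if $m<2n$ and $a_1=0$ if $l<2n$.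
   Context: $H^*$ denotes Čech cohomology. $X\sim_R Y$ means that $H^*(X;R)\cong H^*(Y;R)$ (as graded algebras). In particular $X\sim_R\mathbb{S}^n\vee\mathbb{S}^m\vee\mathbb{S}^l$ means $H^*(X;R)\cong R[a,b,c]/\langle a^2,b^2,c^2,ab,bc,ac\rangle$ with $\deg a=n$, $\deg b=m$, $\deg c=l$. *)

theory Defs
  imports
    "HOL-Analysis.Analysis"
    "HOL-Algebra.QuotRing"
    "HOL-Algebra.Module"
    "HOL-Algebra.Group_Action"
    "HOL-Algebra.Elementary_Groups"
    "HOL-Library.Poly_Mapping"
    "HOL-Library.Z2"
begin

section \<open>Graded algebras\<close>

record ('k, 'a) graded_algebra = "('k, 'a) module" +
  component :: "nat \<Rightarrow> 'a set"

definition graded_algebra_iso ::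
    "('k, 'a) graded_algebra \<Rightarrow> ('k, 'b) graded_algebra \<Rightarrow> bool" (infix "\<cong>\<^sub>g\<^sub>r" 50)
  where "A \<cong>\<^sub>g\<^sub>r B \<longleftrightarrow>
    (\<exists>h \<in> ring_iso A B.
       (\<forall>k. \<forall>a \<in> carrier A. h (k \<odot>\<^bsub>A\<^esub> a) = k \<odot>\<^bsub>B\<^esub> h a) \<and>
       (\<forall>i. h ` component A i = component B i))"


section \<open>Polynomial rings and their graded quotients\<close>

text \<open>A polynomial with coefficients in \<open>'k\<close> and variables in \<open>'v\<close> is a finitely supported
  function on monomials, and a monomial is a finitely supported function from variables to
  exponents. Multiplication is convolution.\<close>

type_synonym ('v, 'k) mpoly = "('v \<Rightarrow>\<^sub>0 nat) \<Rightarrow>\<^sub>0 'k"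

definition Var :: "'v \<Rightarrow> ('v, 'k::comm_ring_1) mpoly"
  where "Var v = Poly_Mapping.single (Poly_Mapping.single v 1) 1"

definition Const :: "'k \<Rightarrow> ('v, 'k::comm_ring_1) mpoly"
  where "Const k = Poly_Mapping.single 0 k"

definition poly_ring :: "('v, 'k::comm_ring_1) mpoly ring"
  where "poly_ring = \<lparr>carrier = UNIV, mult = (*), one = 1, zero = 0, add = (+)\<rparr>"

lemma cring_poly_ring: "cring (poly_ring :: ('v, 'k::comm_ring_1) mpoly ring)"
proof (rule cringI)
  show "abelian_group (poly_ring :: ('v, 'k) mpoly ring)"
  proof (rule abelian_groupI)
    fix p :: "('v, 'k) mpoly"
    show "\<exists>q \<in> carrier poly_ring. q \<oplus>\<^bsub>poly_ring\<^esub> p = \<zero>\<^bsub>poly_ring\<^esub>"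
      by (rule bexI[of _ "- p"]) (simp_all add: poly_ring_def)
  qed (simp_all add: poly_ring_def algebra_simps)
  show "comm_monoid (poly_ring :: ('v, 'k) mpoly ring)"
    by (rule comm_monoidI) (simp_all add: poly_ring_def algebra_simps)
qed (simp add: poly_ring_def algebra_simps)

definition homogeneous :: "('v \<Rightarrow> nat) \<Rightarrow> nat \<Rightarrow> ('v, 'k::comm_ring_1) mpoly \<Rightarrow> bool"
  where "homogeneous d i p \<longleftrightarrow>
    (\<forall>t \<in> Poly_Mapping.keys p. (\<Sum>v \<in> Poly_Mapping.keys t. d v * Poly_Mapping.lookup t v) = i)"

text \<open>The quotient of the polynomial ring by the ideal generated by \<open>S\<close>, where the variable \<open>v\<close>
  has degree \<open>d v\<close>. The degree-\<open>i\<close> component is the image of the homogeneous polynomials of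
  degree \<open>i\<close>; this is a grading only if the elements of \<open>S\<close> are homogeneous.\<close>

definition presented_algebra ::
    "('v \<Rightarrow> nat) \<Rightarrow> ('v, 'k::comm_ring_1) mpoly set \<Rightarrow> ('k, ('v, 'k) mpoly set) graded_algebra"
  where "presented_algebra d S =
    (let I = Idl\<^bsub>poly_ring\<^esub> S; Q = poly_ring Quot I in
      \<lparr>carrier = carrier Q, mult = mult Q, one = one Q, zero = zero Q, add = add Q,
       smult = (\<lambda>k C. \<Union>p\<in>C. I +>\<^bsub>poly_ring\<^esub> (Const k * p)),
       component = (\<lambda>i. {I +>\<^bsub>poly_ring\<^esub> p | p. homogeneous d i p})\<rparr>)"

datatype abc = gen_a | gen_b | gen_c

text \<open>The cohomology algebra of the wedge of spheres of dimensions \<open>n\<close>, \<open>m\<close>, \<open>l\<close>.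
  The presentation is meant for coefficients in which \<open>2 = 0\<close>: the variables commute strictly,
  without signs.\<close>

definition wedge_algebra :: "nat \<Rightarrow> nat \<Rightarrow> nat \<Rightarrow> ('k::comm_ring_1, (abc, 'k) mpoly set) graded_algebra"
  where "wedge_algebra n m l =
    (let a = Var gen_a; b = Var gen_b; c = Var gen_c in
      presented_algebra (\<lambda>v. case v of gen_a \<Rightarrow> n | gen_b \<Rightarrow> m | gen_c \<Rightarrow> l)
        {a^2, b^2, c^2, a * b, b * c, a * c})"

datatype yz = gen_y | gen_z

definition yz_algebra :: "nat \<Rightarrow> (yz, 'k::comm_ring_1) mpoly set \<Rightarrow> ('k, (yz, 'k) mpoly set) graded_algebra"
  where "yz_algebra k = presented_algebra (\<lambda>v. case v of gen_y \<Rightarrow> 1 | gen_z \<Rightarrow> k)"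


section \<open>Cech cohomology\<close>

definition open_cover :: "'a topology \<Rightarrow> 'a set set \<Rightarrow> bool"
  where "open_cover X U \<longleftrightarrow> (\<forall>u \<in> U. openin X u) \<and> \<Union>U = topspace X"

text \<open>Ordered simplices of the nerve, repeated vertices allowed; a list of length \<open>p + 1\<close> is a
  \<open>p\<close>-simplex.\<close>

definition nerve :: "'a set set \<Rightarrow> 'a set list set"
  where "nerve U = {s. s \<noteq> [] \<and> set s \<subseteq> U \<and> \<Inter>(set s) \<noteq> {}}"

text \<open>The total cochain module, that is, the direct sum over all \<open>p\<close> of the \<open>p\<close>-cochains of the
  nerve. A cochain is extended by zero to lists that are not simplices, and it vanishes in all
  sufficiently high degrees.\<close>

definition cochains :: "'a set set \<Rightarrow> ('a set list \<Rightarrow> 'k::comm_ring_1) set"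
  where "cochains U =
    {c. (\<forall>s. s \<notin> nerve U \<longrightarrow> c s = 0) \<and> (\<exists>N. \<forall>s. length s > N \<longrightarrow> c s = 0)}"

definition coboundary :: "'a set set \<Rightarrow> ('a set list \<Rightarrow> 'k::comm_ring_1) \<Rightarrow> 'a set list \<Rightarrow> 'k"
  where "coboundary U c s =
    (if s \<in> nerve U then \<Sum>i<length s. (- 1) ^ i * c (take i s @ drop (Suc i) s) else 0)"

definition cup :: "'a set set \<Rightarrow> ('a set list \<Rightarrow> 'k::comm_ring_1) \<Rightarrow> ('a set list \<Rightarrow> 'k) \<Rightarrow> 'a set list \<Rightarrow> 'k"
  where "cup U c d s =
    (if s \<in> nerve U then \<Sum>i<length s. c (take (Suc i) s) * d (drop i s) else 0)"

definition unit_cochain :: "'a set set \<Rightarrow> 'a set list \<Rightarrow> 'k::comm_ring_1"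
  where "unit_cochain U s = (if s \<in> nerve U \<and> length s = 1 then 1 else 0)"

text \<open>A choice function for the refinement relation; on the nerve it induces a simplicial map.\<close>

definition refinement_map :: "'a set set \<Rightarrow> 'a set set \<Rightarrow> ('a set \<Rightarrow> 'a set) \<Rightarrow> bool"
  where "refinement_map W U f \<longleftrightarrow> (\<forall>w \<in> W. f w \<in> U \<and> w \<subseteq> f w)"

definition pull_cochain ::
    "'a set set \<Rightarrow> ('a set \<Rightarrow> 'a set) \<Rightarrow> ('a set list \<Rightarrow> 'k::comm_ring_1) \<Rightarrow> 'a set list \<Rightarrow> 'k"
  where "pull_cochain W f c s = (if s \<in> nerve W then c (map f s) else 0)"

definition cech_cocycles :: "'a topology \<Rightarrow> ('a set set \<times> ('a set list \<Rightarrow> 'k::comm_ring_1)) set"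
  where "cech_cocycles X =
    {(U, c). open_cover X U \<and> c \<in> cochains U \<and> coboundary U c = (\<lambda>s. 0)}"

text \<open>Two cocycles represent the same element of the direct limit over all open covers iff they
  become cohomologous on a common refinement.\<close>

definition cech_rel ::
    "'a topology \<Rightarrow> (('a set set \<times> ('a set list \<Rightarrow> 'k::comm_ring_1)) \<times>
                    ('a set set \<times> ('a set list \<Rightarrow> 'k))) set"
  where "cech_rel X =
    {((U, c), (V, d)). (U, c) \<in> cech_cocycles X \<and> (V, d) \<in> cech_cocycles X \<and>
       (\<exists>W f g. \<exists>e \<in> cochains W.
          open_cover X W \<and> refinement_map W U f \<and> refinement_map W V g \<and>
          (\<forall>s. pull_cochain W f c s - pull_cochain W g d s = coboundary W e s))}"

abbreviation cech_class ::
    "'a topology \<Rightarrow> 'a set set \<Rightarrow> ('a set list \<Rightarrow> 'k::comm_ring_1) \<Rightarrow>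
     ('a set set \<times> ('a set list \<Rightarrow> 'k)) set"
  where "cech_class X U c \<equiv> cech_rel X `` {(U, c)}"

text \<open>The graded algebra of Cech cohomology. Any two classes have representatives on a common cover,
  and the operations are induced by those on cochains; the unions below are over all such
  representatives, which all yield the same class.\<close>

definition cech_cohomology ::
    "'a topology \<Rightarrow> ('k::comm_ring_1, ('a set set \<times> ('a set list \<Rightarrow> 'k)) set) graded_algebra"
  where "cech_cohomology X =
    \<lparr>carrier = cech_cocycles X // cech_rel X,
     mult = (\<lambda>A B. \<Union>(U, c) \<in> A. \<Union>d \<in> {d. (U, d) \<in> B}. cech_class X U (cup U c d)),
     one = cech_class X {topspace X} (unit_cochain {topspace X}),
     zero = cech_class X {topspace X} (\<lambda>s. 0),
     add = (\<lambda>A B. \<Union>(U, c) \<in> A. \<Union>d \<in> {d. (U, d) \<in> B}. cech_class X U (\<lambda>s. c s + d s)),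
     smult = (\<lambda>k A. \<Union>(U, c) \<in> A. cech_class X U (\<lambda>s. k * c s)),
     component = (\<lambda>p. {cech_class X U c | U c.
       (U, c) \<in> cech_cocycles X \<and> (\<forall>s. length s \<noteq> Suc p \<longrightarrow> c s = 0)})\<rparr>"


section \<open>Finite CW-complexes\<close>

definition disk :: "nat \<Rightarrow> (nat \<Rightarrow> real) topology"
  where "disk k = subtopology (Euclidean_space k) {x. (\<Sum>i<k. x i ^ 2) \<le> 1}"

definition open_disk :: "nat \<Rightarrow> (nat \<Rightarrow> real) topology"
  where "open_disk k = subtopology (Euclidean_space k) {x. (\<Sum>i<k. x i ^ 2) < 1}"

text \<open>The space admits a finite CW structure: there are cells indexed by \<open>i < N\<close>, of dimension
  \<open>dim i\<close> and with characteristic map \<open>\<Phi> i\<close>. Closure finiteness and the weak topology are automatic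
  for finitely many cells. A zero-dimensional disk is a point and equals its interior.\<close>

definition finite_CW_complex :: "'a topology \<Rightarrow> bool"
  where "finite_CW_complex X \<longleftrightarrow> Hausdorff_space X \<and>
    (\<exists>(N::nat) (dim :: nat \<Rightarrow> nat) (\<Phi> :: nat \<Rightarrow> (nat \<Rightarrow> real) \<Rightarrow> 'a).
       let cell = (\<lambda>i. \<Phi> i ` topspace (open_disk (dim i))) in
       (\<forall>i<N. continuous_map (disk (dim i)) X (\<Phi> i)) \<and>
       (\<forall>i<N. homeomorphic_map (open_disk (dim i)) (subtopology X (cell i)) (\<Phi> i)) \<and>
       disjoint_family_on cell {..<N} \<and>
       (\<Union>i<N. cell i) = topspace X \<and>
       (\<forall>i<N. \<Phi> i ` (topspace (disk (dim i)) - topspace (open_disk (dim i)))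
                \<subseteq> (\<Union>j \<in> {j. j < N \<and> dim j < dim i}. cell j)))"


section \<open>Group actions on spaces and orbit spaces\<close>

text \<open>The group is discrete, so continuity of the action means that each element acts
  continuously. In \<^locale>\<open>group_action\<close> each \<open>\<phi> g\<close> is extensional on the space; this
  fixes only its irrelevant values elsewhere.\<close>

definition continuous_action :: "('g, 'm) monoid_scheme \<Rightarrow> 'a topology \<Rightarrow> ('g \<Rightarrow> 'a \<Rightarrow> 'a) \<Rightarrow> bool"
  where "continuous_action G X \<phi> \<longleftrightarrow>
    group_action G (topspace X) \<phi> \<and> (\<forall>g \<in> carrier G. continuous_map X X (\<phi> g))"

definition free_action :: "('g, 'm) monoid_scheme \<Rightarrow> 'a topology \<Rightarrow> ('g \<Rightarrow> 'a \<Rightarrow> 'a) \<Rightarrow> bool"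
  where "free_action G X \<phi> \<longleftrightarrow>
    continuous_action G X \<phi> \<and>
    (\<forall>g \<in> carrier G. \<forall>x \<in> topspace X. \<phi> g x = x \<longrightarrow> g = \<one>\<^bsub>G\<^esub>)"

definition orbit_space :: "('g, 'm) monoid_scheme \<Rightarrow> 'a topology \<Rightarrow> ('g \<Rightarrow> 'a \<Rightarrow> 'a) \<Rightarrow> 'a set topology"
  where "orbit_space G X \<phi> =
    topology (\<lambda>V. V \<subseteq> orbits G (topspace X) \<phi> \<and> openin X {x \<in> topspace X. orbit G \<phi> x \<in> V})"

lemma openin_orbit_space:
  "openin (orbit_space G X \<phi>) V \<longleftrightarrow>
     V \<subseteq> orbits G (topspace X) \<phi> \<and> openin X {x \<in> topspace X. orbit G \<phi> x \<in> V}"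
proof -
  have "istopology (\<lambda>V. V \<subseteq> orbits G (topspace X) \<phi> \<and>
          openin X {x \<in> topspace X. orbit G \<phi> x \<in> V})" (is "istopology ?P")
    unfolding istopology_def
  proof (intro conjI allI impI)
    fix S T assume "?P S" "?P T"
    moreover have "{x \<in> topspace X. orbit G \<phi> x \<in> S \<inter> T} =
        {x \<in> topspace X. orbit G \<phi> x \<in> S} \<inter> {x \<in> topspace X. orbit G \<phi> x \<in> T}" by auto
    ultimately show "S \<inter> T \<subseteq> orbits G (topspace X) \<phi>"
      and "openin X {x \<in> topspace X. orbit G \<phi> x \<in> S \<inter> T}"
      by (auto simp: openin_Int)
  next
    fix \<K> assume K: "\<forall>K \<in> \<K>. ?P K"
    have "{x \<in> topspace X. orbit G \<phi> x \<in> \<Union>\<K>} =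
        (\<Union>K \<in> \<K>. {x \<in> topspace X. orbit G \<phi> x \<in> K})" by auto
    with K show "\<Union>\<K> \<subseteq> orbits G (topspace X) \<phi>"
      and "openin X {x \<in> topspace X. orbit G \<phi> x \<in> \<Union>\<K>}" by auto
  qed
  then show ?thesis by (simp add: orbit_space_def topology_inverse')
qed

lemma quotient_map_orbit_space: "quotient_map X (orbit_space G X \<phi>) (orbit G \<phi>)"
proof -
  have im: "orbit G \<phi> ` topspace X = orbits G (topspace X) \<phi>"
    by (auto simp: orbits_def)
  have "{x \<in> topspace X. orbit G \<phi> x \<in> orbits G (topspace X) \<phi>} = topspace X"
    by (auto simp: orbits_def)
  then have "openin (orbit_space G X \<phi>) (orbits G (topspace X) \<phi>)"
    by (simp add: openin_orbit_space)
  then have "topspace (orbit_space G X \<phi>) = orbits G (topspace X) \<phi>"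
    by (metis openin_orbit_space openin_subset openin_topspace subset_antisym)
  then show ?thesis
    by (auto simp: quotient_map_def openin_orbit_space im)
qed

end

theory Submission
  imports Defs
begin

text \<open>Over the field with two elements, a free involution \<open>T\<close> on a compact Hausdorff space \<open>X\<close> with
  orbit space \<open>Y\<close> gives an exact Gysin sequence
  \<open>H\<^sup>i\<^sup>-\<^sup>1(Y) \<rightarrow> H\<^sup>i(Y) \<rightarrow> H\<^sup>i(X) \<rightarrow> H\<^sup>i(Y) \<rightarrow> H\<^sup>i\<^sup>+\<^sup>1(Y)\<close>, in which the outer maps multiply by the class
  \<open>y\<close> of the double cover. On covers of \<open>X\<close> that are fine enough and invariant, the cochains of
  \<open>Y\<close> are the \<open>T\<close>-invariant cochains of \<open>X\<close>, and everything follows from a cochain \<open>u\<close> of degree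
  zero with \<open>u + T u = 1\<close>. Moreover \<open>y\<close> is central and, by compactness, nilpotent.

  If \<open>H(X)\<close> has total dimension four, counting dimensions shows that \<open>H(Y)\<close> is the sum of two
  cyclic modules over the polynomials in \<open>y\<close>, generated by \<open>1\<close> and by a class \<open>z\<close>. The degree of \<open>z\<close>
  and the two top degrees are \<open>n\<close>, \<open>m\<close>, \<open>l\<close> in some order. Replacing \<open>z\<close> by \<open>z\<close> plus a power
  of \<open>y\<close> makes the two modules independent, so that the relation in degree \<open>m + 1\<close> of the first
  case has \<open>a\<^sub>2 = 0\<close>. Only the additive structure of \<open>H(X)\<close> enters.\<close>

text \<open>The cup product of cochains commutes only up to homotopy, and no such homotopy is
  constructed in general: H(Y) is handled as a ring that may fail to commute. Centrality of
  \<open>y\<close> suffices, since the powers of \<open>y\<close> and their products with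
  \<open>z\<close> span everything. The computation behind the exact sequence is
  \<open>T (u x) = u x + x\<close> for invariant \<open>x\<close>: adding \<open>u x\<close> turns a
  cochain \<open>a\<close> with \<open>a + T a = x\<close> into an invariant one, and taking
  coboundaries brings in the factor \<open>d u\<close>, which represents \<open>y\<close>. In each
  degree exactness splits the dimension of H(X) into that of the kernel of \<open>y\<close> there
  and that of the cokernel of \<open>y\<close> into it. Nothing bounds the degrees of H(Y) in
  advance; nilpotence does, because above degree \<open>l\<close> multiplication by \<open>y\<close>
  is injective. Hence kernels and cokernels have the same total dimension, two each. The unit
  accounts for one cokernel and the last nonzero power of \<open>y\<close> for one kernel; the
  remaining cokernel and kernel mark the degree of \<open>z\<close> and the top degree of its
  block.\<close>

text \<open>As rewrite rules these two replace bit arithmetic by case distinctions, so that the ring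
  normalization no longer applies.\<close>

declare add_bit_eq_xor [simp del] mult_bit_eq_and [simp del]

lemma bit_double [simp]: "(a::bit) + a = 0"
  by (cases a) (simp_all add: add_bit_eq_xor)

lemma bit_plus_cancel [simp]: "(a::bit) + (a + b) = b"
  by (simp flip: add.assoc)

lemma bit_eq_iff_sum: "(a::bit) = b \<longleftrightarrow> a + b = 0"
  by (metis add.right_neutral add.assoc bit_double)

section \<open>Cochains as functions on lists\<close>

text \<open>Recursion on the simplex turns the cochain identities into list inductions. They hold for
  arbitrary functions on lists, so \<open>bd_cupl\<close> has correction terms for the empty list, on which a
  cochain of a nerve vanishes.\<close>

fun bd :: "('v list \<Rightarrow> bit) \<Rightarrow> 'v list \<Rightarrow> bit" where
  "bd c [] = 0"
| "bd c (x # s) = c s + bd (\<lambda>t. c (x # t)) s"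

fun cupl :: "('v list \<Rightarrow> bit) \<Rightarrow> ('v list \<Rightarrow> bit) \<Rightarrow> 'v list \<Rightarrow> bit" where
  "cupl c e [] = 0"
| "cupl c e (x # s) = c [x] * e (x # s) + cupl (\<lambda>t. c (x # t)) e s"

text \<open>Unfolded, this is the sum over \<open>i\<close> of \<open>c\<close> at the list f x0,
  ..., f xi, g xi, ..., g xk: the prism operator between two simplicial maps, without signs. In each
  summand one vertex is used twice, which raises the length by one.\<close>

fun prism :: "('v \<Rightarrow> 'u) \<Rightarrow> ('v \<Rightarrow> 'u) \<Rightarrow> ('u list \<Rightarrow> bit) \<Rightarrow> 'v list \<Rightarrow> bit" where
  "prism f g c [] = 0"
| "prism f g c (x # s) = c (f x # g x # map g s) + prism f g (\<lambda>t. c (f x # t)) s"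

text \<open>Links the recursion to the alternating sum that defines the coboundary; the signs
  disappear because \<open>- 1 = 1\<close> in \<open>bit\<close>.\<close>

lemma bd_altdef: "bd c s = (\<Sum>i<length s. (- 1) ^ i * c (take i s @ drop (Suc i) s))"
proof (induction s arbitrary: c)
  case (Cons x s)
  show ?case
    using Cons[of "\<lambda>t. c (x # t)"]
    by (simp add: sum.lessThan_Suc_shift del: sum.lessThan_Suc)
qed simp

lemma cupl_altdef: "cupl c e s = (\<Sum>i<length s. c (take (Suc i) s) * e (drop i s))"
proof (induction s arbitrary: c)
  case (Cons x s)
  show ?case
    using Cons[of "\<lambda>t. c (x # t)"]
    by (simp add: sum.lessThan_Suc_shift del: sum.lessThan_Suc)
qed simp

lemma bd_add: "bd (\<lambda>s. c s + e s) s = bd c s + bd e s"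
  by (induction s arbitrary: c e) (simp_all add: ac_simps)

text \<open>With the first vertex split off, \<open>bd c\<close> arises once from deleting that
  vertex and once inside the remaining boundary. The pair cancels in characteristic two, and the
  rest is the induction hypothesis.\<close>

lemma bd_bd: "bd (bd c) s = 0"
proof (induction s arbitrary: c)
  case (Cons x s)
  have "bd (\<lambda>t. bd c (x # t)) s = bd (\<lambda>t. c t + bd (\<lambda>t. c (x # t)) t) s" by simp
  also have "\<dots> = bd c s" by (simp only: bd_add Cons) simp
  finally show ?case by simp
qed simp

lemma cupl_add_left: "cupl (\<lambda>s. c s + c' s) e s = cupl c e s + cupl c' e s"
  by (induction s arbitrary: c c') (simp_all add: algebra_simps)

lemma cupl_add_right: "cupl c (\<lambda>s. e s + e' s) s = cupl c e s + cupl c e' s"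
  by (induction s arbitrary: c) (simp_all add: algebra_simps)

lemma cupl_scale_left: "cupl (\<lambda>s. k * c s) e s = k * cupl c e s"
  by (induction s arbitrary: c) (simp_all add: algebra_simps)

lemma bd_scale: "bd (\<lambda>s. k * c s) s = k * bd c s"
  by (induction s arbitrary: c) (simp_all add: algebra_simps)

lemma bd_zero [simp]: "bd (\<lambda>s. 0) s = 0"
  by (induction s) simp_all

lemma cupl_zero_left [simp]: "cupl (\<lambda>s. 0) e s = 0"
  by (induction s) simp_all

lemma cupl_assoc: "cupl (cupl c e) f s = cupl c (cupl e f) s"
proof (induction s arbitrary: c e)
  case (Cons x s)
  have "cupl (\<lambda>t. cupl c e (x # t)) f s = cupl (\<lambda>t. c [x] * e (x # t) + cupl (\<lambda>t. c (x # t)) e t) f s"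
    by simp
  also have "\<dots> = c [x] * cupl (\<lambda>t. e (x # t)) f s + cupl (\<lambda>t. c (x # t)) (cupl e f) s"
    by (simp only: cupl_add_left cupl_scale_left Cons)
  finally show ?case by (simp add: algebra_simps)
qed simp

lemma bd_cupl:
  "bd (cupl c e) s = cupl (bd c) e s + cupl c (bd e) s + c [] * e s + c s * e []"
proof (induction s arbitrary: c)
  case (Cons x s)
  have 1: "bd (\<lambda>t. cupl c e (x # t)) s = bd (\<lambda>t. c [x] * e (x # t) + cupl (\<lambda>t. c (x # t)) e t) s"
    by simp
  have 2: "cupl (\<lambda>t. bd c (x # t)) e s = cupl (\<lambda>t. c t + bd (\<lambda>t. c (x # t)) t) e s"
    by simp
  have "bd (cupl c e) (x # s) = cupl c e s + c [x] * bd (\<lambda>t. e (x # t)) s +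
    (cupl (bd (\<lambda>t. c (x # t))) e s + cupl (\<lambda>t. c (x # t)) (bd e) s + c [x] * e s + c (x # s) * e [])"
    by (simp only: bd.simps 1 bd_add bd_scale Cons ac_simps)
  moreover have "cupl (bd c) e (x # s) = c [] * e (x # s) + (cupl c e s + cupl (bd (\<lambda>t. c (x # t))) e s)"
    by (simp only: cupl.simps 2 cupl_add_left bd.simps add.right_neutral)
  moreover have "cupl c (bd e) (x # s) = c [x] * (e s + bd (\<lambda>t. e (x # t)) s) + cupl (\<lambda>t. c (x # t)) (bd e) s"
    by simp
  ultimately show ?case by (simp add: algebra_simps)
qed simp

lemma prism_add: "prism f g (\<lambda>s. c s + e s) s = prism f g c s + prism f g e s"
  by (induction s arbitrary: c e) (simp_all add: ac_simps)

lemma bd_map: "bd (\<lambda>t. c (map g t)) s = bd c (map g s)"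
  by (induction s arbitrary: c) simp_all

lemma cupl_map: "cupl (\<lambda>t. c (map g t)) (\<lambda>t. e (map g t)) s = cupl c e (map g s)"
proof (induction s arbitrary: c)
  case (Cons x s)
  show ?case using Cons[of "\<lambda>t. c (g x # t)"] by simp
qed simp

text \<open>The homotopy identity. The faces of the form f x0, ..., f xi, g x(i+1), ..., g xk
  telescope, so that only the list with \<open>f\<close> throughout and the one with
  \<open>g\<close> throughout survive.\<close>

lemma bd_prism: "bd (prism f g c) s + prism f g (bd c) s = c (map f s) + c (map g s)"
proof (induction s arbitrary: c)
  case (Cons x s)
  have 1: "bd (\<lambda>t. prism f g c (x # t)) s
      = bd (\<lambda>t. c (f x # g x # map g t) + prism f g (\<lambda>t. c (f x # t)) t) s" by simp
  have 2: "prism f g (\<lambda>t. bd c (f x # t)) s = prism f g (\<lambda>t. c t + bd (\<lambda>t. c (f x # t)) t) s"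
    by simp
  have "bd (prism f g c) (x # s) = prism f g c s +
      (bd (\<lambda>t. c (f x # g x # t)) (map g s) + bd (prism f g (\<lambda>t. c (f x # t))) s)"
    by (simp only: bd.simps 1 bd_add bd_map[of "\<lambda>t. c (f x # g x # t)"])
  moreover have "prism f g (bd c) (x # s) =
      (c (g x # map g s) + c (f x # map g s) + bd (\<lambda>t. c (f x # g x # t)) (map g s)) +
      (prism f g c s + prism f g (bd (\<lambda>t. c (f x # t))) s)"
    by (simp only: prism.simps 2 prism_add) simp
  ultimately have "bd (prism f g c) (x # s) + prism f g (bd c) (x # s) =
      c (g x # map g s) + c (f x # map g s) +
      (bd (prism f g (\<lambda>t. c (f x # t))) s + prism f g (bd (\<lambda>t. c (f x # t))) s)"
    by (simp add: algebra_simps)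
  then show ?case by (simp only: Cons) (simp add: algebra_simps)
qed simp

text \<open>The length condition makes this applicable to functions that agree in one degree only,
  such as a cochain and its truncation.\<close>

lemma bd_cong:
  "(\<And>t. set t \<subseteq> set s \<Longrightarrow> length s = Suc (length t) \<Longrightarrow> c t = e t) \<Longrightarrow> bd c s = bd e s"
proof (induction s arbitrary: c e)
  case (Cons x s)
  have "bd (\<lambda>t. c (x # t)) s = bd (\<lambda>t. e (x # t)) s"
    by (rule Cons.IH, rule Cons.prems) auto
  then show ?case using Cons.prems[of s] by auto
qed simp

lemma cupl_cong:
  assumes "\<And>t. t \<noteq> [] \<Longrightarrow> set t \<subseteq> set s \<Longrightarrow> c t = c' t"
    and "\<And>t. t \<noteq> [] \<Longrightarrow> set t \<subseteq> set s \<Longrightarrow> e t = e' t"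
  shows "cupl c e s = cupl c' e' s"
  using assms
proof (induction s arbitrary: c c')
  case (Cons x s)
  have "cupl (\<lambda>t. c (x # t)) e s = cupl (\<lambda>t. c' (x # t)) e' s"
    by (rule Cons.IH, rule Cons.prems, simp, fastforce, rule Cons.prems, simp, fastforce)
  then show ?case using Cons.prems(1)[of "[x]"] Cons.prems(2)[of "x # s"] by simp
qed simp

lemma prism_cong:
  assumes "\<And>t. t \<noteq> [] \<Longrightarrow> set t \<subseteq> f ` set s \<union> g ` set s \<Longrightarrow> c t = e t"
  shows "prism f g c s = prism f g e s"
  using assms
proof (induction s arbitrary: c e)
  case (Cons x s)
  have "prism f g (\<lambda>t. c (f x # t)) s = prism f g (\<lambda>t. e (f x # t)) s"
    by (rule Cons.IH, rule Cons.prems) auto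
  then show ?case using Cons.prems[of "f x # g x # map g s"] by auto
qed simp

section \<open>Cochains on nerves\<close>

lemma nerveI: "s \<noteq> [] \<Longrightarrow> set s \<subseteq> U \<Longrightarrow> (\<And>u. u \<in> set s \<Longrightarrow> x \<in> u) \<Longrightarrow> s \<in> nerve U"
  unfolding nerve_def by blast

lemma nerveE:
  assumes "s \<in> nerve U"
  obtains x where "s \<noteq> []" "set s \<subseteq> U" "\<forall>u \<in> set s. x \<in> u"
  using assms by (auto simp: nerve_def)

lemma nerve_subset: "s \<in> nerve U \<Longrightarrow> set t \<subseteq> set s \<Longrightarrow> t \<noteq> [] \<Longrightarrow> t \<in> nerve U"
  unfolding nerve_def by blast

lemma Nil_notin_nerve [simp]: "[] \<notin> nerve U"
  by (simp add: nerve_def)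

lemma cochains_Nil [simp]: "c \<in> cochains U \<Longrightarrow> c [] = 0"
  by (simp add: cochains_def)

lemma coboundary_bd: "coboundary U c = (\<lambda>s. if s \<in> nerve U then bd c s else 0)"
  by (rule ext) (simp add: coboundary_def bd_altdef)

lemma cup_cupl: "cup U c e = (\<lambda>s. if s \<in> nerve U then cupl c e s else 0)"
  by (rule ext) (simp add: cup_def cupl_altdef)

lemma cochainsI:
  assumes "\<And>s. s \<notin> nerve U \<Longrightarrow> c s = 0" "\<And>s. length s > N \<Longrightarrow> c s = 0"
  shows "c \<in> cochains U"
  using assms unfolding cochains_def by blast

lemma cochainsE:
  assumes "c \<in> cochains U"
  obtains N where "\<forall>s. s \<notin> nerve U \<longrightarrow> c s = 0" "\<forall>s. length s > N \<longrightarrow> c s = 0"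
proof -
  obtain N where "\<forall>s. length s > N \<longrightarrow> c s = 0" using assms by (auto simp: cochains_def)
  with assms show ?thesis by (intro that[of N]) (auto simp: cochains_def)
qed

lemma cochains_zero [simp]: "(\<lambda>s. 0) \<in> cochains U"
  by (simp add: cochains_def)

lemma cochains_add [intro]: "c \<in> cochains U \<Longrightarrow> e \<in> cochains U \<Longrightarrow> (\<lambda>s. c s + e s :: bit) \<in> cochains U"
proof -
  assume "c \<in> cochains U" "e \<in> cochains U"
  then obtain N M where "\<forall>s. s \<notin> nerve U \<longrightarrow> c s = 0" "\<forall>s. length s > N \<longrightarrow> c s = 0"
     "\<forall>s. s \<notin> nerve U \<longrightarrow> e s = 0" "\<forall>s. length s > M \<longrightarrow> e s = 0"
    by (metis cochainsE)
  then show ?thesis by (intro cochainsI[of U _ "max N M"]) auto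
qed

lemma cochains_scale [intro]: "c \<in> cochains U \<Longrightarrow> (\<lambda>s. k * c s :: bit) \<in> cochains U"
  by (cases k) auto

lemma coboundary_cochains [intro]:
  fixes c :: "'a set list \<Rightarrow> bit"
  assumes "c \<in> cochains U" shows "coboundary U c \<in> cochains U"
proof -
  obtain N where N: "\<forall>s. s \<notin> nerve U \<longrightarrow> c s = 0" "\<forall>s. length s > N \<longrightarrow> c s = 0"
    using assms by (rule cochainsE)
  show ?thesis
  proof (rule cochainsI[of U _ "Suc N"])
    fix s :: "'a set list" assume "length s > Suc N"
    then have "bd c s = bd (\<lambda>t. 0) s"
    proof (intro bd_cong)
      fix t :: "'a set list" assume "Suc N < length s" "length s = Suc (length t)"
      then have "N < length t" by simp
      then show "c t = 0" using N(2) by auto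
    qed
    then show "coboundary U c s = 0" by (simp add: coboundary_bd)
  qed (simp add: coboundary_bd)
qed

lemma coboundary_coboundary [simp]:
  fixes c :: "_ \<Rightarrow> bit"
  assumes "c \<in> cochains U" shows "coboundary U (coboundary U c) = (\<lambda>s. 0)"
proof
  fix s
  have "bd (coboundary U c) s = bd (bd c) s" if "s \<in> nerve U"
  proof (rule bd_cong)
    fix t assume t: "set t \<subseteq> set s" "length s = Suc (length t)"
    show "coboundary U c t = bd c t"
      using t that by (cases "t = []") (auto simp: coboundary_bd nerve_subset)
  qed
  then show "coboundary U (coboundary U c) s = 0"
    by (simp add: coboundary_bd[of U "coboundary U c"] bd_bd)
qed

lemma coboundary_add:
  fixes c :: "_ \<Rightarrow> bit"
  shows "coboundary U (\<lambda>s. c s + e s) = (\<lambda>s. coboundary U c s + coboundary U e s)"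
  by (rule ext) (simp add: coboundary_bd bd_add)

lemma coboundary_scale: "coboundary U (\<lambda>s. k * c s) = (\<lambda>s. k * coboundary U c s :: bit)"
  by (rule ext) (simp add: coboundary_bd bd_scale)

lemma coboundary_zero [simp]: "coboundary U (\<lambda>s. 0 :: bit) = (\<lambda>s. 0)"
  using coboundary_scale[of U 0] by simp

lemma cup_cochains [intro]:
  fixes c e :: "'a set list \<Rightarrow> bit"
  assumes "c \<in> cochains U" "e \<in> cochains U" shows "cup U c e \<in> cochains U"
proof -
  obtain N M where N: "\<forall>s. s \<notin> nerve U \<longrightarrow> c s = 0" "\<forall>s. length s > N \<longrightarrow> c s = 0"
     "\<forall>s. s \<notin> nerve U \<longrightarrow> e s = 0" "\<forall>s. length s > M \<longrightarrow> e s = 0"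
    using assms by (metis cochainsE)
  show ?thesis
  proof (rule cochainsI[of U _ "N + M"])
    fix s :: "'a set list" assume s: "length s > N + M"
    \<comment> \<open>The lengths of front and back face add up to \<open>length s + 1\<close>, so
      the front face is longer than \<open>N\<close> or the back face is longer than
      \<open>M\<close>.\<close>
    have "c (take (Suc i) s) * e (drop i s) = 0" if "i < length s" for i
      using s that by (cases "Suc i > N") (simp_all add: N)
    then show "cup U c e s = 0" unfolding cup_def by (auto intro!: sum.neutral simp del: mult_eq_0_iff)
  qed (simp add: cup_def)
qed

lemma cup_add_left: "cup U (\<lambda>s. c s + c' s) e = (\<lambda>s. cup U c e s + cup U c' e s)" for e :: "_ \<Rightarrow> bit"
  by (rule ext) (simp add: cup_cupl cupl_add_left)

lemma cup_add_right: "cup U c (\<lambda>s. e s + e' s) = (\<lambda>s. cup U c e s + cup U c e' s)" for e :: "_ \<Rightarrow> bit"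
  by (rule ext) (simp add: cup_cupl cupl_add_right)

lemma cup_zero_right [simp]: "cup U c (\<lambda>s. 0) = (\<lambda>s. 0)"
  by (rule ext) (simp add: cup_def)

lemma cup_zero_left [simp]: "cup U (\<lambda>s. 0) c = (\<lambda>s. 0)"
  by (rule ext) (simp add: cup_def)

lemma cup_assoc:
  fixes c :: "_ \<Rightarrow> bit"
  shows "cup U (cup U c e) f = cup U c (cup U e f)"
proof
  fix s
  have "cupl (cup U c e) f s = cupl (cupl c e) f s" if "s \<in> nerve U"
    using nerve_subset[OF that] by (intro cupl_cong) (auto simp: cup_cupl)
  moreover have "cupl c (cup U e f) s = cupl c (cupl e f) s" if "s \<in> nerve U"
    using nerve_subset[OF that] by (intro cupl_cong) (auto simp: cup_cupl)
  ultimately show "cup U (cup U c e) f s = cup U c (cup U e f) s"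
    by (simp add: cup_cupl[of U "cup U c e"] cup_cupl[of U c "cup U e f"] cupl_assoc)
qed

lemma coboundary_cup:
  fixes c e :: "_ \<Rightarrow> bit"
  assumes "c \<in> cochains U" "e \<in> cochains U"
  shows "coboundary U (cup U c e) = (\<lambda>s. cup U (coboundary U c) e s + cup U c (coboundary U e) s)"
proof
  fix s
  show "coboundary U (cup U c e) s = cup U (coboundary U c) e s + cup U c (coboundary U e) s"
  proof (cases "s \<in> nerve U")
    case True
    have "bd (cup U c e) s = bd (cupl c e) s"
    proof (rule bd_cong)
      fix t assume t: "set t \<subseteq> set s"
      show "cup U c e t = cupl c e t"
        using nerve_subset[OF True t] by (cases "t = []") (auto simp: cup_cupl)
    qed
    moreover have "cupl (coboundary U c) e s = cupl (bd c) e s"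
      using nerve_subset[OF True] by (intro cupl_cong) (auto simp: coboundary_bd)
    moreover have "cupl c (coboundary U e) s = cupl c (bd e) s"
      using nerve_subset[OF True] by (intro cupl_cong) (auto simp: coboundary_bd)
    ultimately show ?thesis
      using True assms by (simp add: coboundary_bd[of U "cup U c e"] cup_cupl[of U "coboundary U c"]
          cup_cupl[of U c "coboundary U e"] bd_cupl)
  qed (simp add: coboundary_bd cup_cupl)
qed

lemma cupl_unit_left: "cupl (\<lambda>t. if length t = 1 then 1 else 0) c s = (if s = [] then 0 else c s)"
proof (cases s)
  case (Cons x t)
  have "cupl (\<lambda>t. if t = [] then 1 else 0) c t = 0" for t
  proof -
    have "cupl (\<lambda>t. if t = [] then 1 else 0) c t = cupl (\<lambda>t. 0) c t"
      by (rule cupl_cong) auto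
    then show ?thesis by simp
  qed
  then show ?thesis using Cons by simp
qed simp

lemma cupl_unit_right: "cupl c (\<lambda>t. if length t = 1 then 1 else 0) s = (if s = [] then 0 else c s)"
proof (induction s arbitrary: c)
  case (Cons x s)
  then show ?case by (cases s) auto
qed simp

lemma unit_cochain_cochains [simp]: "unit_cochain U \<in> cochains U"
  by (rule cochainsI[of U _ 1]) (auto simp: unit_cochain_def)

lemma cup_unit_left [simp]:
  fixes c :: "_ \<Rightarrow> bit"
  assumes "c \<in> cochains U" shows "cup U (unit_cochain U) c = c"
proof
  fix s
  have "cupl (unit_cochain U) c s = cupl (\<lambda>t. if length t = 1 then 1 else 0) c s" if "s \<in> nerve U"
    using nerve_subset[OF that] by (intro cupl_cong) (auto simp: unit_cochain_def)
  then show "cup U (unit_cochain U) c s = c s"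
    using assms cupl_unit_left[of c s] by (auto simp: cup_cupl cochains_def)
qed

lemma cup_unit_right [simp]:
  fixes c :: "_ \<Rightarrow> bit"
  assumes "c \<in> cochains U" shows "cup U c (unit_cochain U) = c"
proof
  fix s
  have "cupl c (unit_cochain U) s = cupl c (\<lambda>t. if length t = 1 then 1 else 0) s" if "s \<in> nerve U"
    using nerve_subset[OF that] by (intro cupl_cong) (auto simp: unit_cochain_def)
  then show "cup U c (unit_cochain U) s = c s"
    using assms cupl_unit_right[of c s] by (auto simp: cup_cupl cochains_def)
qed

lemma coboundary_unit_cochain [simp]: "coboundary U (unit_cochain U :: _ \<Rightarrow> bit) = (\<lambda>s. 0)"
proof
  fix s
  show "coboundary U (unit_cochain U :: _ \<Rightarrow> bit) s = 0"
  proof (cases "s \<in> nerve U")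
    case True
    have "bd (unit_cochain U :: _ \<Rightarrow> bit) s = 0"
    proof (cases "length s = 2")
      case True
      then obtain x y where s: "s = [x, y]" by (auto simp: length_Suc_conv numeral_2_eq_2)
      have "[x] \<in> nerve U" "[y] \<in> nerve U"
        using nerve_subset[OF \<open>s \<in> nerve U\<close>] s by auto
      then show ?thesis by (simp add: s unit_cochain_def)
    next
      case False
      then have "bd (unit_cochain U :: _ \<Rightarrow> bit) s = bd (\<lambda>t. 0) s"
        by (intro bd_cong) (auto simp: unit_cochain_def)
      then show ?thesis by simp
    qed
    then show ?thesis by (simp add: coboundary_bd)
  qed (simp add: coboundary_bd)
qed

text \<open>A list of length \<open>j\<close> is a simplex of dimension \<open>j - 1\<close>.\<close>

definition trunc :: "nat \<Rightarrow> ('v list \<Rightarrow> bit) \<Rightarrow> 'v list \<Rightarrow> bit"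
  where "trunc j c s = (if length s = j then c s else 0)"

lemma trunc_cochains [intro]: "c \<in> cochains U \<Longrightarrow> trunc j c \<in> cochains U"
  unfolding cochains_def trunc_def by auto

lemma coboundary_trunc: "coboundary U (trunc j c) = trunc (Suc j) (coboundary U c)"
proof
  fix s
  have "bd (trunc j c) s = bd c s" if "length s = Suc j"
    using that by (intro bd_cong) (auto simp: trunc_def)
  moreover have "bd (trunc j c) s = bd (\<lambda>t. 0) s" if "length s \<noteq> Suc j"
    using that by (intro bd_cong) (auto simp: trunc_def)
  ultimately show "coboundary U (trunc j c) s = trunc (Suc j) (coboundary U c) s"
    by (simp add: coboundary_bd trunc_def)
qed

lemma trunc_eq: "(\<forall>s. length s \<noteq> j \<longrightarrow> c s = 0) \<longleftrightarrow> trunc j c = c"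
  by (auto simp: trunc_def fun_eq_iff)

lemma trunc_trunc: "trunc i (trunc j c) = (if i = j then trunc i c else (\<lambda>s. 0))"
  by (auto simp: trunc_def fun_eq_iff)

lemma trunc_add: "trunc j (\<lambda>s. c s + e s) = (\<lambda>s. trunc j c s + trunc j e s)"
  by (auto simp: trunc_def fun_eq_iff)

lemma trunc_zero [simp]: "trunc j (\<lambda>s. 0) = (\<lambda>s. 0)"
  by (auto simp: trunc_def fun_eq_iff)

text \<open>Front and back face share a vertex: lengths \<open>i + 1\<close> and
  \<open>j + 1\<close> combine to \<open>i + j + 1\<close>.\<close>

lemma cup_trunc:
  assumes "trunc (Suc i) c = c" "trunc (Suc j) e = e"
  shows "trunc (Suc (i + j)) (cup U c e) = cup U c e"
proof
  fix s
  have c: "length t \<noteq> Suc i \<Longrightarrow> c t = 0" for t using assms(1) by (metis trunc_def)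
  have e: "length t \<noteq> Suc j \<Longrightarrow> e t = 0" for t using assms(2) by (metis trunc_def)
  have "cup U c e s = 0" if "length s \<noteq> Suc (i + j)"
  proof -
    have "c (take (Suc k) s) * e (drop k s) = 0" if "k < length s" for k
      using that \<open>length s \<noteq> Suc (i + j)\<close> by (cases "k = i") (auto simp: c e)
    then show ?thesis unfolding cup_def by (auto intro!: sum.neutral simp del: mult_eq_0_iff)
  qed
  then show "trunc (Suc (i + j)) (cup U c e) s = cup U c e s" by (simp add: trunc_def)
qed

section \<open>Simplicial maps between nerves, and the homotopy between two refinement maps\<close>

text \<open>Weaker than being a refinement map, in order to cover the involution on a cover and the
  projection to a cover of the orbit space, neither of which enlarges the sets it is applied
  to.\<close>

definition simplicial :: "'v set set \<Rightarrow> 'u set set \<Rightarrow> ('v set \<Rightarrow> 'u set) \<Rightarrow> bool"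
  where "simplicial W U f \<longleftrightarrow> (\<forall>s \<in> nerve W. map f s \<in> nerve U)"

lemma refinement_map_simplicial: "refinement_map W U f \<Longrightarrow> simplicial W U f"
  unfolding simplicial_def
proof
  fix s assume f: "refinement_map W U f" and "s \<in> nerve W"
  then obtain x where "s \<noteq> []" "set s \<subseteq> W" "\<forall>u \<in> set s. x \<in> u" by (metis nerveE)
  with f show "map f s \<in> nerve U"
    by (intro nerveI[of _ _ x]) (auto simp: refinement_map_def)
qed

text \<open>Unlike \<open>pull_cochain\<close>, this allows covers of different spaces.\<close>

definition pullback :: "'v set set \<Rightarrow> ('v set \<Rightarrow> 'u set) \<Rightarrow> ('u set list \<Rightarrow> 'k::comm_ring_1) \<Rightarrow> 'v set list \<Rightarrow> 'k"
  where "pullback W f c s = (if s \<in> nerve W then c (map f s) else 0)"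

lemma pullback_cochains [intro]:
  assumes "c \<in> cochains U" shows "pullback W f c \<in> cochains W"
proof -
  obtain N where "\<forall>s. length s > N \<longrightarrow> c s = 0" using assms by (rule cochainsE)
  then show ?thesis by (intro cochainsI[of W _ N]) (auto simp: pullback_def)
qed

lemma pullback_coboundary:
  fixes c :: "_ \<Rightarrow> bit"
  assumes "simplicial W U f" and "c [] = 0"
  shows "coboundary W (pullback W f c) = pullback W f (coboundary U c)"
proof
  fix s
  have "bd (pullback W f c) s = bd (\<lambda>t. c (map f t)) s" if s: "s \<in> nerve W"
  proof (rule bd_cong)
    fix t assume t: "set t \<subseteq> set s"
    show "pullback W f c t = c (map f t)"
      using nerve_subset[OF s t] \<open>c [] = 0\<close> by (cases "t = []") (auto simp: pullback_def)
  qed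
  then show "coboundary W (pullback W f c) s = pullback W f (coboundary U c) s"
    using assms by (simp add: coboundary_bd bd_map simplicial_def) (simp add: pullback_def)
qed

lemma pullback_cup:
  fixes c e :: "_ \<Rightarrow> bit"
  assumes "simplicial W U f"
  shows "cup W (pullback W f c) (pullback W f e) = pullback W f (cup U c e)"
proof
  fix s
  have "cupl (pullback W f c) (pullback W f e) s = cupl (\<lambda>t. c (map f t)) (\<lambda>t. e (map f t)) s"
    if s: "s \<in> nerve W"
    using nerve_subset[OF s] by (intro cupl_cong) (auto simp: pullback_def)
  then show "cup W (pullback W f c) (pullback W f e) s = pullback W f (cup U c e) s"
    using assms by (simp add: cup_cupl cupl_map simplicial_def) (simp add: pullback_def)
qed

lemma pullback_add: "pullback W f (\<lambda>s. c s + e s) = (\<lambda>s. pullback W f c s + pullback W f e s)"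
  by (auto simp: pullback_def fun_eq_iff)

lemma pullback_scale: "pullback W f (\<lambda>s. k * c s) = (\<lambda>s. k * pullback W f c s)"
  by (auto simp: pullback_def fun_eq_iff)

lemma pullback_zero [simp]: "pullback W f (\<lambda>s. 0) = (\<lambda>s. 0)"
  by (auto simp: pullback_def fun_eq_iff)

lemma pullback_trunc: "pullback W f (trunc j c) = trunc j (pullback W f c)"
  by (auto simp: pullback_def trunc_def fun_eq_iff)

lemma pullback_pull: "simplicial W V f \<Longrightarrow> pullback W f (pullback V g c) = pullback W (g \<circ> f) c"
  by (auto simp: pullback_def fun_eq_iff simplicial_def)

lemma pullback_cong: "(\<And>w. w \<in> W \<Longrightarrow> f w = g w) \<Longrightarrow> pullback W f c = pullback W g c"
  unfolding pullback_def nerve_def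
  by (rule ext) (metis (mono_tags, lifting) map_eq_conv mem_Collect_eq subsetD)

lemma pullback_unit: "simplicial W U f \<Longrightarrow> pullback W f (unit_cochain U) = unit_cochain W"
  by (auto simp: pullback_def unit_cochain_def simplicial_def fun_eq_iff)

lemma pull_cochain_pullback: "pull_cochain W f c = pullback W f c"
  by (simp add: pull_cochain_def pullback_def fun_eq_iff)

lemma pull_cochains [intro]:
  assumes "c \<in> cochains U" shows "pull_cochain W f c \<in> cochains W"
  using assms unfolding pull_cochain_pullback by (rule pullback_cochains)

lemma pull_coboundary:
  fixes c :: "_ \<Rightarrow> bit"
  assumes "simplicial W U f" and "c [] = 0"
  shows "coboundary W (pull_cochain W f c) = pull_cochain W f (coboundary U c)"
  using assms unfolding pull_cochain_pullback by (rule pullback_coboundary)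

lemma pull_cup:
  fixes c e :: "_ \<Rightarrow> bit"
  assumes "simplicial W U f"
  shows "cup W (pull_cochain W f c) (pull_cochain W f e) = pull_cochain W f (cup U c e)"
  using assms unfolding pull_cochain_pullback by (rule pullback_cup)

lemma pull_add: "pull_cochain W f (\<lambda>s. c s + e s) = (\<lambda>s. pull_cochain W f c s + pull_cochain W f e s)"
  unfolding pull_cochain_pullback by (rule pullback_add)

lemma pull_scale: "pull_cochain W f (\<lambda>s. k * c s) = (\<lambda>s. k * pull_cochain W f c s)"
  unfolding pull_cochain_pullback by (rule pullback_scale)

lemma pull_zero [simp]: "pull_cochain W f (\<lambda>s. 0) = (\<lambda>s. 0)"
  unfolding pull_cochain_pullback by (rule pullback_zero)

lemma pull_trunc: "pull_cochain W f (trunc j c) = trunc j (pull_cochain W f c)"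
  unfolding pull_cochain_pullback by (rule pullback_trunc)

lemma pull_pull: "simplicial W V f \<Longrightarrow> pull_cochain W f (pull_cochain V g c) = pull_cochain W (g \<circ> f) c"
  unfolding pull_cochain_pullback by (rule pullback_pull)

lemma pull_cong: "(\<And>w. w \<in> W \<Longrightarrow> f w = g w) \<Longrightarrow> pull_cochain W f c = pull_cochain W g c"
  unfolding pull_cochain_pullback by (rule pullback_cong)

lemma pull_id: "c \<in> cochains W \<Longrightarrow> (\<And>w. w \<in> W \<Longrightarrow> f w = w) \<Longrightarrow> pull_cochain W f c = c"
  using pullback_cong[of W f id c] by (auto simp: pull_cochain_pullback pullback_def cochains_def fun_eq_iff)

lemma pull_unit: "simplicial W U f \<Longrightarrow> pull_cochain W f (unit_cochain U) = unit_cochain W"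
  unfolding pull_cochain_pullback by (rule pullback_unit)

text \<open>Two refinement maps are contiguous: a point common to the members of a simplex lies in
  their images under both \<open>f\<close> and \<open>g\<close>. The mixed lists in the prism are
  therefore simplices of \<open>U\<close>, where the cocycle condition applies.\<close>

lemma prism_homotopy:
  fixes c :: "'a set list \<Rightarrow> bit"
  assumes f: "refinement_map W U f" and g: "refinement_map W U g"
    and c: "c \<in> cochains U" and dc: "coboundary U c = (\<lambda>s. 0)"
  shows "\<exists>e \<in> cochains W. \<forall>s. pull_cochain W f c s + pull_cochain W g c s = coboundary W e s"
proof (intro bexI allI)
  let ?e = "\<lambda>s. if s \<in> nerve W then prism f g c s else 0"
  have nv: "t \<in> nerve U" if s: "s \<in> nerve W" and t: "t \<noteq> []" "set t \<subseteq> f ` set s \<union> g ` set s" for s t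
  proof -
    obtain x where x: "s \<noteq> []" "set s \<subseteq> W" "\<forall>u \<in> set s. x \<in> u" using s by (rule nerveE)
    show ?thesis
      using t x f g unfolding refinement_map_def
      by (intro nerveI[of _ _ x]) (blast, blast, blast)
  qed
  obtain N where N: "\<forall>s. length s > N \<longrightarrow> c s = 0" using c by (rule cochainsE)
  \<comment> \<open>The prism operator evaluates \<open>c\<close> only on lists one longer than
    \<open>s\<close>, so the length bound of \<open>c\<close> still serves.\<close>
  have pz: "prism f g c s = 0" if "\<And>t. length t > length s \<Longrightarrow> c t = 0" for s c
    using that
  proof (induction s arbitrary: c)
    case (Cons x s)
    then show ?case by simp
  qed simp
  show "?e \<in> cochains W"
  proof (rule cochainsI[of W _ N])
    fix s :: "'a set list" assume "N < length s"
    then have "prism f g c s = 0" by (intro pz) (simp add: N)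
    then show "?e s = 0" by simp
  qed simp
  fix s
  show "pull_cochain W f c s + pull_cochain W g c s = coboundary W ?e s"
  proof (cases "s \<in> nerve W")
    case True
    have "bd ?e s = bd (prism f g c) s"
    proof (rule bd_cong)
      fix t assume t: "set t \<subseteq> set s"
      show "?e t = prism f g c t"
        using nerve_subset[OF True t] by (cases "t = []") auto
    qed
    moreover have "prism f g (bd c) s = prism f g (\<lambda>t. 0) s"
    proof (rule prism_cong)
      fix t assume "t \<noteq> []" "set t \<subseteq> f ` set s \<union> g ` set s"
      then have "bd c t = coboundary U c t" using nv[OF True] by (simp add: coboundary_bd)
      then show "bd c t = 0" by (simp add: dc)
    qed
    moreover have "prism f g (\<lambda>t. 0) s = 0"
      using prism_add[of f g "\<lambda>t. 0" "\<lambda>t. 0"] by simp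
    ultimately show ?thesis
      using bd_prism[of f g c s] True by (simp add: pull_cochain_def coboundary_bd)
  qed (simp add: pull_cochain_def coboundary_bd)
qed

section \<open>The Cech cohomology ring with coefficients in the field of two elements\<close>

definition refines :: "'a set set \<Rightarrow> 'a set set \<Rightarrow> bool"
  where "refines W U \<longleftrightarrow> (\<forall>w \<in> W. \<exists>u \<in> U. w \<subseteq> u)"

lemma refines_refinement_map: "refines W U \<Longrightarrow> \<exists>f. refinement_map W U f"
  unfolding refines_def refinement_map_def by metis

lemma refinement_map_refines: "refinement_map W U f \<Longrightarrow> refines W U"
  unfolding refines_def refinement_map_def by metis

lemma refines_trans: "refines W V \<Longrightarrow> refines V U \<Longrightarrow> refines W U"
  unfolding refines_def by (meson order_trans)

lemma refinement_map_comp: "refinement_map W V f \<Longrightarrow> refinement_map V U g \<Longrightarrow> refinement_map W U (g \<circ> f)"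
  unfolding refinement_map_def by fastforce

lemma common_refinement:
  assumes "open_cover X U" "open_cover X V"
  shows "\<exists>W. open_cover X W \<and> refines W U \<and> refines W V"
proof (intro exI conjI)
  let ?W = "{u \<inter> v | u v. u \<in> U \<and> v \<in> V}"
  show "open_cover X ?W"
    unfolding open_cover_def
  proof (intro conjI ballI subset_antisym subsetI)
    fix x assume "x \<in> topspace X"
    then obtain u v where "u \<in> U" "x \<in> u" "v \<in> V" "x \<in> v" using assms unfolding open_cover_def by blast
    then show "x \<in> \<Union>?W" by blast
  qed (use assms in \<open>auto simp: open_cover_def openin_Int\<close>)
qed (auto simp: refines_def)

lemma cocycleI: "open_cover X U \<Longrightarrow> c \<in> cochains U \<Longrightarrow> coboundary U c = (\<lambda>s. 0) \<Longrightarrow> (U, c) \<in> cech_cocycles X"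
  by (simp add: cech_cocycles_def)

lemma cocycleD:
  assumes "(U, c) \<in> cech_cocycles X"
  shows "open_cover X U" "c \<in> cochains U" "coboundary U c = (\<lambda>s. 0)"
  using assms by (simp_all add: cech_cocycles_def)

lemma cech_relI:
  fixes c :: "'a set list \<Rightarrow> bit"
  assumes "(U, c) \<in> cech_cocycles X" "(V, d) \<in> cech_cocycles X"
    "open_cover X W" "refinement_map W U f" "refinement_map W V g" "e \<in> cochains W"
    "\<And>s. pull_cochain W f c s + pull_cochain W g d s = coboundary W e s"
  shows "((U, c), (V, d)) \<in> cech_rel X"
  using assms by (auto simp: cech_rel_def)

lemma cocycle_pull:
  fixes c :: "'a set list \<Rightarrow> bit"
  assumes "(U, c) \<in> cech_cocycles X" "open_cover X W" "refinement_map W U f"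
  shows "(W, pull_cochain W f c) \<in> cech_cocycles X"
  using assms(2) cocycleD[OF assms(1)] pull_coboundary[OF refinement_map_simplicial[OF assms(3)], of c]
  by (intro cocycleI) auto

text \<open>Since refinement maps are homotopic, a relation that holds on one cover holds on every
  finer cover for every choice of refinement maps.\<close>

lemma cech_rel_refine:
  fixes c :: "'a set list \<Rightarrow> bit"
  assumes "((U, c), (V, d)) \<in> cech_rel X"
  obtains Z where "open_cover X Z"
    "\<And>W f g. refines W Z \<Longrightarrow> refinement_map W U f \<Longrightarrow> refinement_map W V g \<Longrightarrow>
      \<exists>e \<in> cochains W. \<forall>s. pull_cochain W f c s + pull_cochain W g d s = coboundary W e s"
proof -
  obtain Z f0 g0 e0 where Z: "open_cover X Z" "refinement_map Z U f0" "refinement_map Z V g0"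
      "e0 \<in> cochains Z" "\<forall>s. pull_cochain Z f0 c s - pull_cochain Z g0 d s = coboundary Z e0 s"
    and c: "(U, c) \<in> cech_cocycles X" and d: "(V, d) \<in> cech_cocycles X"
    using assms unfolding cech_rel_def by blast
  have e0: "pull_cochain Z f0 c s + pull_cochain Z g0 d s = coboundary Z e0 s" for s
    using Z(5) by simp
  have "\<exists>e \<in> cochains W. \<forall>s. pull_cochain W f c s + pull_cochain W g d s = coboundary W e s"
    if W: "refines W Z" "refinement_map W U f" "refinement_map W V g" for W f g
  proof -
    obtain h where h: "refinement_map W Z h" using refines_refinement_map[OF W(1)] by blast
    note sh = refinement_map_simplicial[OF h]
    obtain e1 where e1: "e1 \<in> cochains W"
        "\<forall>s. pull_cochain W f c s + pull_cochain W (f0 \<circ> h) c s = coboundary W e1 s"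
      using prism_homotopy[OF W(2) refinement_map_comp[OF h Z(2)]] cocycleD[OF c] by blast
    obtain e2 where e2: "e2 \<in> cochains W"
        "\<forall>s. pull_cochain W g d s + pull_cochain W (g0 \<circ> h) d s = coboundary W e2 s"
      using prism_homotopy[OF W(3) refinement_map_comp[OF h Z(3)]] cocycleD[OF d] by blast
    have e3: "pull_cochain W (f0 \<circ> h) c s + pull_cochain W (g0 \<circ> h) d s = coboundary W (pull_cochain W h e0) s" for s
    proof -
      have "pull_cochain W (f0 \<circ> h) c s + pull_cochain W (g0 \<circ> h) d s =
          pull_cochain W h (\<lambda>s. pull_cochain Z f0 c s + pull_cochain Z g0 d s) s"
        by (simp add: pull_add pull_pull[OF sh])
      also have "\<dots> = pull_cochain W h (coboundary Z e0) s" by (simp only: e0)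
      also have "\<dots> = coboundary W (pull_cochain W h e0) s"
        using pull_coboundary[OF sh, of e0] Z(4) by simp
      finally show ?thesis .
    qed
    let ?e = "\<lambda>s. (e1 s + e2 s) + pull_cochain W h e0 s"
    have "?e \<in> cochains W" using e1(1) e2(1) Z(4) by (intro cochains_add pull_cochains)
    moreover have "pull_cochain W f c s + pull_cochain W g d s = coboundary W ?e s" for s
      unfolding coboundary_add e1(2)[rule_format, symmetric] e2(2)[rule_format, symmetric] e3[symmetric]
      by (simp add: ac_simps)
    ultimately show ?thesis by blast
  qed
  with Z(1) show ?thesis by (rule that)
qed

text \<open>Transitivity is the point: the two given relations reach the middle cover by unrelated
  refinement maps. By \<open>cech_rel_refine\<close> both hold on one common refinement with the
  same map \<open>g\<close>, where the middle terms cancel.\<close>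

lemma equiv_cech_rel: "equiv (cech_cocycles X) (cech_rel X :: (('a set set \<times> ('a set list \<Rightarrow> bit)) \<times> _) set)"
proof (rule equivI)
  show "cech_rel X \<subseteq> cech_cocycles X \<times> cech_cocycles X"
    by (auto simp: cech_rel_def)
  show "refl_on (cech_cocycles X) (cech_rel X :: (('a set set \<times> ('a set list \<Rightarrow> bit)) \<times> _) set)"
  proof (rule refl_onI)
    fix a :: "'a set set \<times> ('a set list \<Rightarrow> bit)" assume a: "a \<in> cech_cocycles X"
    obtain U c where Uc: "a = (U, c)" by fastforce
    show "(a, a) \<in> cech_rel X"
      using a cocycleD[of U c X] unfolding Uc
      by (intro cech_relI[of _ _ _ _ _ U id id "\<lambda>s. 0"]) (auto simp: refinement_map_def)
  qed
  show "sym (cech_rel X :: (('a set set \<times> ('a set list \<Rightarrow> bit)) \<times> _) set)"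
  proof (rule symI)
    fix a b :: "'a set set \<times> ('a set list \<Rightarrow> bit)" assume ab: "(a, b) \<in> cech_rel X"
    obtain U c where Uc: "a = (U, c)" by fastforce
    obtain V d where Vd: "b = (V, d)" by fastforce
    obtain Z f0 g0 e0 where Z: "open_cover X Z" "refinement_map Z U f0" "refinement_map Z V g0"
      "e0 \<in> cochains Z" "\<forall>s. pull_cochain Z f0 c s - pull_cochain Z g0 d s = coboundary Z e0 s"
      and c: "(U, c) \<in> cech_cocycles X" and d: "(V, d) \<in> cech_cocycles X"
      using ab unfolding cech_rel_def Uc Vd by blast
    show "(b, a) \<in> cech_rel X" unfolding Uc Vd
      using Z(5) by (intro cech_relI[OF d c Z(1,3,2,4)]) (simp add: add.commute)
  qed
  show "trans (cech_rel X :: (('a set set \<times> ('a set list \<Rightarrow> bit)) \<times> _) set)"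
  proof (rule transI)
    fix a b b' :: "'a set set \<times> ('a set list \<Rightarrow> bit)"
    assume ab: "(a, b) \<in> cech_rel X" and bb: "(b, b') \<in> cech_rel X"
    obtain U c where Uc: "a = (U, c)" by fastforce
    obtain V d where Vd: "b = (V, d)" by fastforce
    obtain V' d' where Vd': "b' = (V', d')" by fastforce
    have cc: "(U, c) \<in> cech_cocycles X" "(V, d) \<in> cech_cocycles X" "(V', d') \<in> cech_cocycles X"
      using ab bb unfolding Uc Vd Vd' cech_rel_def by blast+
    obtain Z where Z: "open_cover X Z" "\<And>W f g. refines W Z \<Longrightarrow> refinement_map W U f \<Longrightarrow> refinement_map W V g \<Longrightarrow>
      \<exists>e \<in> cochains W. \<forall>s. pull_cochain W f c s + pull_cochain W g d s = coboundary W e s"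
      using cech_rel_refine[OF ab[unfolded Uc Vd]] by metis
    obtain Z' where Z': "open_cover X Z'" "\<And>W f g. refines W Z' \<Longrightarrow> refinement_map W V f \<Longrightarrow> refinement_map W V' g \<Longrightarrow>
      \<exists>e \<in> cochains W. \<forall>s. pull_cochain W f d s + pull_cochain W g d' s = coboundary W e s"
      using cech_rel_refine[OF bb[unfolded Vd' Vd]] by metis
    obtain W1 where W1: "open_cover X W1" "refines W1 Z" "refines W1 Z'"
      using common_refinement[OF Z(1) Z'(1)] by blast
    obtain W2 where W2: "open_cover X W2" "refines W2 U" "refines W2 V"
      using common_refinement[OF cocycleD(1)[OF cc(1)] cocycleD(1)[OF cc(2)]] by blast
    obtain W3 where W3: "open_cover X W3" "refines W3 W2" "refines W3 V'"
      using common_refinement[OF W2(1) cocycleD(1)[OF cc(3)]] by blast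
    obtain W where W: "open_cover X W" "refines W W1" "refines W W3"
      using common_refinement[OF W1(1) W3(1)] by blast
    obtain f where f: "refinement_map W U f"
      using refines_refinement_map refines_trans W W3 W2 by metis
    obtain g where g: "refinement_map W V g"
      using refines_refinement_map refines_trans W W3 W2 by metis
    obtain h where h: "refinement_map W V' h"
      using refines_refinement_map refines_trans W W3 W2 by metis
    obtain e1 where e1: "e1 \<in> cochains W" "\<forall>s. pull_cochain W f c s + pull_cochain W g d s = coboundary W e1 s"
      using Z(2)[OF _ f g] refines_trans W W1 by metis
    obtain e2 where e2: "e2 \<in> cochains W" "\<forall>s. pull_cochain W g d s + pull_cochain W h d' s = coboundary W e2 s"
      using Z'(2)[OF _ g h] refines_trans W W1 by metis
    show "(a, b') \<in> cech_rel X"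
      unfolding Uc Vd'
    proof (rule cech_relI[OF cc(1,3) W(1) f h cochains_add[OF e1(1) e2(1)]])
      fix s
      show "pull_cochain W f c s + pull_cochain W h d' s = coboundary W (\<lambda>s. e1 s + e2 s) s"
        unfolding coboundary_add e1(2)[rule_format, symmetric] e2(2)[rule_format, symmetric]
        by (simp add: ac_simps)
    qed
  qed
qed

lemma cech_class_eq_iff:
  fixes c :: "'a set list \<Rightarrow> bit"
  assumes "(U, c) \<in> cech_cocycles X" "(V, d) \<in> cech_cocycles X"
  shows "cech_class X U c = cech_class X V d \<longleftrightarrow> ((U, c), (V, d)) \<in> cech_rel X"
  using eq_equiv_class_iff[OF equiv_cech_rel assms] .

lemma cech_class_pull:
  fixes c :: "'a set list \<Rightarrow> bit"
  assumes "(U, c) \<in> cech_cocycles X" "open_cover X W" "refinement_map W U f"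
  shows "cech_class X W (pull_cochain W f c) = cech_class X U c"
proof -
  note p = cocycle_pull[OF assms]
  have "((W, pull_cochain W f c), (U, c)) \<in> cech_rel X"
  proof (rule cech_relI[OF p assms(1,2) _ assms(3)])
    show "refinement_map W W id" by (simp add: refinement_map_def)
    show "pull_cochain W id (pull_cochain W f c) s + pull_cochain W f c s = coboundary W (\<lambda>s. 0) s" for s
      using pull_id[OF cocycleD(2)[OF p], of id] by simp
  qed simp
  then show ?thesis using cech_class_eq_iff[OF p assms(1)] by blast
qed

lemma cech_class_eqI:
  fixes c :: "'a set list \<Rightarrow> bit"
  assumes "(U, c) \<in> cech_cocycles X" "(U, d) \<in> cech_cocycles X" "e \<in> cochains U"
    and "\<And>s. c s + d s = coboundary U e s"
  shows "cech_class X U c = cech_class X U d"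
proof -
  have "((U, c), (U, d)) \<in> cech_rel X"
    using assms(4) pull_id[OF cocycleD(2)[OF assms(1)], of id] pull_id[OF cocycleD(2)[OF assms(2)], of id]
    by (intro cech_relI[OF assms(1,2) cocycleD(1)[OF assms(1)] _ _ assms(3), of id id])
      (simp_all add: refinement_map_def)
  then show ?thesis using cech_class_eq_iff[OF assms(1,2)] by blast
qed

lemma cech_class_mem:
  fixes c :: "'a set list \<Rightarrow> bit"
  assumes "(U, c) \<in> cech_class X V d"
  shows "(U, c) \<in> cech_cocycles X" "cech_class X U c = cech_class X V d"
proof -
  have "((V, d), (U, c)) \<in> cech_rel X" using assms by blast
  then show "(U, c) \<in> cech_cocycles X" "cech_class X U c = cech_class X V d"
    using equiv_class_eq[OF equiv_cech_rel, of "(V, d)" "(U, c)"] by (simp_all add: cech_rel_def)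
qed

lemma cech_class_self:
  fixes c :: "'a set list \<Rightarrow> bit"
  shows "(U, c) \<in> cech_cocycles X \<Longrightarrow> (U, c) \<in> cech_class X U c"
  using equiv_class_self[OF equiv_cech_rel] .

lemma cech_common_witness:
  fixes c :: "'a set list \<Rightarrow> bit"
  assumes "(U, c) \<in> cech_cocycles X" "(V, d) \<in> cech_cocycles X" "cech_class X U c = cech_class X V d"
  obtains Z where "open_cover X Z"
    "\<And>W f g. refines W Z \<Longrightarrow> refinement_map W U f \<Longrightarrow> refinement_map W V g \<Longrightarrow>
      \<exists>e \<in> cochains W. \<forall>s. pull_cochain W f c s + pull_cochain W g d s = coboundary W e s"
  using cech_class_eq_iff[OF assms(1,2)] assms(3) cech_rel_refine[of U c V d X] by blast

text \<open>Independence of representatives for operations that act on cochains of every cover by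
  the same formula, here scaling and truncation. The companion \<open>\<psi>\<close> acts on
  primitives; it differs from \<open>\<phi>\<close> for truncation, where a primitive sits one
  degree lower.\<close>

lemma cech_unary:
  fixes \<phi> \<psi> :: "('a set list \<Rightarrow> bit) \<Rightarrow> 'a set list \<Rightarrow> bit"
  assumes d: "(V, d) \<in> cech_cocycles X"
    and cc: "\<And>U c. (U, c) \<in> cech_cocycles X \<Longrightarrow> (U, \<phi> c) \<in> cech_cocycles X"
    and pull: "\<And>W f c. pull_cochain W f (\<phi> c) = \<phi> (pull_cochain W f c)"
    and add: "\<And>c e. \<phi> (\<lambda>s. c s + e s) = (\<lambda>s. \<phi> c s + \<phi> e s)"
    and cob: "\<And>U e. e \<in> cochains U \<Longrightarrow> \<phi> (coboundary U e) = coboundary U (\<psi> e)"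
    and coch: "\<And>U e. e \<in> cochains U \<Longrightarrow> \<psi> e \<in> cochains U"
  shows "(\<Union>(U, c) \<in> cech_class X V d. cech_class X U (\<phi> c)) = cech_class X V (\<phi> d)"
proof -
  have "cech_class X U (\<phi> c) = cech_class X V (\<phi> d)" if "(U, c) \<in> cech_class X V d" for U c
  proof -
    note c = cech_class_mem[OF that]
    have "((U, c), (V, d)) \<in> cech_rel X" using cech_class_eq_iff[OF c(1) d] c(2) by blast
    then obtain W f g e where W: "open_cover X W" "refinement_map W U f" "refinement_map W V g"
      "e \<in> cochains W" "\<forall>s. pull_cochain W f c s - pull_cochain W g d s = coboundary W e s"
      unfolding cech_rel_def by blast
    have "(\<lambda>s. pull_cochain W f c s + pull_cochain W g d s) = coboundary W e" using W(5) by (simp add: fun_eq_iff)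
    then have "(\<lambda>s. pull_cochain W f (\<phi> c) s + pull_cochain W g (\<phi> d) s) = coboundary W (\<psi> e)"
      using add[of "pull_cochain W f c" "pull_cochain W g d"] by (simp add: pull cob[OF W(4)])
    then have "((U, \<phi> c), (V, \<phi> d)) \<in> cech_rel X"
      using W by (intro cech_relI[OF cc[OF c(1)] cc[OF d] W(1-3) coch[OF W(4)]]) (simp add: fun_eq_iff)
    then show ?thesis using cech_class_eq_iff[OF cc[OF c(1)] cc[OF d]] by blast
  qed
  then show ?thesis using cech_class_self[OF d] by fastforce
qed

text \<open>Independence of representatives for addition and cup product at once. Since
  \<open>\<omega>\<close> commutes with refinement, both pairs can be moved to one fine cover, and
  \<open>coh\<close> has to be checked on a single cover only.\<close>

lemma cech_binary:
  fixes \<omega> :: "'a set set \<Rightarrow> ('a set list \<Rightarrow> bit) \<Rightarrow> ('a set list \<Rightarrow> bit) \<Rightarrow> 'a set list \<Rightarrow> bit"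
  assumes ab: "(V, a) \<in> cech_cocycles X" "(V, b) \<in> cech_cocycles X"
    and cc: "\<And>U c d. (U, c) \<in> cech_cocycles X \<Longrightarrow> (U, d) \<in> cech_cocycles X \<Longrightarrow> (U, \<omega> U c d) \<in> cech_cocycles X"
    and pull: "\<And>W U f c d. refinement_map W U f \<Longrightarrow>
        pull_cochain W f (\<omega> U c d) = \<omega> W (pull_cochain W f c) (pull_cochain W f d)"
    and coh: "\<And>U c d c' d' e f. \<lbrakk>(U, c) \<in> cech_cocycles X; (U, d) \<in> cech_cocycles X;
        (U, c') \<in> cech_cocycles X; (U, d') \<in> cech_cocycles X; e \<in> cochains U; f \<in> cochains U;
        \<forall>s. c s + c' s = coboundary U e s; \<forall>s. d s + d' s = coboundary U f s\<rbrakk>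
        \<Longrightarrow> \<exists>g \<in> cochains U. \<forall>s. \<omega> U c d s + \<omega> U c' d' s = coboundary U g s"
  shows "(\<Union>(U, c) \<in> cech_class X V a. \<Union>d \<in> {d. (U, d) \<in> cech_class X V b}. cech_class X U (\<omega> U c d))
    = cech_class X V (\<omega> V a b)"
proof -
  have "cech_class X U (\<omega> U c d) = cech_class X V (\<omega> V a b)"
    if "(U, c) \<in> cech_class X V a" "(U, d) \<in> cech_class X V b" for U c d
  proof -
    note c = cech_class_mem[OF that(1)] and d = cech_class_mem[OF that(2)]
    obtain Z where Z: "open_cover X Z" "\<And>W f g. refines W Z \<Longrightarrow> refinement_map W U f \<Longrightarrow> refinement_map W V g \<Longrightarrow>
      \<exists>e \<in> cochains W. \<forall>s. pull_cochain W f c s + pull_cochain W g a s = coboundary W e s"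
      using cech_common_witness[OF c(1) ab(1) c(2)] by metis
    obtain Z' where Z': "open_cover X Z'" "\<And>W f g. refines W Z' \<Longrightarrow> refinement_map W U f \<Longrightarrow> refinement_map W V g \<Longrightarrow>
      \<exists>e \<in> cochains W. \<forall>s. pull_cochain W f d s + pull_cochain W g b s = coboundary W e s"
      using cech_common_witness[OF d(1) ab(2) d(2)] by metis
    obtain W1 where W1: "open_cover X W1" "refines W1 Z" "refines W1 Z'"
      using common_refinement[OF Z(1) Z'(1)] by blast
    obtain W2 where W2: "open_cover X W2" "refines W2 U" "refines W2 V"
      using common_refinement[OF cocycleD(1)[OF c(1)] cocycleD(1)[OF ab(1)]] by blast
    obtain W where W: "open_cover X W" "refines W W1" "refines W W2"
      using common_refinement[OF W1(1) W2(1)] by blast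
    obtain f where f: "refinement_map W U f"
      using refines_refinement_map refines_trans W W2 by metis
    obtain g where g: "refinement_map W V g"
      using refines_refinement_map refines_trans W W2 by metis
    obtain e1 where e1: "e1 \<in> cochains W" "\<forall>s. pull_cochain W f c s + pull_cochain W g a s = coboundary W e1 s"
      using Z(2)[OF _ f g] refines_trans W W1 by metis
    obtain e2 where e2: "e2 \<in> cochains W" "\<forall>s. pull_cochain W f d s + pull_cochain W g b s = coboundary W e2 s"
      using Z'(2)[OF _ f g] refines_trans W W1 by metis
    obtain h where h: "h \<in> cochains W" "\<forall>s. \<omega> W (pull_cochain W f c) (pull_cochain W f d) s +
        \<omega> W (pull_cochain W g a) (pull_cochain W g b) s = coboundary W h s"
      using coh[OF cocycle_pull[OF c(1) W(1) f] cocycle_pull[OF d(1) W(1) f]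
          cocycle_pull[OF ab(1) W(1) g] cocycle_pull[OF ab(2) W(1) g] e1(1) e2(1) e1(2) e2(2)] by blast
    have "((U, \<omega> U c d), (V, \<omega> V a b)) \<in> cech_rel X"
      using h(2) by (intro cech_relI[OF cc[OF c(1) d(1)] cc[OF ab] W(1) f g h(1)])
        (simp add: pull[OF f] pull[OF g])
    then show ?thesis using cech_class_eq_iff[OF cc[OF c(1) d(1)] cc[OF ab]] by blast
  qed
  then show ?thesis using cech_class_self[OF ab(1)] cech_class_self[OF ab(2)] by fastforce
qed

section \<open>The ring operations and the grading of Cech cohomology\<close>

abbreviation coho :: "'a topology \<Rightarrow> (bit, ('a set set \<times> ('a set list \<Rightarrow> bit)) set) graded_algebra" where
  "coho \<equiv> cech_cohomology"

lemma coho_carrier: "A \<in> carrier (coho X) \<longleftrightarrow> (\<exists>U c. (U, c) \<in> cech_cocycles X \<and> A = cech_class X U c)"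
  by (auto simp: cech_cohomology_def quotient_def)

lemma coho_carrierI [intro, simp]: "(U, c) \<in> cech_cocycles X \<Longrightarrow> cech_class X U c \<in> carrier (coho X)"
  by (auto simp: coho_carrier)

lemma cocycle_add:
  fixes c :: "'a set list \<Rightarrow> bit"
  assumes "(U, c) \<in> cech_cocycles X" "(U, d) \<in> cech_cocycles X"
  shows "(U, \<lambda>s. c s + d s) \<in> cech_cocycles X"
  using cocycleD[OF assms(1)] cocycleD[OF assms(2)] by (auto intro!: cocycleI simp: coboundary_add)

lemma cocycle_cup:
  fixes c :: "'a set list \<Rightarrow> bit"
  assumes "(U, c) \<in> cech_cocycles X" "(U, d) \<in> cech_cocycles X"
  shows "(U, cup U c d) \<in> cech_cocycles X"
  using cocycleD[OF assms(1)] cocycleD[OF assms(2)] by (auto intro!: cocycleI simp: coboundary_cup)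

lemma cocycle_scale:
  fixes c :: "'a set list \<Rightarrow> bit"
  assumes "(U, c) \<in> cech_cocycles X"
  shows "(U, \<lambda>s. k * c s) \<in> cech_cocycles X"
  using cocycleD[OF assms] by (auto intro!: cocycleI simp: coboundary_scale)

lemma cocycle_trunc:
  assumes "(U, c) \<in> cech_cocycles X"
  shows "(U, trunc j c) \<in> cech_cocycles X"
  using cocycleD[OF assms] by (auto intro!: cocycleI simp: coboundary_trunc)

lemma cocycle_zero: "open_cover X U \<Longrightarrow> (U, \<lambda>s. 0 :: bit) \<in> cech_cocycles X"
  by (simp add: cocycleI)

lemma cocycle_unit: "open_cover X U \<Longrightarrow> (U, unit_cochain U :: _ \<Rightarrow> bit) \<in> cech_cocycles X"
  by (simp add: cocycleI)

lemma coho_add: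
  fixes c :: "'a set list \<Rightarrow> bit"
  assumes "(U, c) \<in> cech_cocycles X" "(U, d) \<in> cech_cocycles X"
  shows "cech_class X U c \<oplus>\<^bsub>coho X\<^esub> cech_class X U d = cech_class X U (\<lambda>s. c s + d s)"
proof -
  have "(\<Union>(V, a) \<in> cech_class X U c. \<Union>b \<in> {b. (V, b) \<in> cech_class X U d}. cech_class X V (\<lambda>s. a s + b s))
    = cech_class X U (\<lambda>s. c s + d s)"
  proof (rule cech_binary[OF assms, of "\<lambda>U c d s. c s + d s"], goal_cases)
    case (3 U c d c' d' e f)
    then show ?case
      by (intro bexI[of _ "\<lambda>s. e s + f s"])
        (auto simp: coboundary_add ac_simps simp flip: 3(7,8)[rule_format])
  qed (simp_all add: cocycle_add pull_add)
  then show ?thesis by (simp add: cech_cohomology_def)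
qed

lemma coho_mult:
  fixes c :: "'a set list \<Rightarrow> bit"
  assumes "(U, c) \<in> cech_cocycles X" "(U, d) \<in> cech_cocycles X"
  shows "cech_class X U c \<otimes>\<^bsub>coho X\<^esub> cech_class X U d = cech_class X U (cup U c d)"
proof -
  have "(\<Union>(V, a) \<in> cech_class X U c. \<Union>b \<in> {b. (V, b) \<in> cech_class X U d}. cech_class X V (cup V a b))
    = cech_class X U (cup U c d)"
  proof (rule cech_binary[OF assms, of cup], goal_cases)
    case (2 W U f c d)
    then show ?case using pull_cup[OF refinement_map_simplicial] by metis
  next
    case (3 U c d c' d' e f)
    have 1: "(\<lambda>s. c s + c' s) = coboundary U e" "(\<lambda>s. d s + d' s) = coboundary U f"
      using 3 by auto
    \<comment> \<open>From \<open>c d + c' d' = (c + c') d + c' (d + d')\<close>: as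
      \<open>d\<close> and \<open>c'\<close> are cocycles, the two summands on the right are the
      coboundaries of \<open>cup U e d\<close> and \<open>cup U c' f\<close>.\<close>
    let ?g = "\<lambda>s. cup U e d s + cup U c' f s"
    have "coboundary U ?g = (\<lambda>s. cup U (coboundary U e) d s + cup U c' (coboundary U f) s)"
      using 3(5,6) cocycleD[OF 3(2)] cocycleD[OF 3(3)] by (simp add: coboundary_add coboundary_cup)
    also have "\<dots> = (\<lambda>s. cup U c d s + cup U c' d' s)"
      by (simp add: cup_add_left cup_add_right ac_simps flip: 1)
    finally have "coboundary U ?g = (\<lambda>s. cup U c d s + cup U c' d' s)" .
    moreover have "?g \<in> cochains U"
      using 3(5,6) cocycleD[OF 3(2)] cocycleD[OF 3(3)] by (intro cochains_add cup_cochains)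
    ultimately show ?case by (intro bexI[of _ ?g]) auto
  qed (simp_all add: cocycle_cup)
  then show ?thesis by (simp add: cech_cohomology_def)
qed

lemma coho_smult:
  fixes c :: "'a set list \<Rightarrow> bit"
  assumes "(U, c) \<in> cech_cocycles X"
  shows "k \<odot>\<^bsub>coho X\<^esub> cech_class X U c = cech_class X U (\<lambda>s. k * c s)"
proof -
  have "(\<Union>(V, a) \<in> cech_class X U c. cech_class X V (\<lambda>s. k * a s)) = cech_class X U (\<lambda>s. k * c s)"
    by (rule cech_unary[OF assms, of "\<lambda>c s. k * c s" "\<lambda>c s. k * c s"])
      (auto simp: cocycle_scale pull_scale coboundary_scale algebra_simps)
  then show ?thesis by (simp add: cech_cohomology_def)
qed

lemma open_cover_topspace: "open_cover X {topspace X}"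
  by (simp add: open_cover_def)

lemma refinement_map_topspace: "open_cover X U \<Longrightarrow> refinement_map U {topspace X} (\<lambda>u. topspace X)"
  by (auto simp: open_cover_def refinement_map_def)

lemma coho_zero:
  assumes "open_cover X U" shows "\<zero>\<^bsub>coho X\<^esub> = cech_class X U (\<lambda>s. 0)"
  using cech_class_pull[OF cocycle_zero[OF open_cover_topspace] assms refinement_map_topspace[OF assms]]
  by (simp add: cech_cohomology_def)

lemma coho_one:
  assumes "open_cover X U" shows "\<one>\<^bsub>coho X\<^esub> = cech_class X U (unit_cochain U)"
  using cech_class_pull[OF cocycle_unit[OF open_cover_topspace] assms refinement_map_topspace[OF assms]]
    pull_unit[OF refinement_map_simplicial[OF refinement_map_topspace[OF assms]], where ?'b = bit]
  by (simp add: cech_cohomology_def)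

text \<open>The operations are computed on representatives over the same cover, which a common
  refinement provides.\<close>

lemma coho_carrier2:
  assumes "A \<in> carrier (coho X)" "B \<in> carrier (coho X)"
  obtains U c d where "(U, c) \<in> cech_cocycles X" "(U, d) \<in> cech_cocycles X"
    "A = cech_class X U c" "B = cech_class X U d"
proof -
  obtain U c where c: "(U, c) \<in> cech_cocycles X" "A = cech_class X U c"
    using assms(1) by (auto simp: coho_carrier)
  obtain V d where d: "(V, d) \<in> cech_cocycles X" "B = cech_class X V d"
    using assms(2) by (auto simp: coho_carrier)
  obtain W where W: "open_cover X W" "refines W U" "refines W V"
    using common_refinement[OF cocycleD(1)[OF c(1)] cocycleD(1)[OF d(1)]] by blast
  obtain f g where fg: "refinement_map W U f" "refinement_map W V g"
    using W refines_refinement_map by metis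
  show ?thesis
    using that[OF cocycle_pull[OF c(1) W(1) fg(1)] cocycle_pull[OF d(1) W(1) fg(2)]]
      cech_class_pull[OF c(1) W(1) fg(1)] cech_class_pull[OF d(1) W(1) fg(2)] c(2) d(2) by simp
qed

lemma coho_carrier3:
  assumes "A \<in> carrier (coho X)" "B \<in> carrier (coho X)" "C \<in> carrier (coho X)"
  obtains U c d e where "(U, c) \<in> cech_cocycles X" "(U, d) \<in> cech_cocycles X" "(U, e) \<in> cech_cocycles X"
    "A = cech_class X U c" "B = cech_class X U d" "C = cech_class X U e"
proof -
  obtain U c d where cd: "(U, c) \<in> cech_cocycles X" "(U, d) \<in> cech_cocycles X"
    "A = cech_class X U c" "B = cech_class X U d"
    using coho_carrier2[OF assms(1,2)] by metis
  obtain V e where e: "(V, e) \<in> cech_cocycles X" "C = cech_class X V e"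
    using assms(3) by (auto simp: coho_carrier)
  obtain W where W: "open_cover X W" "refines W U" "refines W V"
    using common_refinement[OF cocycleD(1)[OF cd(1)] cocycleD(1)[OF e(1)]] by blast
  obtain f g where fg: "refinement_map W U f" "refinement_map W V g"
    using W refines_refinement_map by metis
  show ?thesis
    using that[OF cocycle_pull[OF cd(1) W(1) fg(1)] cocycle_pull[OF cd(2) W(1) fg(1)] cocycle_pull[OF e(1) W(1) fg(2)]]
      cech_class_pull[OF cd(1) W(1) fg(1)] cech_class_pull[OF cd(2) W(1) fg(1)] cech_class_pull[OF e(1) W(1) fg(2)] cd e(2)
    by simp
qed

text \<open>On a fixed cover the ring axioms hold strictly for cochains, so no homotopy enters.
  Commutativity holds strictly for addition alone.\<close>

lemma ring_coho: "ring (coho X)"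
proof (rule ringI)
  show "abelian_group (coho X)"
  proof (rule abelian_groupI)
    fix A B assume "A \<in> carrier (coho X)" "B \<in> carrier (coho X)"
    then obtain U c d where "(U, c) \<in> cech_cocycles X" "(U, d) \<in> cech_cocycles X"
      "A = cech_class X U c" "B = cech_class X U d" by (rule coho_carrier2)
    then show "A \<oplus>\<^bsub>coho X\<^esub> B \<in> carrier (coho X)" "A \<oplus>\<^bsub>coho X\<^esub> B = B \<oplus>\<^bsub>coho X\<^esub> A"
      by (simp_all add: coho_add cocycle_add add.commute)
  next
    fix A B C assume "A \<in> carrier (coho X)" "B \<in> carrier (coho X)" "C \<in> carrier (coho X)"
    then obtain U c d e where "(U, c) \<in> cech_cocycles X" "(U, d) \<in> cech_cocycles X" "(U, e) \<in> cech_cocycles X"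
      "A = cech_class X U c" "B = cech_class X U d" "C = cech_class X U e" by (rule coho_carrier3)
    then show "A \<oplus>\<^bsub>coho X\<^esub> B \<oplus>\<^bsub>coho X\<^esub> C = A \<oplus>\<^bsub>coho X\<^esub> (B \<oplus>\<^bsub>coho X\<^esub> C)"
      by (simp add: coho_add cocycle_add add.assoc)
  next
    show "\<zero>\<^bsub>coho X\<^esub> \<in> carrier (coho X)"
      using coho_zero[OF open_cover_topspace[of X]] cocycle_zero[OF open_cover_topspace[of X]] by simp
  next
    fix A assume "A \<in> carrier (coho X)"
    then obtain U c where c: "(U, c) \<in> cech_cocycles X" "A = cech_class X U c" by (auto simp: coho_carrier)
    note U = cocycleD(1)[OF c(1)]
    show "\<zero>\<^bsub>coho X\<^esub> \<oplus>\<^bsub>coho X\<^esub> A = A"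
      using c by (simp add: coho_zero[OF U] coho_add cocycle_zero[OF U])
    show "\<exists>B \<in> carrier (coho X). B \<oplus>\<^bsub>coho X\<^esub> A = \<zero>\<^bsub>coho X\<^esub>"
      using c by (intro bexI[of _ A]) (simp_all add: coho_zero[OF U] coho_add)
  qed
  show "monoid (coho X)"
  proof (rule monoidI)
    fix A B assume "A \<in> carrier (coho X)" "B \<in> carrier (coho X)"
    then obtain U c d where "(U, c) \<in> cech_cocycles X" "(U, d) \<in> cech_cocycles X"
      "A = cech_class X U c" "B = cech_class X U d" by (rule coho_carrier2)
    then show "A \<otimes>\<^bsub>coho X\<^esub> B \<in> carrier (coho X)" by (simp add: coho_mult cocycle_cup)
  next
    show "\<one>\<^bsub>coho X\<^esub> \<in> carrier (coho X)"
      using coho_one[OF open_cover_topspace[of X]] cocycle_unit[OF open_cover_topspace[of X]] by simp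
  next
    fix A B C assume "A \<in> carrier (coho X)" "B \<in> carrier (coho X)" "C \<in> carrier (coho X)"
    then obtain U c d e where "(U, c) \<in> cech_cocycles X" "(U, d) \<in> cech_cocycles X" "(U, e) \<in> cech_cocycles X"
      "A = cech_class X U c" "B = cech_class X U d" "C = cech_class X U e" by (rule coho_carrier3)
    then show "A \<otimes>\<^bsub>coho X\<^esub> B \<otimes>\<^bsub>coho X\<^esub> C = A \<otimes>\<^bsub>coho X\<^esub> (B \<otimes>\<^bsub>coho X\<^esub> C)"
      by (simp add: coho_mult cocycle_cup cup_assoc)
  next
    fix A assume "A \<in> carrier (coho X)"
    then obtain U c where c: "(U, c) \<in> cech_cocycles X" "A = cech_class X U c" by (auto simp: coho_carrier)
    note U = cocycleD(1)[OF c(1)]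
    show "\<one>\<^bsub>coho X\<^esub> \<otimes>\<^bsub>coho X\<^esub> A = A" "A \<otimes>\<^bsub>coho X\<^esub> \<one>\<^bsub>coho X\<^esub> = A"
      using c cocycleD[OF c(1)] by (simp_all add: coho_one[OF U] coho_mult cocycle_unit[OF U])
  qed
  fix A B C assume "A \<in> carrier (coho X)" "B \<in> carrier (coho X)" "C \<in> carrier (coho X)"
  then obtain U c d e where "(U, c) \<in> cech_cocycles X" "(U, d) \<in> cech_cocycles X" "(U, e) \<in> cech_cocycles X"
    "A = cech_class X U c" "B = cech_class X U d" "C = cech_class X U e" by (rule coho_carrier3)
  then show "(A \<oplus>\<^bsub>coho X\<^esub> B) \<otimes>\<^bsub>coho X\<^esub> C = A \<otimes>\<^bsub>coho X\<^esub> C \<oplus>\<^bsub>coho X\<^esub> B \<otimes>\<^bsub>coho X\<^esub> C"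
    "C \<otimes>\<^bsub>coho X\<^esub> (A \<oplus>\<^bsub>coho X\<^esub> B) = C \<otimes>\<^bsub>coho X\<^esub> A \<oplus>\<^bsub>coho X\<^esub> C \<otimes>\<^bsub>coho X\<^esub> B"
    by (simp_all add: coho_mult coho_add cocycle_cup cocycle_add cup_add_left cup_add_right)
qed

lemma coho_double: "A \<in> carrier (coho X) \<Longrightarrow> A \<oplus>\<^bsub>coho X\<^esub> A = \<zero>\<^bsub>coho X\<^esub>"
  by (clarsimp simp: coho_carrier coho_add) (metis coho_zero cocycleD(1))

lemma coho_smult_cases: "A \<in> carrier (coho X) \<Longrightarrow> k \<odot>\<^bsub>coho X\<^esub> A = (if k = 0 then \<zero>\<^bsub>coho X\<^esub> else A)"
  by (clarsimp simp: coho_carrier coho_smult) (metis coho_zero cocycleD(1))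

lemma coho_component:
  "A \<in> component (coho X) i \<longleftrightarrow>
    (\<exists>U c. (U, c) \<in> cech_cocycles X \<and> trunc (Suc i) c = c \<and> A = cech_class X U c)"
  by (auto simp: cech_cohomology_def simp flip: trunc_eq)

lemma coho_component_carrier: "A \<in> component (coho X) i \<Longrightarrow> A \<in> carrier (coho X)"
  by (auto simp: coho_component)

text \<open>The components are mere sets of classes with a homogeneous representative; through these
  projections they become independent and are seen to span.\<close>

definition coho_proj :: "'a topology \<Rightarrow> nat \<Rightarrow> ('a set set \<times> ('a set list \<Rightarrow> bit)) set \<Rightarrow> ('a set set \<times> ('a set list \<Rightarrow> bit)) set"
  where "coho_proj X i A = (\<Union>(U, c) \<in> A. cech_class X U (trunc (Suc i) c))"

lemma coho_proj_class:
  assumes "(U, c) \<in> cech_cocycles X"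
  shows "coho_proj X i (cech_class X U c) = cech_class X U (trunc (Suc i) c)"
  unfolding coho_proj_def
  by (rule cech_unary[OF assms, of "trunc (Suc i)" "trunc i"])
    (auto simp: cocycle_trunc pull_trunc trunc_add coboundary_trunc)

text \<open>The representatives obtained on a common cover need not be homogeneous. Truncating them
  restores this without changing the classes.\<close>

lemma coho_component_add:
  assumes "A \<in> component (coho X) i" "B \<in> component (coho X) i"
  shows "A \<oplus>\<^bsub>coho X\<^esub> B \<in> component (coho X) i"
proof -
  obtain U c d where cd: "(U, c) \<in> cech_cocycles X" "(U, d) \<in> cech_cocycles X"
    "A = cech_class X U c" "B = cech_class X U d"
    using coho_carrier2[OF assms[THEN coho_component_carrier]] by metis
  have "coho_proj X i A = A" "coho_proj X i B = B"
    using assms by (clarsimp simp: coho_component coho_proj_class)+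
  then have "A = cech_class X U (trunc (Suc i) c)" "B = cech_class X U (trunc (Suc i) d)"
    using cd by (simp_all add: coho_proj_class)
  then have "A \<oplus>\<^bsub>coho X\<^esub> B = cech_class X U (\<lambda>s. trunc (Suc i) c s + trunc (Suc i) d s)"
    using cd by (simp add: coho_add cocycle_trunc)
  then show ?thesis
    unfolding coho_component using cd
    by (intro exI[of _ U] exI[of _ "\<lambda>s. trunc (Suc i) c s + trunc (Suc i) d s"])
      (simp add: cocycle_add cocycle_trunc trunc_add trunc_trunc)
qed

lemma coho_proj_add:
  assumes "A \<in> carrier (coho X)" "B \<in> carrier (coho X)"
  shows "coho_proj X i (A \<oplus>\<^bsub>coho X\<^esub> B) = coho_proj X i A \<oplus>\<^bsub>coho X\<^esub> coho_proj X i B"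
proof -
  obtain U c d where "(U, c) \<in> cech_cocycles X" "(U, d) \<in> cech_cocycles X"
    "A = cech_class X U c" "B = cech_class X U d"
    using coho_carrier2[OF assms] by metis
  then show ?thesis by (simp add: coho_add coho_proj_class cocycle_add cocycle_trunc trunc_add)
qed

lemma coho_proj_component: "A \<in> carrier (coho X) \<Longrightarrow> coho_proj X i A \<in> component (coho X) i"
  by (clarsimp simp: coho_carrier coho_component coho_proj_class) (metis cocycle_trunc trunc_trunc)

lemma coho_proj_on_component:
  assumes "A \<in> component (coho X) i"
  shows "coho_proj X j A = (if i = j then A else \<zero>\<^bsub>coho X\<^esub>)"
proof -
  obtain U c where c: "(U, c) \<in> cech_cocycles X" "trunc (Suc i) c = c" "A = cech_class X U c"
    using assms by (auto simp: coho_component)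
  have "trunc (Suc j) c = (\<lambda>s. 0)" if "i \<noteq> j"
    using trunc_trunc[of "Suc j" "Suc i" c] c(2) that by simp
  then show ?thesis
    using c coho_zero[OF cocycleD(1)[OF c(1)]] by (cases "i = j") (simp_all add: coho_proj_class)
qed

lemma coho_zero_component: "\<zero>\<^bsub>coho X\<^esub> \<in> component (coho X) i"
  unfolding coho_component coho_zero[OF open_cover_topspace]
  using cocycle_zero[OF open_cover_topspace] trunc_zero by blast

lemma coho_one_component: "\<one>\<^bsub>coho X\<^esub> \<in> component (coho X) 0"
  unfolding coho_component coho_one[OF open_cover_topspace]
  using cocycle_unit[OF open_cover_topspace, of X]
  by (intro exI[of _ "{topspace X}"] exI[of _ "unit_cochain {topspace X}"])
    (auto simp: trunc_def unit_cochain_def fun_eq_iff)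

lemma coho_mult_component:
  assumes "A \<in> component (coho X) i" "B \<in> component (coho X) j"
  shows "A \<otimes>\<^bsub>coho X\<^esub> B \<in> component (coho X) (i + j)"
proof -
  obtain U c d where cd: "(U, c) \<in> cech_cocycles X" "(U, d) \<in> cech_cocycles X"
    "A = cech_class X U c" "B = cech_class X U d"
    using coho_carrier2[OF assms[THEN coho_component_carrier]] by metis
  have "coho_proj X i A = A" "coho_proj X j B = B"
    using assms by (clarsimp simp: coho_component coho_proj_class)+
  then have "A = cech_class X U (trunc (Suc i) c)" "B = cech_class X U (trunc (Suc j) d)"
    using cd by (simp_all add: coho_proj_class)
  then have "A \<otimes>\<^bsub>coho X\<^esub> B = cech_class X U (cup U (trunc (Suc i) c) (trunc (Suc j) d))"
    using cd by (simp add: coho_mult cocycle_trunc)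
  then show ?thesis
    unfolding coho_component using cd
    by (intro exI[of _ U] exI[of _ "cup U (trunc (Suc i) c) (trunc (Suc j) d)"])
      (simp add: cocycle_cup cocycle_trunc cup_trunc trunc_trunc)
qed

lemma coho_proj_finsum:
  assumes "A \<in> carrier (coho X)"
  shows "\<exists>N. A = finsum (coho X) (\<lambda>i. coho_proj X i A) {..<N}"
proof -
  obtain U c where c: "(U, c) \<in> cech_cocycles X" "A = cech_class X U c"
    using assms by (auto simp: coho_carrier)
  obtain N where N: "\<forall>s. s \<notin> nerve U \<longrightarrow> c s = 0" "\<forall>s. length s > N \<longrightarrow> c s = 0"
    using cocycleD(2)[OF c(1)] by (rule cochainsE)
  interpret ring "coho X" by (rule ring_coho)
  \<comment> \<open>The part of \<open>c\<close> in degrees below \<open>k\<close>: a list of length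
    \<open>j + 1\<close> has degree \<open>j\<close>, and the empty list belongs to no
    component.\<close>
  let ?t = "\<lambda>k s. if 0 < length s \<and> length s \<le> k then c s else 0"
  have sums: "(U, ?t k) \<in> cech_cocycles X \<and> finsum (coho X) (\<lambda>i. coho_proj X i A) {..<k} = cech_class X U (?t k)" for k
  proof (induction k)
    case 0
    have "?t 0 = (\<lambda>s. 0)" by (auto simp: fun_eq_iff)
    then show ?case using coho_zero[OF cocycleD(1)[OF c(1)]] cocycle_zero[OF cocycleD(1)[OF c(1)]] by simp
  next
    case (Suc k)
    have t: "?t (Suc k) = (\<lambda>s. trunc (Suc k) c s + ?t k s)"
      by (auto simp: fun_eq_iff trunc_def)
    have "finsum (coho X) (\<lambda>i. coho_proj X i A) {..<Suc k}
        = cech_class X U (trunc (Suc k) c) \<oplus>\<^bsub>coho X\<^esub> cech_class X U (?t k)"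
      using Suc c by (simp add: lessThan_Suc coho_proj_class cocycle_trunc)
    then show ?case
      using Suc c cocycle_trunc[OF c(1)] unfolding t by (simp add: coho_add cocycle_add)
  qed
  have "?t N = c" using N by (auto simp: fun_eq_iff not_le[symmetric])
  then show ?thesis using c(2) sums[of N] by (intro exI[of _ N]) simp
qed

section \<open>Free involutions and good covers\<close>

text \<open>The orbit space enters only as a quotient whose fibres are the pairs of \<open>x\<close>
  and \<open>T x\<close>; group actions and cell structures stay outside the cohomological
  argument.\<close>

locale free_involution =
  fixes X :: "'a topology" and T :: "'a \<Rightarrow> 'a" and Y :: "'b topology" and \<pi> :: "'a \<Rightarrow> 'b"
  assumes compact: "compact_space X"
    and Hausdorff: "Hausdorff_space X"
    and continuous_T: "continuous_map X X T"
    and T_T: "x \<in> topspace X \<Longrightarrow> T (T x) = x"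
    and T_free: "x \<in> topspace X \<Longrightarrow> T x \<noteq> x"
    and quotient: "quotient_map X Y \<pi>"
    and fibre: "x \<in> topspace X \<Longrightarrow> x' \<in> topspace X \<Longrightarrow> \<pi> x = \<pi> x' \<longleftrightarrow> x' = x \<or> x' = T x"
begin

lemma T_topspace: "x \<in> topspace X \<Longrightarrow> T x \<in> topspace X"
  using continuous_T by (auto simp: continuous_map_def)

lemma inj_T: "inj_on T (topspace X)"
  by (metis inj_onI T_T)

lemma T_image_T_image: "w \<subseteq> topspace X \<Longrightarrow> T ` T ` w = w"
  by (force simp: T_T image_image)

lemma mem_T_image: "w \<subseteq> topspace X \<Longrightarrow> x \<in> topspace X \<Longrightarrow> x \<in> T ` w \<longleftrightarrow> T x \<in> w"
  by (metis T_T image_iff subsetD)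

lemma openin_T_image:
  assumes "openin X w" shows "openin X (T ` w)"
proof -
  have "T ` w = {x \<in> topspace X. T x \<in> w}"
    using openin_subset[OF assms] mem_T_image T_topspace by auto
  then show ?thesis using openin_continuous_map_preimage[OF continuous_T assms] by simp
qed

text \<open>The last condition makes the nerve of the cover a free double cover of the nerve of the
  image cover of the orbit space.\<close>

definition good :: "'a set set \<Rightarrow> bool"
  where "good W \<longleftrightarrow> open_cover X W \<and> {} \<notin> W \<and> (\<forall>w \<in> W. T ` w \<in> W) \<and>
    (\<forall>w \<in> W. \<forall>w' \<in> W. w \<inter> w' \<noteq> {} \<longrightarrow> w \<inter> T ` w' = {})"

lemma good_cover: "good W \<Longrightarrow> open_cover X W"
  and good_nonempty: "good W \<Longrightarrow> w \<in> W \<Longrightarrow> w \<noteq> {}"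
  and good_T: "good W \<Longrightarrow> w \<in> W \<Longrightarrow> T ` w \<in> W"
  and good_disjoint: "good W \<Longrightarrow> w \<in> W \<Longrightarrow> w' \<in> W \<Longrightarrow> x \<in> w \<Longrightarrow> x \<in> w' \<Longrightarrow> w \<inter> T ` w' = {}"
  unfolding good_def by blast+

lemma good_subset: "good W \<Longrightarrow> w \<in> W \<Longrightarrow> w \<subseteq> topspace X"
  using good_cover unfolding open_cover_def by blast

lemma good_T_T: "good W \<Longrightarrow> w \<in> W \<Longrightarrow> T ` T ` w = w"
  using good_subset T_image_T_image by metis

lemma good_T_neq: "good W \<Longrightarrow> w \<in> W \<Longrightarrow> T ` w \<noteq> w"
  using good_disjoint[of W w w] good_nonempty[of W w] by blast

text \<open>Separate \<open>x\<close> and \<open>T x\<close> by \<open>U\<close> and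
  \<open>V\<close>. The involution carries the intersection of \<open>U\<close> with the translate
  of \<open>V\<close> into \<open>V\<close>, which misses \<open>U\<close>.\<close>

lemma free_neighbourhood:
  assumes x: "x \<in> topspace X"
  shows "\<exists>a. openin X a \<and> x \<in> a \<and> a \<inter> T ` a = {}"
proof -
  obtain U V where UV: "openin X U" "openin X V" "x \<in> U" "T x \<in> V" "U \<inter> V = {}"
    using Hausdorff x T_free[OF x] T_topspace[OF x]
    unfolding Hausdorff_space_def disjnt_def by metis
  have s: "U \<subseteq> topspace X" "V \<subseteq> topspace X" using UV openin_subset by auto
  show ?thesis
  proof (intro exI conjI)
    show "openin X (U \<inter> T ` V)" using UV openin_T_image by blast
    show "x \<in> U \<inter> T ` V" using UV s mem_T_image x by blast
    have "T ` (U \<inter> T ` V) \<subseteq> V" using T_image_T_image[OF s(2)] by blast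
    then show "(U \<inter> T ` V) \<inter> T ` (U \<inter> T ` V) = {}" using UV by blast
  qed
qed

text \<open>The star condition is what yields the disjointness in \<open>good\<close>: two members
  through a common point lie in one set \<open>b i\<close> that is disjoint from its translate.
  Compactness supplies finitely many nested triples \<open>N i\<close>, \<open>K i\<close>,
  \<open>b i\<close>, open, closed and open; the neighbourhood of \<open>x\<close> is cut out by
  whether \<open>x\<close> lies in \<open>K i\<close>, for each \<open>i\<close>.\<close>

lemma ex_good_star_refinement:
  assumes O: "open_cover X C"
  obtains W where "good W" "\<And>p. p \<in> topspace X \<Longrightarrow> \<exists>c \<in> C. \<forall>w \<in> W. p \<in> w \<longrightarrow> w \<subseteq> c"
proof -
  have "\<exists>N K b. openin X N \<and> closedin X K \<and> x \<in> N \<and> N \<subseteq> K \<and> K \<subseteq> b \<and> openin X b \<and>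
      b \<inter> T ` b = {} \<and> (\<exists>c \<in> C. b \<subseteq> c)" if x: "x \<in> topspace X" for x
  proof -
    obtain c where c: "c \<in> C" "x \<in> c" "openin X c" using O x unfolding open_cover_def by blast
    obtain a where a: "openin X a" "x \<in> a" "a \<inter> T ` a = {}" using free_neighbourhood[OF x] by blast
    have "neighbourhood_base_of (closedin X) X"
      using compact Hausdorff compact_Hausdorff_imp_regular_space neighbourhood_base_of_closedin by blast
    then obtain N K where "openin X N" "closedin X K" "x \<in> N" "N \<subseteq> K" "K \<subseteq> a \<inter> c"
      unfolding neighbourhood_base_of using a c openin_Int by (metis IntI)
    then show ?thesis using a c
      by (intro exI[of _ N] exI[of _ K] exI[of _ "a \<inter> c"]) (auto intro: openin_Int)
  qed
  then obtain N K b where N: "\<And>x. x \<in> topspace X \<Longrightarrow> openin X (N x) \<and> closedin X (K x) \<and> x \<in> N x \<and>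
      N x \<subseteq> K x \<and> K x \<subseteq> b x \<and> openin X (b x) \<and> b x \<inter> T ` b x = {} \<and> (\<exists>c \<in> C. b x \<subseteq> c)"
    by metis
  have "(\<forall>U \<in> N ` topspace X. openin X U) \<and> topspace X \<subseteq> \<Union>(N ` topspace X)" using N by auto
  then obtain F where F: "finite F" "F \<subseteq> N ` topspace X" "topspace X \<subseteq> \<Union>F"
    using compact unfolding compact_space_alt by meson
  obtain I where I: "finite I" "I \<subseteq> topspace X" "F = N ` I"
    using finite_subset_image[OF F(1,2)] by blast
  define V where "V x = topspace X \<inter> \<Inter>((\<lambda>i. if x \<in> K i then b i else topspace X - K i) ` I)" for x
  \<comment> \<open>Symmetrization: \<open>T\<close> exchanges the sets attached to \<open>x\<close>
    and to \<open>T x\<close>, so the family becomes invariant.\<close>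
  define W where "W x = V x \<inter> T ` V (T x)" for x
  have V: "openin X (V x)" "V x \<subseteq> topspace X" for x
  proof -
    show "openin X (V x)"
    proof (cases "I = {}")
      case False
      then have "openin X (\<Inter>((\<lambda>i. if x \<in> K i then b i else topspace X - K i) ` I))"
        using I N by (intro openin_Inter) (auto simp: closedin_def)
      then show ?thesis unfolding V_def by blast
    qed (simp add: V_def)
  qed (simp add: V_def)
  have xV: "x \<in> V x" if "x \<in> topspace X" for x
  proof -
    have "x \<in> b i" if "i \<in> I" "x \<in> K i" for i using that I(2) N[of i] by blast
    then show ?thesis using that unfolding V_def by auto
  qed
  have Wo: "openin X (W x)" for x unfolding W_def using V openin_T_image by blast
  have xW: "x \<in> W x" if x: "x \<in> topspace X" for x
    unfolding W_def using xV[OF x] xV[OF T_topspace[OF x]] mem_T_image[OF V(2) x] by blast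
  have TW: "T ` W x = W (T x)" if x: "x \<in> topspace X" for x
  proof -
    have "T ` W x = T ` V x \<inter> T ` T ` V (T x)"
      unfolding W_def
    proof (rule inj_on_image_Int[OF inj_T])
      show "V x \<subseteq> topspace X" "T ` V (T x) \<subseteq> topspace X" using V(2) T_topspace by blast+
    qed
    then show ?thesis using V(2) by (simp add: W_def T_image_T_image T_T[OF x] Int_commute)
  qed
  have star: "\<exists>i \<in> I. \<forall>x \<in> topspace X. p \<in> W x \<longrightarrow> W x \<subseteq> b i" if p: "p \<in> topspace X" for p
  proof -
    obtain i where i: "i \<in> I" "p \<in> N i" using p F I by blast
    have "W x \<subseteq> b i" if x: "x \<in> topspace X" "p \<in> W x" for x
    proof -
      have "p \<in> V x" using x by (simp add: W_def)
      moreover have "p \<in> K i" using i I(2) N[of i] by blast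
      \<comment> \<open>If \<open>x\<close> were outside \<open>K i\<close>, then \<open>V x\<close>
        would avoid \<open>K i\<close>, but \<open>p\<close> lies in both.\<close>
      ultimately have "x \<in> K i" using i unfolding V_def by (auto split: if_splits)
      then have "V x \<subseteq> b i" using i unfolding V_def by auto
      then show ?thesis unfolding W_def by blast
    qed
    then show ?thesis using i(1) by blast
  qed
  have cov: "open_cover X (W ` topspace X)"
    unfolding open_cover_def using Wo xW openin_subset[OF Wo] by auto
  have "good (W ` topspace X)"
    unfolding good_def
  proof (intro conjI ballI impI)
    show "{} \<notin> W ` topspace X" using xW by auto
    show "T ` w \<in> W ` topspace X" if "w \<in> W ` topspace X" for w
      using that TW T_topspace by auto
    fix w w' assume w: "w \<in> W ` topspace X" "w' \<in> W ` topspace X" "w \<inter> w' \<noteq> {}"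
    then obtain p where p: "p \<in> w" "p \<in> w'" by blast
    then have "p \<in> topspace X" using w openin_subset[OF Wo] by blast
    then obtain i where i: "i \<in> I" "w \<subseteq> b i" "w' \<subseteq> b i" using star w p by (metis imageE)
    then have "b i \<inter> T ` b i = {}" using N[of i] I(2) by blast
    then show "w \<inter> T ` w' = {}" using i by blast
  qed (rule cov)
  moreover have "\<exists>c \<in> C. \<forall>w \<in> W ` topspace X. p \<in> w \<longrightarrow> w \<subseteq> c" if p: "p \<in> topspace X" for p
  proof -
    obtain i where i: "i \<in> I" "\<forall>x \<in> topspace X. p \<in> W x \<longrightarrow> W x \<subseteq> b i" using star[OF p] by blast
    then obtain c where "c \<in> C" "b i \<subseteq> c" using N[of i] I(2) by blast
    then show ?thesis using i(2) by blast
  qed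
  ultimately show ?thesis by (rule that)
qed

lemma ex_good_refines:
  assumes "open_cover X C" obtains W where "good W" "refines W C"
proof -
  obtain W where W: "good W" "\<And>p. p \<in> topspace X \<Longrightarrow> \<exists>c \<in> C. \<forall>w \<in> W. p \<in> w \<longrightarrow> w \<subseteq> c"
    using ex_good_star_refinement[OF assms] by blast
  have "refines W C" unfolding refines_def
  proof
    fix w assume w: "w \<in> W"
    obtain p where p: "p \<in> w" "p \<in> topspace X"
      using good_nonempty[OF W(1) w] good_subset[OF W(1) w] by (meson ex_in_conv subsetD)
    then show "\<exists>u \<in> C. w \<subseteq> u" using W(2)[OF p(2)] w by blast
  qed
  then show ?thesis using W that by blast
qed

definition equivariant :: "'a set set \<Rightarrow> ('a set \<Rightarrow> 'a set) \<Rightarrow> bool"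
  where "equivariant W F \<longleftrightarrow> (\<forall>w \<in> W. F (T ` w) = T ` F w)"

text \<open>Both members of a pair \<open>{w, T w}\<close> see the same choice, so exactly one of them satisfies \<open>sel\<close>.\<close>

definition sel :: "'a set \<Rightarrow> bool"
  where "sel w \<longleftrightarrow> w = (SOME v. v \<in> {w, T ` w})"

lemma sel_T:
  assumes "good W" "w \<in> W" shows "sel (T ` w) \<longleftrightarrow> \<not> sel w"
proof -
  have "{T ` w, T ` T ` w} = {w, T ` w}" using good_T_T[OF assms] by auto
  then have "sel (T ` w) \<longleftrightarrow> T ` w = (SOME v. v \<in> {w, T ` w})" by (simp add: sel_def)
  moreover have "(SOME v. v \<in> {w, T ` w}) \<in> {w, T ` w}" by (rule someI[of _ w]) simp
  ultimately show ?thesis using good_T_neq[OF assms] unfolding sel_def by auto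
qed

text \<open>A refinement map is kept on the selected member of each pair and transported by the
  involution to the other one. No conflict arises, since no member of a good cover equals its
  translate.\<close>

lemma ex_equivariant:
  assumes W: "good W" and V: "good V" and r: "refines W V"
  obtains F where "refinement_map W V F" "equivariant W F"
proof -
  obtain f where f: "refinement_map W V f" using refines_refinement_map[OF r] by blast
  define F where "F w = (if sel w then f w else T ` f (T ` w))" for w
  have "F w \<in> V \<and> w \<subseteq> F w" if w: "w \<in> W" for w
  proof -
    have "w = T ` T ` w" using good_T_T[OF W w] by simp
    moreover have "T ` w \<subseteq> f (T ` w)" using f good_T[OF W w] by (simp add: refinement_map_def)
    ultimately have "w \<subseteq> T ` f (T ` w)" by blast
    then show ?thesis using f w good_T[OF W w] good_T[OF V] by (auto simp: F_def refinement_map_def)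
  qed
  then have "refinement_map W V F" by (simp add: refinement_map_def)
  moreover have "equivariant W F" unfolding equivariant_def
  proof
    fix w assume w: "w \<in> W"
    have "f w \<in> V" "f (T ` w) \<in> V" using f w good_T[OF W w] by (auto simp: refinement_map_def)
    then show "F (T ` w) = T ` F w"
      using sel_T[OF W w] good_T_T[OF W w] good_T_T[OF V] by (auto simp: F_def)
  qed
  ultimately show ?thesis by (rule that)
qed

lemma common_good:
  assumes "good W" "good W'" "open_cover X C"
  obtains V F G where "good V" "refines V C" "refinement_map V W F" "equivariant V F"
    "refinement_map V W' G" "equivariant V G"
proof -
  obtain A where A: "open_cover X A" "refines A W" "refines A W'"
    using common_refinement[OF good_cover[OF assms(1)] good_cover[OF assms(2)]] by blast
  obtain B where B: "open_cover X B" "refines B A" "refines B C"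
    using common_refinement[OF A(1) assms(3)] by blast
  obtain V where V: "good V" "refines V B" using ex_good_refines[OF B(1)] by blast
  have r: "refines V W" "refines V W'" "refines V C" using V A B refines_trans by metis+
  obtain F where "refinement_map V W F" "equivariant V F" using ex_equivariant[OF V(1) assms(1) r(1)] by blast
  moreover obtain G where "refinement_map V W' G" "equivariant V G" using ex_equivariant[OF V(1) assms(2) r(2)] by blast
  ultimately show ?thesis using that V(1) r(3) by blast
qed

section \<open>Descent of invariant cochains\<close>

abbreviation PI :: "'a set \<Rightarrow> 'b set" where "PI \<equiv> image \<pi>"

lemma pi_T: "x \<in> topspace X \<Longrightarrow> \<pi> (T x) = \<pi> x"
  using fibre[of x "T x"] T_topspace by auto

lemma PI_T: "w \<subseteq> topspace X \<Longrightarrow> PI (T ` w) = PI w"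
  using pi_T by (auto simp: image_image subset_iff intro!: image_cong)

lemma mem_PI:
  assumes "w \<subseteq> topspace X" "x \<in> topspace X"
  shows "\<pi> x \<in> PI w \<longleftrightarrow> x \<in> w \<or> x \<in> T ` w"
proof
  assume "\<pi> x \<in> PI w"
  then obtain z where "z \<in> w" "\<pi> z = \<pi> x" by (metis imageE)
  then have "x = z \<or> x = T z" using fibre[of z x] assms by blast
  then show "x \<in> w \<or> x \<in> T ` w" using \<open>z \<in> w\<close> by blast
next
  assume "x \<in> w \<or> x \<in> T ` w"
  then show "\<pi> x \<in> PI w" using assms pi_T by (metis image_eqI mem_T_image)
qed

text \<open>Suppose two members with the same image share a point. Each point of the first lies in
  the second or in its translate, and the translate is excluded by goodness; hence they are equal.
  If \<open>w'\<close> does not meet \<open>w\<close>, it meets the translate of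
  \<open>w\<close>.\<close>

lemma PI_eq:
  assumes W: "good W" and w: "w \<in> W" "w' \<in> W" and eq: "PI w = PI w'"
  shows "w' = w \<or> w' = T ` w"
proof -
  have sub: "v \<subseteq> v'" if v: "v \<in> W" "v' \<in> W" "PI v = PI v'" "x \<in> v" "x \<in> v'" for v v' x
  proof
    fix z assume z: "z \<in> v"
    then have "z \<in> topspace X" using good_subset[OF W v(1)] by (rule rev_subsetD)
    moreover have "\<pi> z \<in> PI v'" using z v(3) by (metis imageI)
    ultimately have "z \<in> v' \<or> z \<in> T ` v'" using mem_PI[OF good_subset[OF W v(2)]] by simp
    moreover have "z \<notin> T ` v'" using good_disjoint[OF W v(1,2,4,5)] z by (meson disjoint_iff)
    ultimately show "z \<in> v'" by simp
  qed
  obtain x where x: "x \<in> w'" using good_nonempty[OF W w(2)] by blast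
  then have xX: "x \<in> topspace X" using good_subset[OF W w(2)] by blast
  then have "x \<in> w \<or> x \<in> T ` w" using mem_PI[OF good_subset[OF W w(1)] xX] x eq by (metis imageI)
  then show ?thesis
  proof
    assume h: "x \<in> w"
    show ?thesis using sub[OF w eq h x] sub[OF w(2,1) eq[symmetric] x h] by simp
  next
    assume h: "x \<in> T ` w"
    have "PI (T ` w) = PI w'" using PI_T[OF good_subset[OF W w(1)]] eq by simp
    then show ?thesis
      using sub[OF good_T[OF W w(1)] w(2) _ h x] sub[OF w(2) good_T[OF W w(1)] _ x h] by (metis subset_antisym)
  qed
qed

text \<open>The preimage of the image of \<open>w\<close> is the union of \<open>w\<close> and its
  translate, which is open.\<close>

lemma PI_cover:
  assumes W: "good W" shows "open_cover Y (PI ` W)"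
  unfolding open_cover_def
proof
  show "\<forall>u \<in> PI ` W. openin Y u"
  proof
    fix u assume "u \<in> PI ` W"
    then obtain w where w: "w \<in> W" "u = PI w" by (rule imageE)
    have "{x \<in> topspace X. \<pi> x \<in> u} = w \<union> T ` w"
    proof (rule Set.set_eqI)
      fix x
      have "x \<in> topspace X" if "x \<in> w \<union> T ` w"
        using that good_subset[OF W w(1)] good_subset[OF W good_T[OF W w(1)]] by (meson UnE subsetD)
      then show "x \<in> {x \<in> topspace X. \<pi> x \<in> u} \<longleftrightarrow> x \<in> w \<union> T ` w"
        using mem_PI[OF good_subset[OF W w(1)], of x] w(2) by (metis (lifting) UnCI UnE mem_Collect_eq)
    qed
    moreover have "openin X (w \<union> T ` w)"
      using good_cover[OF W] w(1) good_T[OF W w(1)] by (simp add: open_cover_def openin_Un)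
    moreover have "u \<subseteq> topspace Y"
      using quotient image_mono[OF good_subset[OF W w(1)], of \<pi>] w(2) by (simp add: quotient_map_def)
    ultimately show "openin Y u" using quotient unfolding quotient_map_def by auto
  qed
  have "\<Union>(PI ` W) = PI (\<Union>W)" by blast
  also have "\<dots> = topspace Y" using quotient good_cover[OF W] unfolding quotient_map_def open_cover_def by simp
  finally show "\<Union>(PI ` W) = topspace Y" .
qed

lemma simplicial_PI: "simplicial W (PI ` W) PI"
  unfolding simplicial_def
proof
  fix s assume "s \<in> nerve W"
  then obtain x where "s \<noteq> []" "set s \<subseteq> W" "\<forall>u \<in> set s. x \<in> u" by (rule nerveE)
  then show "map PI s \<in> nerve (PI ` W)" by (intro nerveI[of _ _ "\<pi> x"]) auto
qed

lemma simplicial_T: "good W \<Longrightarrow> simplicial W W (image T)"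
  unfolding simplicial_def
proof
  fix s assume W: "good W" and "s \<in> nerve W"
  then obtain x where "s \<noteq> []" "set s \<subseteq> W" "\<forall>u \<in> set s. x \<in> u" by (metis nerveE)
  then show "map ((`) T) s \<in> nerve W" using good_T[OF W] by (intro nerveI[of _ _ "T x"]) auto
qed

text \<open>A common point of the images is \<open>\<pi> x\<close> for some \<open>x\<close>. Of the
  two members over each vertex the one containing this same \<open>x\<close> is taken, so the lifted
  members meet.\<close>

lemma nerve_lift:
  assumes W: "good W" and s: "s \<in> nerve (PI ` W)"
  shows "\<exists>t \<in> nerve W. map PI t = s"
proof -
  obtain y where y: "s \<noteq> []" "set s \<subseteq> PI ` W" "\<forall>u \<in> set s. y \<in> u" using s by (rule nerveE)
  obtain w0 where "w0 \<in> W" "y \<in> PI w0" using y by (cases s) auto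
  then obtain x where x: "x \<in> topspace X" "y = \<pi> x" using good_subset[OF W \<open>w0 \<in> W\<close>] by (metis imageE subsetD)
  have "\<exists>w. w \<in> W \<and> PI w = u \<and> x \<in> w" if u: "u \<in> set s" for u
  proof -
    obtain w where w: "w \<in> W" "u = PI w" using subsetD[OF y(2) u] by (rule imageE)
    have "\<pi> x \<in> PI w" using x(2) y(3) u w(2) by simp
    then have "x \<in> w \<or> x \<in> T ` w" using mem_PI[OF good_subset[OF W w(1)] x(1)] by simp
    then show ?thesis using w good_T[OF W w(1)] PI_T[OF good_subset[OF W w(1)]] by metis
  qed
  then obtain g where g: "\<And>u. u \<in> set s \<Longrightarrow> g u \<in> W \<and> PI (g u) = u \<and> x \<in> g u" by metis
  have "map g s \<in> nerve W" using g y(1) by (intro nerveI[of _ _ x]) auto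
  moreover have "map PI (map g s) = s" using g by (simp add: map_idI)
  ultimately show ?thesis by blast
qed

text \<open>Vertexwise the lifts agree up to \<open>T\<close>. Mixing both possibilities would put a
  point into \<open>t ! i\<close> and into the translate of \<open>t ! j\<close>, although
  \<open>t ! i\<close> and \<open>t ! j\<close> meet, which goodness forbids.\<close>

lemma nerve_lift_unique:
  assumes W: "good W" and t: "t \<in> nerve W" "t' \<in> nerve W" and eq: "map PI t = map PI t'"
  shows "t' = t \<or> t' = map (image T) t"
proof -
  obtain x where x: "set t \<subseteq> W" "\<forall>u \<in> set t. x \<in> u" using t(1) by (rule nerveE)
  obtain x' where x': "set t' \<subseteq> W" "\<forall>u \<in> set t'. x' \<in> u" using t(2) by (rule nerveE)
  have len: "length t = length t'" using eq map_eq_imp_length_eq by blast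
  have each: "t' ! i = t ! i \<or> t' ! i = T ` (t ! i)" if i: "i < length t" for i
  proof (rule PI_eq[OF W])
    show "t ! i \<in> W" "t' ! i \<in> W" using i len x x' by (auto simp: subset_iff)
    show "PI (t ! i) = PI (t' ! i)" using i len eq by (metis nth_map)
  qed
  have mix: False if ij: "i < length t" "j < length t" "t' ! i = t ! i" "t' ! j = T ` (t ! j)" for i j
  proof -
    have "x' \<in> t ! i" "x' \<in> T ` (t ! j)" using ij x' len by (metis nth_mem)+
    moreover have "x \<in> t ! i" "x \<in> t ! j" "t ! i \<in> W" "t ! j \<in> W" using ij x by auto
    ultimately show False using good_disjoint[OF W, of "t ! i" "t ! j" x] by (meson disjoint_iff)
  qed
  show ?thesis
  proof (cases "\<exists>i < length t. t' ! i = t ! i")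
    case True
    then have "t' = t" using mix each len by (intro nth_equalityI) metis+
    then show ?thesis by simp
  next
    case False
    then have "t' = map (image T) t" using each len by (intro nth_equalityI) auto
    then show ?thesis by simp
  qed
qed

abbreviation Tc :: "'a set set \<Rightarrow> ('a set list \<Rightarrow> bit) \<Rightarrow> 'a set list \<Rightarrow> bit"
  where "Tc W \<equiv> pull_cochain W (image T)"

lemma Tc_Tc: "good W \<Longrightarrow> e \<in> cochains W \<Longrightarrow> Tc W (Tc W e) = e"
  by (simp add: pull_pull[OF simplicial_T] pull_id good_T_T)

lemma Tc_coboundary: "good W \<Longrightarrow> e \<in> cochains W \<Longrightarrow> Tc W (coboundary W e) = coboundary W (Tc W e)"
  using pull_coboundary[OF simplicial_T, of W e] by simp

lemma Tc_cup: "good W \<Longrightarrow> Tc W (cup W a b) = cup W (Tc W a) (Tc W b)"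
  using pull_cup[OF simplicial_T] by metis

lemma Tc_pull:
  assumes "good V" "good W" "refinement_map V W F" "equivariant V F"
  shows "Tc V (pull_cochain V F e) = pull_cochain V F (Tc W e)"
  unfolding pull_pull[OF simplicial_T[OF assms(1)]] pull_pull[OF refinement_map_simplicial[OF assms(3)]]
  using assms(4) by (intro pull_cong) (simp add: equivariant_def)

definition inv_cochains :: "'a set set \<Rightarrow> ('a set list \<Rightarrow> bit) set"
  where "inv_cochains W = {e \<in> cochains W. Tc W e = e}"

lemma inv_cochains_add: "a \<in> inv_cochains W \<Longrightarrow> b \<in> inv_cochains W \<Longrightarrow> (\<lambda>s. a s + b s) \<in> inv_cochains W"
  by (simp add: inv_cochains_def pull_add cochains_add)

lemma inv_cochains_zero [simp]: "(\<lambda>s. 0) \<in> inv_cochains W"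
  by (simp add: inv_cochains_def)

lemma inv_cochains_coboundary: "good W \<Longrightarrow> a \<in> inv_cochains W \<Longrightarrow> coboundary W a \<in> inv_cochains W"
  by (auto simp: inv_cochains_def Tc_coboundary)

lemma inv_cochains_cup: "good W \<Longrightarrow> a \<in> inv_cochains W \<Longrightarrow> b \<in> inv_cochains W \<Longrightarrow> cup W a b \<in> inv_cochains W"
  by (auto simp: inv_cochains_def Tc_cup)

lemma inv_cochains_trunc: "a \<in> inv_cochains W \<Longrightarrow> trunc j a \<in> inv_cochains W"
  by (auto simp: inv_cochains_def pull_trunc)

lemma inv_cochains_norm: "good W \<Longrightarrow> a \<in> cochains W \<Longrightarrow> (\<lambda>s. a s + Tc W a s) \<in> inv_cochains W"
  by (auto simp: inv_cochains_def pull_add Tc_Tc add.commute)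

lemma inv_cochains_pull:
  assumes "good V" "good W" "refinement_map V W F" "equivariant V F" "a \<in> inv_cochains W"
  shows "pull_cochain V F a \<in> inv_cochains V"
  using assms(5) by (auto simp: inv_cochains_def Tc_pull[OF assms(1-4)])

lemma inv_cochains_subset: "a \<in> inv_cochains W \<Longrightarrow> a \<in> cochains W"
  by (simp add: inv_cochains_def)

lemma inv_cochains_unit: "good W \<Longrightarrow> unit_cochain W \<in> inv_cochains W"
  by (simp add: inv_cochains_def pull_unit[OF simplicial_T])

lemma inv_cochains_lift:
  assumes W: "good W" and c: "c \<in> cochains (PI ` W)"
  shows "pullback W PI c \<in> inv_cochains W"
proof -
  have "Tc W (pullback W PI c) = pullback W PI c"
    unfolding pull_cochain_pullback pullback_pull[OF simplicial_T[OF W]]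
    using PI_T[OF good_subset[OF W]] by (intro pullback_cong) simp
  then show ?thesis using c by (auto simp: inv_cochains_def)
qed

text \<open>Inverse to pulling back along \<open>PI\<close> on invariant cochains. A simplex has two
  lifts, exchanged by \<open>T\<close>, so invariance makes the choice immaterial.\<close>

definition desc :: "'a set set \<Rightarrow> ('a set list \<Rightarrow> bit) \<Rightarrow> 'b set list \<Rightarrow> bit"
  where "desc W e s = (if s \<in> nerve (PI ` W) then e (SOME t. t \<in> nerve W \<and> map PI t = s) else 0)"

lemma desc_map:
  assumes W: "good W" and e: "e \<in> inv_cochains W" and t: "t \<in> nerve W"
  shows "desc W e (map PI t) = e t"
proof -
  have s: "map PI t \<in> nerve (PI ` W)" using simplicial_PI t unfolding simplicial_def by blast
  define t' where "t' = (SOME t'. t' \<in> nerve W \<and> map PI t' = map PI t)"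
  have t': "t' \<in> nerve W" "map PI t' = map PI t"
    using someI[of "\<lambda>t'. t' \<in> nerve W \<and> map PI t' = map PI t" t] t unfolding t'_def by auto
  have "e (map ((`) T) t) = Tc W e t" using t by (simp add: pull_cochain_def)
  then have "e (map ((`) T) t) = e t" using e by (simp add: inv_cochains_def)
  then have "e t' = e t" using nerve_lift_unique[OF W t t'(1) t'(2)[symmetric]] by auto
  then show ?thesis using s by (simp add: desc_def t'_def)
qed

lemma desc_cochains:
  assumes W: "good W" and e: "e \<in> inv_cochains W"
  shows "desc W e \<in> cochains (PI ` W)"
proof -
  obtain N where N: "\<forall>s. length s > N \<longrightarrow> e s = 0"
    using inv_cochains_subset[OF e] by (rule cochainsE)
  show ?thesis
  proof (rule cochainsI[of _ _ N])
    fix s :: "'b set list" assume l: "N < length s"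
    show "desc W e s = 0"
    proof (cases "s \<in> nerve (PI ` W)")
      case True
      then obtain t where t: "t \<in> nerve W" "map PI t = s" using nerve_lift[OF W] by blast
      then have "length t > N" using l by auto
      then show ?thesis using desc_map[OF W e t(1)] t(2) N by simp
    qed (simp add: desc_def)
  qed (simp add: desc_def)
qed

lemma lift_desc:
  assumes W: "good W" and e: "e \<in> inv_cochains W"
  shows "pullback W PI (desc W e) = e"
proof
  fix s show "pullback W PI (desc W e) s = e s"
    using desc_map[OF W e, of s] inv_cochains_subset[OF e] by (auto simp: pullback_def cochains_def)
qed

text \<open>The way in which identities for \<open>desc\<close> are proved below: lifted to
  \<open>W\<close>, both sides become statements about the invariant cochain itself.\<close>

lemma lift_inj:
  assumes W: "good W" and c: "c \<in> cochains (PI ` W)" "c' \<in> cochains (PI ` W)"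
    and eq: "pullback W PI c = pullback W PI c'"
  shows "c = c'"
proof
  fix s show "c s = c' s"
  proof (cases "s \<in> nerve (PI ` W)")
    case True
    then obtain t where t: "t \<in> nerve W" "map PI t = s" using nerve_lift[OF W] by blast
    then show ?thesis using fun_cong[OF eq, of t] by (simp add: pullback_def)
  next
    case False
    then show ?thesis using c by (simp add: cochains_def)
  qed
qed

lemma desc_lift: "good W \<Longrightarrow> c \<in> cochains (PI ` W) \<Longrightarrow> desc W (pullback W PI c) = c"
  by (rule lift_inj) (auto simp: lift_desc inv_cochains_lift desc_cochains)

lemma desc_add:
  assumes W: "good W" and a: "a \<in> inv_cochains W" "b \<in> inv_cochains W"
  shows "desc W (\<lambda>s. a s + b s) = (\<lambda>s. desc W a s + desc W b s)"
  by (rule lift_inj[OF W])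
    (use assms in \<open>simp_all add: pullback_add lift_desc inv_cochains_add desc_cochains cochains_add\<close>)

lemma desc_trunc:
  assumes W: "good W" and a: "a \<in> inv_cochains W"
  shows "desc W (trunc j a) = trunc j (desc W a)"
  by (rule lift_inj[OF W])
    (use assms in \<open>simp_all add: pullback_trunc lift_desc inv_cochains_trunc desc_cochains trunc_cochains\<close>)

lemma desc_coboundary:
  assumes W: "good W" and a: "a \<in> inv_cochains W"
  shows "desc W (coboundary W a) = coboundary (PI ` W) (desc W a)"
proof (rule lift_inj[OF W])
  show "pullback W PI (desc W (coboundary W a)) = pullback W PI (coboundary (PI ` W) (desc W a))"
    unfolding lift_desc[OF W inv_cochains_coboundary[OF W a]]
    using pullback_coboundary[OF simplicial_PI, of "desc W a" W] lift_desc[OF W a]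
    by (simp add: cochains_Nil[OF desc_cochains[OF W a]])
qed (use assms in \<open>auto simp: inv_cochains_coboundary desc_cochains\<close>)

lemma desc_cup:
  assumes W: "good W" and a: "a \<in> inv_cochains W" "b \<in> inv_cochains W"
  shows "desc W (cup W a b) = cup (PI ` W) (desc W a) (desc W b)"
proof (rule lift_inj[OF W])
  show "pullback W PI (desc W (cup W a b)) = pullback W PI (cup (PI ` W) (desc W a) (desc W b))"
    unfolding lift_desc[OF W inv_cochains_cup[OF W a]]
    using pullback_cup[OF simplicial_PI, of W "desc W a" "desc W b"] lift_desc[OF W a(1)] lift_desc[OF W a(2)]
    by simp
qed (use assms in \<open>auto simp: inv_cochains_cup desc_cochains\<close>)

lemma desc_zero [simp]: "desc W (\<lambda>s. 0) = (\<lambda>s. 0)"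
  by (simp add: desc_def fun_eq_iff)

lemma desc_unit:
  assumes W: "good W"
  shows "desc W (unit_cochain W) = unit_cochain (PI ` W)"
  by (rule lift_inj[OF W]) (use assms in \<open>simp_all add: lift_desc inv_cochains_unit desc_cochains pullback_unit[OF simplicial_PI]\<close>)

text \<open>The refinement map induced between covers of the orbit space; equivariance of
  \<open>F\<close> makes the choice of a preimage immaterial.\<close>

definition desc_map :: "'a set set \<Rightarrow> ('a set \<Rightarrow> 'a set) \<Rightarrow> 'b set \<Rightarrow> 'b set"
  where "desc_map V F u = PI (F (SOME w. w \<in> V \<and> PI w = u))"

lemma desc_map_PI:
  assumes VW: "good V" "good W" "refinement_map V W F" "equivariant V F" and w: "w \<in> V"
  shows "desc_map V F (PI w) = PI (F w)"
proof -
  define w' where "w' = (SOME w'. w' \<in> V \<and> PI w' = PI w)"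
  have w': "w' \<in> V" "PI w' = PI w"
    using someI[of "\<lambda>w'. w' \<in> V \<and> PI w' = PI w" w] w unfolding w'_def by auto
  have "w' = w \<or> w' = T ` w" using PI_eq[OF VW(1) w w'(1)] w'(2) by simp
  moreover have "F (T ` w) = T ` F w" using VW(4) w by (simp add: equivariant_def)
  moreover have "F w \<subseteq> topspace X" using VW(3) w good_subset[OF VW(2)] by (simp add: refinement_map_def)
  ultimately have "PI (F w') = PI (F w)" using PI_T[of "F w"] by metis
  then show ?thesis by (simp add: desc_map_def w'_def)
qed

lemma desc_map_refinement:
  assumes "good V" "good W" "refinement_map V W F" "equivariant V F"
  shows "refinement_map (PI ` V) (PI ` W) (desc_map V F)"
  using assms(3) unfolding refinement_map_def by (auto simp: desc_map_PI[OF assms])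

lemma desc_pull:
  assumes VW: "good V" "good W" "refinement_map V W F" "equivariant V F" and e: "e \<in> inv_cochains W"
  shows "pull_cochain (PI ` V) (desc_map V F) (desc W e) = desc V (pull_cochain V F e)"
proof (rule lift_inj[OF VW(1)])
  have "pullback V PI (pull_cochain (PI ` V) (desc_map V F) (desc W e)) = pullback V (PI \<circ> F) (desc W e)"
    unfolding pull_cochain_pullback pullback_pull[OF simplicial_PI]
    by (intro pullback_cong) (simp add: desc_map_PI[OF VW])
  also have "\<dots> = pull_cochain V F (pullback W PI (desc W e))"
    by (simp add: pull_cochain_pullback pullback_pull[OF refinement_map_simplicial[OF VW(3)]])
  also have "\<dots> = pullback V PI (desc V (pull_cochain V F e))"
    by (simp add: lift_desc VW e inv_cochains_pull[OF VW e])
  finally show "pullback V PI (pull_cochain (PI ` V) (desc_map V F) (desc W e))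
    = pullback V PI (desc V (pull_cochain V F e))" .
qed (use VW e in \<open>auto intro!: desc_cochains inv_cochains_pull[OF VW]\<close>)

end

context free_involution
begin

section \<open>The Gysin sequence\<close>

definition inv_cocycle :: "'a set set \<Rightarrow> ('a set list \<Rightarrow> bit) \<Rightarrow> bool"
  where "inv_cocycle W e \<longleftrightarrow> good W \<and> e \<in> inv_cochains W \<and> coboundary W e = (\<lambda>s. 0)"

text \<open>By \<open>coho_Y_rep\<close> every class of the orbit space has this form, so H(Y) can
  be computed with invariant cochains on \<open>X\<close> throughout.\<close>

definition clsY :: "'a set set \<Rightarrow> ('a set list \<Rightarrow> bit) \<Rightarrow> ('b set set \<times> ('b set list \<Rightarrow> bit)) set"
  where "clsY W e = cech_class Y (PI ` W) (desc W e)"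

lemma inv_cocycleD: "inv_cocycle W e \<Longrightarrow> good W" "inv_cocycle W e \<Longrightarrow> e \<in> inv_cochains W" "inv_cocycle W e \<Longrightarrow> coboundary W e = (\<lambda>s. 0)"
  by (simp_all add: inv_cocycle_def)

lemma inv_cocycle_cocycle: "inv_cocycle W e \<Longrightarrow> (PI ` W, desc W e) \<in> cech_cocycles Y"
  unfolding inv_cocycle_def using desc_coboundary[of W e] by (auto intro!: cocycleI PI_cover desc_cochains)

lemma inv_cocycle_cocycle_X: "inv_cocycle W e \<Longrightarrow> (W, e) \<in> cech_cocycles X"
  unfolding inv_cocycle_def using inv_cochains_subset good_cover by (auto intro!: cocycleI)

lemma clsY_carrier: "inv_cocycle W e \<Longrightarrow> clsY W e \<in> carrier (coho Y)"
  unfolding clsY_def using inv_cocycle_cocycle by (rule coho_carrierI)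

lemma inv_cocycle_add: "inv_cocycle W a \<Longrightarrow> inv_cocycle W b \<Longrightarrow> inv_cocycle W (\<lambda>s. a s + b s)"
  by (simp add: inv_cocycle_def inv_cochains_add coboundary_add)

lemma inv_cocycle_zero: "good W \<Longrightarrow> inv_cocycle W (\<lambda>s. 0)"
  by (simp add: inv_cocycle_def)

lemma inv_cocycle_cup: "inv_cocycle W a \<Longrightarrow> inv_cocycle W b \<Longrightarrow> inv_cocycle W (cup W a b)"
  by (simp add: inv_cocycle_def inv_cochains_cup coboundary_cup inv_cochains_subset)

lemma inv_cocycle_trunc: "inv_cocycle W a \<Longrightarrow> inv_cocycle W (trunc j a)"
  by (simp add: inv_cocycle_def inv_cochains_trunc coboundary_trunc)

lemma inv_cocycle_unit: "good W \<Longrightarrow> inv_cocycle W (unit_cochain W)"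
  by (simp add: inv_cocycle_def inv_cochains_unit)

lemma pull_cob:
  "refinement_map V W F \<Longrightarrow> e \<in> cochains W \<Longrightarrow>
    coboundary V (pull_cochain V F e) = pull_cochain V F (coboundary W e)" for e :: "_ \<Rightarrow> bit"
  using pull_coboundary[OF refinement_map_simplicial, of V W F e] by simp

lemma inv_cocycle_pull:
  assumes "inv_cocycle W e" "good V" "refinement_map V W F" "equivariant V F"
  shows "inv_cocycle V (pull_cochain V F e)"
  using assms inv_cochains_pull[OF assms(2) _ assms(3,4), of e] pull_cob[OF assms(3), of e]
  by (simp add: inv_cocycle_def inv_cochains_subset)

lemma clsY_pull:
  assumes "inv_cocycle W e" "good V" "refinement_map V W F" "equivariant V F"
  shows "clsY V (pull_cochain V F e) = clsY W e"
proof -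
  note W = inv_cocycleD[OF assms(1)]
  show ?thesis
    unfolding clsY_def desc_pull[OF assms(2) W(1) assms(3,4) W(2), symmetric]
    using cech_class_pull[OF inv_cocycle_cocycle[OF assms(1)] PI_cover[OF assms(2)]
        desc_map_refinement[OF assms(2) W(1) assms(3,4)]] .
qed

lemma clsY_add: "inv_cocycle W a \<Longrightarrow> inv_cocycle W b \<Longrightarrow> clsY W a \<oplus>\<^bsub>coho Y\<^esub> clsY W b = clsY W (\<lambda>s. a s + b s)"
  unfolding clsY_def by (simp add: coho_add inv_cocycle_cocycle desc_add inv_cocycleD)

lemma clsY_mult: "inv_cocycle W a \<Longrightarrow> inv_cocycle W b \<Longrightarrow> clsY W a \<otimes>\<^bsub>coho Y\<^esub> clsY W b = clsY W (cup W a b)"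
  unfolding clsY_def by (simp add: coho_mult inv_cocycle_cocycle desc_cup inv_cocycleD)

lemma clsY_zero: "good W \<Longrightarrow> clsY W (\<lambda>s. 0) = \<zero>\<^bsub>coho Y\<^esub>"
  unfolding clsY_def by (simp add: coho_zero[OF PI_cover])

lemma clsY_one: "good W \<Longrightarrow> clsY W (unit_cochain W) = \<one>\<^bsub>coho Y\<^esub>"
  unfolding clsY_def by (simp add: coho_one[OF PI_cover] desc_unit)

lemma clsY_proj: "inv_cocycle W e \<Longrightarrow> coho_proj Y i (clsY W e) = clsY W (trunc (Suc i) e)"
  unfolding clsY_def by (simp add: coho_proj_class inv_cocycle_cocycle desc_trunc inv_cocycleD)

lemma clsY_component_trunc:
  "inv_cocycle W e \<Longrightarrow> clsY W e \<in> component (coho Y) i \<Longrightarrow> clsY W (trunc (Suc i) e) = clsY W e"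
  using clsY_proj[of W e i] coho_proj_on_component[of "clsY W e" Y i i] by simp

lemma clsY_component: "inv_cocycle W e \<Longrightarrow> trunc (Suc i) e = e \<Longrightarrow> clsY W e \<in> component (coho Y) i"
  using coho_proj_component[OF clsY_carrier, of W e i] by (simp add: clsY_proj)

lemma clsX_component_trunc:
  "(W, e) \<in> cech_cocycles X \<Longrightarrow> cech_class X W e \<in> component (coho X) i \<Longrightarrow>
    cech_class X W (trunc (Suc i) e) = cech_class X W e"
  using coho_proj_class[of W e X i] coho_proj_on_component[of "cech_class X W e" X i i] by simp

lemma clsY_eqI:
  assumes "inv_cocycle W a" "inv_cocycle W b" "x \<in> inv_cochains W" "\<And>s. a s + b s = coboundary W x s"
  shows "clsY W a = clsY W b"
  unfolding clsY_def
proof (rule cech_class_eqI[OF inv_cocycle_cocycle[OF assms(1)] inv_cocycle_cocycle[OF assms(2)]])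
  note W = inv_cocycleD(1)[OF assms(1)]
  show "desc W x \<in> cochains (PI ` W)" using desc_cochains[OF W assms(3)] .
  have "(\<lambda>s. a s + b s) = coboundary W x" using assms(4) by (simp add: fun_eq_iff)
  then have "(\<lambda>s. desc W a s + desc W b s) = coboundary (PI ` W) (desc W x)"
    using desc_add[OF W, of a b] desc_coboundary[OF W assms(3)] inv_cocycleD(2)[OF assms(1)] inv_cocycleD(2)[OF assms(2)] by simp
  then show "desc W a s + desc W b s = coboundary (PI ` W) (desc W x) s" for s by (metis)
qed

text \<open>Images of good covers are cofinal among the open covers of the orbit space: pull the
  given cover back to \<open>X\<close> and refine it there.\<close>

lemma ex_good_over:
  assumes V: "open_cover Y V" and C: "open_cover X C"
  obtains W f where "good W" "refines W C" "refinement_map (PI ` W) V f"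
proof -
  let ?P = "(\<lambda>v. {x \<in> topspace X. \<pi> x \<in> v}) ` V"
  have q: "continuous_map X Y \<pi>" using quotient quotient_imp_continuous_map by blast
  have P: "open_cover X ?P" unfolding open_cover_def
  proof
    show "\<forall>u \<in> ?P. openin X u"
      using V openin_continuous_map_preimage[OF q] by (simp add: open_cover_def)
    show "\<Union>?P = topspace X"
    proof (intro subset_antisym subsetI)
      fix x assume x: "x \<in> topspace X"
      then have "\<pi> x \<in> topspace Y" using q by (auto simp: continuous_map_def)
      then have "\<pi> x \<in> \<Union>V" using V by (simp add: open_cover_def)
      then show "x \<in> \<Union>?P" using x by auto
    qed auto
  qed
  obtain B where B: "open_cover X B" "refines B ?P" "refines B C"
    using common_refinement[OF P C] by blast
  obtain W where W: "good W" "refines W B" using ex_good_refines[OF B(1)] by blast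
  have "refines (PI ` W) V" unfolding refines_def
  proof
    fix u assume "u \<in> PI ` W"
    then obtain w where w: "w \<in> W" "u = PI w" by (rule imageE)
    obtain v where "v \<in> V" "w \<subseteq> {x \<in> topspace X. \<pi> x \<in> v}"
      using refines_trans[OF W(2) B(2)] w(1) by (auto simp: refines_def)
    then show "\<exists>v \<in> V. u \<subseteq> v" using w(2) by (intro bexI[of _ v]) auto
  qed
  then obtain f where "refinement_map (PI ` W) V f" using refines_refinement_map by blast
  then show ?thesis using that W(1) refines_trans[OF W(2) B(3)] by blast
qed

lemma lift_cocycle:
  assumes "(PI ` W, c) \<in> cech_cocycles Y" "good W"
  shows "inv_cocycle W (pullback W PI c)" "clsY W (pullback W PI c) = cech_class Y (PI ` W) c"
  using cocycleD[OF assms(1)] assms(2) pullback_coboundary[OF simplicial_PI, of c W]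
  by (simp_all add: inv_cocycle_def inv_cochains_lift clsY_def desc_lift)

lemma coho_Y_rep2:
  assumes "A \<in> carrier (coho Y)" "B \<in> carrier (coho Y)" "open_cover X C"
  obtains W a b where "refines W C" "inv_cocycle W a" "inv_cocycle W b" "A = clsY W a" "B = clsY W b"
proof -
  obtain U c d where cd: "(U, c) \<in> cech_cocycles Y" "(U, d) \<in> cech_cocycles Y"
    "A = cech_class Y U c" "B = cech_class Y U d"
    using coho_carrier2[OF assms(1,2)] by metis
  obtain W f where W: "good W" "refines W C" "refinement_map (PI ` W) U f"
    using ex_good_over[OF cocycleD(1)[OF cd(1)] assms(3)] by blast
  note pc = cocycle_pull[OF cd(1) PI_cover[OF W(1)] W(3)] and pd = cocycle_pull[OF cd(2) PI_cover[OF W(1)] W(3)]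
  show ?thesis
  proof (rule that[OF W(2) lift_cocycle(1)[OF pc W(1)] lift_cocycle(1)[OF pd W(1)]])
    show "A = clsY W (pullback W PI (pull_cochain (PI ` W) f c))"
      using cech_class_pull[OF cd(1) PI_cover[OF W(1)] W(3)] lift_cocycle(2)[OF pc W(1)] cd(3) by simp
    show "B = clsY W (pullback W PI (pull_cochain (PI ` W) f d))"
      using cech_class_pull[OF cd(2) PI_cover[OF W(1)] W(3)] lift_cocycle(2)[OF pd W(1)] cd(4) by simp
  qed
qed

lemma coho_Y_rep:
  assumes "A \<in> carrier (coho Y)"
  obtains W a where "inv_cocycle W a" "A = clsY W a"
  using coho_Y_rep2[OF assms assms open_cover_topspace] by metis

lemma coho_X_rep2:
  assumes "A \<in> carrier (coho X)" "B \<in> carrier (coho X)"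
  obtains W a b where "good W" "(W, a) \<in> cech_cocycles X" "(W, b) \<in> cech_cocycles X"
    "A = cech_class X W a" "B = cech_class X W b"
proof -
  obtain U c d where cd: "(U, c) \<in> cech_cocycles X" "(U, d) \<in> cech_cocycles X"
    "A = cech_class X U c" "B = cech_class X U d"
    using coho_carrier2[OF assms(1,2)] by metis
  obtain W where W: "good W" "refines W U"
    using ex_good_refines[OF cocycleD(1)[OF cd(1)]] by blast
  obtain f where f: "refinement_map W U f" using refines_refinement_map[OF W(2)] by blast
  note gc = good_cover[OF W(1)]
  show ?thesis
    using that[OF W(1) cocycle_pull[OF cd(1) gc f] cocycle_pull[OF cd(2) gc f]]
      cech_class_pull[OF cd(1) gc f] cech_class_pull[OF cd(2) gc f] cd(3,4) by simp
qed

lemma coho_X_rep: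
  assumes "A \<in> carrier (coho X)"
  obtains W a where "good W" "(W, a) \<in> cech_cocycles X" "A = cech_class X W a"
  using coho_X_rep2[OF assms assms] by metis

lemma refines_PI: "refines V B \<Longrightarrow> refines (PI ` V) (PI ` B)"
  unfolding refines_def by (simp, meson image_mono)

text \<open>What matters is that the primitive \<open>x\<close> is invariant. It is the lift of a
  primitive on the orbit space, and equivariance of \<open>F\<close> and \<open>G\<close> lets the
  refinement maps descend to compare the two.\<close>

lemma clsY_eqD:
  assumes a: "inv_cocycle W a" and b: "inv_cocycle W' b" and eq: "clsY W a = clsY W' b"
  obtains V F G x where "good V" "refinement_map V W F" "equivariant V F"
    "refinement_map V W' G" "equivariant V G" "x \<in> inv_cochains V"
    "\<And>s. pull_cochain V F a s + pull_cochain V G b s = coboundary V x s"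
proof -
  obtain Z where Z: "open_cover Y Z" and wit: "\<And>V f g. refines V Z \<Longrightarrow> refinement_map V (PI ` W) f \<Longrightarrow>
      refinement_map V (PI ` W') g \<Longrightarrow>
      \<exists>e \<in> cochains V. \<forall>s. pull_cochain V f (desc W a) s + pull_cochain V g (desc W' b) s = coboundary V e s"
    using cech_common_witness[OF inv_cocycle_cocycle[OF a] inv_cocycle_cocycle[OF b] eq[unfolded clsY_def]] by metis
  obtain B f where B: "good B" "refinement_map (PI ` B) Z f"
    using ex_good_over[OF Z open_cover_topspace] by blast
  obtain V F G where V: "good V" "refines V B" "refinement_map V W F" "equivariant V F"
    "refinement_map V W' G" "equivariant V G"
    using common_good[OF inv_cocycleD(1)[OF a] inv_cocycleD(1)[OF b] good_cover[OF B(1)]] by blast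
  have r: "refines (PI ` V) Z"
    using refines_trans[OF refines_PI[OF V(2)] refinement_map_refines[OF B(2)]] .
  note FW = desc_map_refinement[OF V(1) inv_cocycleD(1)[OF a] V(3,4)] and GW = desc_map_refinement[OF V(1) inv_cocycleD(1)[OF b] V(5,6)]
  obtain e where e: "e \<in> cochains (PI ` V)"
      "\<forall>s. pull_cochain (PI ` V) (desc_map V F) (desc W a) s + pull_cochain (PI ` V) (desc_map V G) (desc W' b) s
        = coboundary (PI ` V) e s"
    using wit[OF r FW GW] by blast
  note pa = inv_cocycleD(2)[OF inv_cocycle_pull[OF a V(1,3,4)]] and pb = inv_cocycleD(2)[OF inv_cocycle_pull[OF b V(1,5,6)]]
  have "(\<lambda>s. desc V (pull_cochain V F a) s + desc V (pull_cochain V G b) s) = coboundary (PI ` V) e"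
    using e(2) desc_pull[OF V(1) inv_cocycleD(1)[OF a] V(3,4) inv_cocycleD(2)[OF a]]
      desc_pull[OF V(1) inv_cocycleD(1)[OF b] V(5,6) inv_cocycleD(2)[OF b]] by (simp add: fun_eq_iff)
  then have "desc V (\<lambda>s. pull_cochain V F a s + pull_cochain V G b s) = coboundary (PI ` V) e"
    by (simp add: desc_add[OF V(1) pa pb])
  then have "pullback V PI (desc V (\<lambda>s. pull_cochain V F a s + pull_cochain V G b s)) = coboundary V (pullback V PI e)"
    using pullback_coboundary[OF simplicial_PI, of e V] e(1) by simp
  then have h: "(\<lambda>s. pull_cochain V F a s + pull_cochain V G b s) = coboundary V (pullback V PI e)"
    unfolding lift_desc[OF V(1) inv_cochains_add[OF pa pb]] .
  show ?thesis
    using that[OF V(1,3-6) inv_cochains_lift[OF V(1) e(1)]] fun_cong[OF h] by simp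
qed

lemma clsX_eqD:
  fixes a b :: "'a set list \<Rightarrow> bit"
  assumes W: "good W" "good W'" and a: "(W, a) \<in> cech_cocycles X" and b: "(W', b) \<in> cech_cocycles X"
    and eq: "cech_class X W a = cech_class X W' b"
  obtains V F G x where "good V" "refinement_map V W F" "equivariant V F"
    "refinement_map V W' G" "equivariant V G" "x \<in> cochains V"
    "\<And>s. pull_cochain V F a s + pull_cochain V G b s = coboundary V x s"
proof -
  obtain Z where Z: "open_cover X Z" and wit: "\<And>V f g. refines V Z \<Longrightarrow> refinement_map V W f \<Longrightarrow>
      refinement_map V W' g \<Longrightarrow>
      \<exists>e \<in> cochains V. \<forall>s. pull_cochain V f a s + pull_cochain V g b s = coboundary V e s"
    using cech_common_witness[OF a b eq] by metis
  obtain V F G where V: "good V" "refines V Z" "refinement_map V W F" "equivariant V F"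
    "refinement_map V W' G" "equivariant V G"
    using common_good[OF W Z] by blast
  then show ?thesis using wit[OF V(2,3,5)] that by blast
qed

lemma clsY_zeroD:
  assumes "inv_cocycle W a" "clsY W a = \<zero>\<^bsub>coho Y\<^esub>"
  obtains V F x where "good V" "refinement_map V W F" "equivariant V F" "x \<in> inv_cochains V"
    "pull_cochain V F a = coboundary V x"
proof -
  note W = inv_cocycleD(1)[OF assms(1)]
  obtain V F G x where "good V" "refinement_map V W F" "equivariant V F" "x \<in> inv_cochains V"
    "\<And>s. pull_cochain V F a s + pull_cochain V G (\<lambda>s. 0) s = coboundary V x s"
    using clsY_eqD[OF assms(1) inv_cocycle_zero[OF W]] assms(2) clsY_zero[OF W] by metis
  then show ?thesis by (intro that) (auto simp: fun_eq_iff)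
qed

lemma clsX_zeroD:
  fixes a :: "'a set list \<Rightarrow> bit"
  assumes "good W" "(W, a) \<in> cech_cocycles X" "cech_class X W a = \<zero>\<^bsub>coho X\<^esub>"
  obtains V F x where "good V" "refinement_map V W F" "equivariant V F" "x \<in> cochains V"
    "pull_cochain V F a = coboundary V x"
proof -
  note W = good_cover[OF assms(1)]
  obtain V F G x where "good V" "refinement_map V W F" "equivariant V F" "x \<in> cochains V"
    "\<And>s. pull_cochain V F a s + pull_cochain V G (\<lambda>s. 0) s = coboundary V x s"
    using clsX_eqD[OF assms(1,1,2) cocycle_zero[OF W]] assms(3) coho_zero[OF W] by metis
  then show ?thesis by (intro that) (auto simp: fun_eq_iff)
qed

section \<open>Pullback to the double cover and transfer back to the orbit space\<close>

text \<open>On cochains the pullback is the inclusion of the invariant ones. A representative is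
  chosen here, and \<open>pi_star_clsY\<close> shows the result to be independent of it;
  \<open>transfer\<close> is treated in the same way.\<close>

definition pi_star :: "('b set set \<times> ('b set list \<Rightarrow> bit)) set \<Rightarrow> ('a set set \<times> ('a set list \<Rightarrow> bit)) set"
  where "pi_star A = (case SOME p. inv_cocycle (fst p) (snd p) \<and> A = clsY (fst p) (snd p) of (W, e) \<Rightarrow> cech_class X W e)"

definition tr :: "'a set set \<Rightarrow> ('a set list \<Rightarrow> bit) \<Rightarrow> 'a set list \<Rightarrow> bit"
  where "tr W e = (\<lambda>s. e s + Tc W e s)"

definition transfer :: "('a set set \<times> ('a set list \<Rightarrow> bit)) set \<Rightarrow> ('b set set \<times> ('b set list \<Rightarrow> bit)) set"
  where "transfer B = (case SOME p. good (fst p) \<and> p \<in> cech_cocycles X \<and> B = cech_class X (fst p) (snd p) of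
     (W, e) \<Rightarrow> clsY W (tr W e))"

lemma inv_cocycle_tr:
  assumes "good W" "(W, e) \<in> cech_cocycles X" shows "inv_cocycle W (tr W e)"
  using cocycleD[OF assms(2)] assms(1) inv_cochains_norm[OF assms(1)] Tc_coboundary[OF assms(1), of e]
  by (auto simp: inv_cocycle_def tr_def coboundary_add)

lemma tr_coboundary: "good W \<Longrightarrow> e \<in> cochains W \<Longrightarrow> tr W (coboundary W e) = coboundary W (tr W e)"
  by (simp add: tr_def coboundary_add Tc_coboundary)

lemma tr_add: "tr W (\<lambda>s. a s + b s) = (\<lambda>s. tr W a s + tr W b s)"
  by (simp add: tr_def pull_add ac_simps)

lemma tr_trunc: "tr W (trunc j a) = trunc j (tr W a)"
  by (simp add: tr_def pull_trunc trunc_add flip: pull_trunc)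

lemma tr_pull:
  assumes "good V" "good W" "refinement_map V W F" "equivariant V F"
  shows "tr V (pull_cochain V F e) = pull_cochain V F (tr W e)"
  by (simp add: tr_def pull_add Tc_pull[OF assms])

lemma tr_inv: "e \<in> inv_cochains W \<Longrightarrow> tr W e = (\<lambda>s. 0)"
  by (simp add: tr_def inv_cochains_def)

lemma tr_zeroD:
  assumes "e \<in> cochains W" "tr W e = (\<lambda>s. 0)" shows "e \<in> inv_cochains W"
proof -
  have "e s + Tc W e s = 0" for s using fun_cong[OF assms(2), of s] by (simp add: tr_def)
  then have "e = Tc W e" using bit_eq_iff_sum by blast
  then show ?thesis using assms(1) by (simp add: inv_cochains_def)
qed

lemma tr_inv_cochains: "good W \<Longrightarrow> e \<in> cochains W \<Longrightarrow> tr W e \<in> inv_cochains W"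
  by (simp add: tr_def inv_cochains_norm)

lemma pi_star_clsY:
  assumes "inv_cocycle W e" shows "pi_star (clsY W e) = cech_class X W e"
proof -
  define p where "p = (SOME p. inv_cocycle (fst p) (snd p) \<and> clsY W e = clsY (fst p) (snd p))"
  obtain W' e' where p: "p = (W', e')" by fastforce
  have "inv_cocycle (fst p) (snd p) \<and> clsY W e = clsY (fst p) (snd p)"
    unfolding p_def by (rule someI[of _ "(W, e)"]) (simp add: assms)
  then have e': "inv_cocycle W' e'" "clsY W e = clsY W' e'" by (simp_all add: p)
  obtain V F G x where V: "good V" "refinement_map V W F" "equivariant V F"
    "refinement_map V W' G" "equivariant V G" "x \<in> inv_cochains V"
    "\<And>s. pull_cochain V F e s + pull_cochain V G e' s = coboundary V x s"
    using clsY_eqD[OF assms e'(1,2)] by blast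
  have "cech_class X W e = cech_class X W' e'"
    using cech_class_eqI[OF cocycle_pull[OF inv_cocycle_cocycle_X[OF assms] good_cover[OF V(1)] V(2)]
        cocycle_pull[OF inv_cocycle_cocycle_X[OF e'(1)] good_cover[OF V(1)] V(4)] inv_cochains_subset[OF V(6)] V(7)]
      cech_class_pull[OF inv_cocycle_cocycle_X[OF assms] good_cover[OF V(1)] V(2)]
      cech_class_pull[OF inv_cocycle_cocycle_X[OF e'(1)] good_cover[OF V(1)] V(4)] by simp
  then show ?thesis unfolding pi_star_def p_def[symmetric] by (simp add: p)
qed

text \<open>\<open>tr\<close> commutes with coboundaries and with equivariant refinement, and it
  turns an arbitrary primitive on \<open>X\<close> into an invariant one.\<close>

lemma transfer_class:
  assumes W: "good W" and e: "(W, e) \<in> cech_cocycles X"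
  shows "transfer (cech_class X W e) = clsY W (tr W e)"
proof -
  define p where "p = (SOME p. good (fst p) \<and> p \<in> cech_cocycles X \<and> cech_class X W e = cech_class X (fst p) (snd p))"
  obtain W' e' where p: "p = (W', e')" by fastforce
  have "good (fst p) \<and> p \<in> cech_cocycles X \<and> cech_class X W e = cech_class X (fst p) (snd p)"
    unfolding p_def by (rule someI[of _ "(W, e)"]) (simp add: assms)
  then have e': "good W'" "(W', e') \<in> cech_cocycles X" "cech_class X W e = cech_class X W' e'" by (simp_all add: p)
  obtain V F G x where V: "good V" "refinement_map V W F" "equivariant V F"
    "refinement_map V W' G" "equivariant V G" "x \<in> cochains V"
    "\<And>s. pull_cochain V F e s + pull_cochain V G e' s = coboundary V x s"
    using clsX_eqD[OF W e'(1) e e'(2,3)] by blast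
  have "(\<lambda>s. pull_cochain V F e s + pull_cochain V G e' s) = coboundary V x" using V(7) by (simp add: fun_eq_iff)
  then have "(\<lambda>s. tr V (pull_cochain V F e) s + tr V (pull_cochain V G e') s) = coboundary V (tr V x)"
    using tr_add[of V "pull_cochain V F e" "pull_cochain V G e'"] tr_coboundary[OF V(1,6)] by simp
  then have "(\<lambda>s. pull_cochain V F (tr W e) s + pull_cochain V G (tr W' e') s) = coboundary V (tr V x)"
    by (simp add: tr_pull[OF V(1) W V(2,3)] tr_pull[OF V(1) e'(1) V(4,5)])
  then have h: "pull_cochain V F (tr W e) s + pull_cochain V G (tr W' e') s = coboundary V (tr V x) s" for s
    by (rule fun_cong)
  note c = inv_cocycle_tr[OF W e] and c' = inv_cocycle_tr[OF e'(1,2)]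
  have "clsY W (tr W e) = clsY W' (tr W' e')"
    using clsY_eqI[OF inv_cocycle_pull[OF c V(1-3)] inv_cocycle_pull[OF c' V(1,4,5)] tr_inv_cochains[OF V(1,6)] h]
      clsY_pull[OF c V(1-3)] clsY_pull[OF c' V(1,4,5)] by simp
  then show ?thesis unfolding transfer_def p_def[symmetric] by (simp add: p)
qed

lemma pi_star_add:
  assumes "A \<in> carrier (coho Y)" "B \<in> carrier (coho Y)"
  shows "pi_star (A \<oplus>\<^bsub>coho Y\<^esub> B) = pi_star A \<oplus>\<^bsub>coho X\<^esub> pi_star B"
proof -
  obtain W a b where W: "inv_cocycle W a" "inv_cocycle W b" "A = clsY W a" "B = clsY W b"
    using coho_Y_rep2[OF assms open_cover_topspace] by metis
  then show ?thesis by (simp add: clsY_add pi_star_clsY inv_cocycle_add coho_add inv_cocycle_cocycle_X)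
qed

lemma transfer_add:
  assumes "A \<in> carrier (coho X)" "B \<in> carrier (coho X)"
  shows "transfer (A \<oplus>\<^bsub>coho X\<^esub> B) = transfer A \<oplus>\<^bsub>coho Y\<^esub> transfer B"
proof -
  obtain W a b where W: "good W" "(W, a) \<in> cech_cocycles X" "(W, b) \<in> cech_cocycles X"
    "A = cech_class X W a" "B = cech_class X W b"
    using coho_X_rep2[OF assms] by metis
  then show ?thesis by (simp add: coho_add transfer_class cocycle_add clsY_add inv_cocycle_tr tr_add)
qed

lemma pi_star_component:
  assumes "A \<in> component (coho Y) i" shows "pi_star A \<in> component (coho X) i"
proof -
  obtain W a where W: "inv_cocycle W a" "A = clsY W a" using coho_Y_rep[OF coho_component_carrier[OF assms]] by metis
  then have "A = clsY W (trunc (Suc i) a)" using clsY_component_trunc assms by simp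
  then have "pi_star A = cech_class X W (trunc (Suc i) a)" using pi_star_clsY[OF inv_cocycle_trunc[OF W(1)]] by simp
  moreover have "cech_class X W (trunc (Suc i) a) \<in> component (coho X) i"
    unfolding coho_component using inv_cocycle_cocycle_X[OF inv_cocycle_trunc[OF W(1)]] trunc_trunc[of "Suc i" "Suc i" a] by auto
  ultimately show ?thesis by simp
qed

lemma transfer_component:
  assumes "A \<in> component (coho X) i" shows "transfer A \<in> component (coho Y) i"
proof -
  obtain W a where W: "good W" "(W, a) \<in> cech_cocycles X" "A = cech_class X W a"
    using coho_X_rep[OF coho_component_carrier[OF assms]] by metis
  then have "A = cech_class X W (trunc (Suc i) a)" using clsX_component_trunc assms by simp
  then have "transfer A = clsY W (trunc (Suc i) (tr W a))"
    using transfer_class[OF W(1) cocycle_trunc[OF W(2)]] by (simp add: tr_trunc)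
  then show ?thesis
    using clsY_component[OF inv_cocycle_trunc[OF inv_cocycle_tr[OF W(1,2)]], of i "Suc i"] by (simp add: trunc_trunc)
qed

text \<open>Degree zero cochains with \<open>u + T u = 1\<close>; the invariant coboundary of such a cochain
  represents the characteristic class of the double cover.\<close>

definition section_of :: "'a set set \<Rightarrow> ('a set list \<Rightarrow> bit) \<Rightarrow> bool"
  where "section_of W u \<longleftrightarrow> good W \<and> u \<in> cochains W \<and> trunc 1 u = u \<and> tr W u = unit_cochain W"

lemma section_pull:
  assumes "section_of W u" "good V" "refinement_map V W F" "equivariant V F"
  shows "section_of V (pull_cochain V F u)"
proof -
  have u: "good W" "u \<in> cochains W" "trunc 1 u = u" "tr W u = unit_cochain W"
    using assms(1) by (simp_all add: section_of_def)
  then show ?thesis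
    using assms(2) pull_cochains[OF u(2), of V F] tr_pull[OF assms(2) u(1) assms(3,4), of u]
      pull_unit[OF refinement_map_simplicial[OF assms(3)]] pull_trunc[of V F 1 u]
    by (simp add: section_of_def)
qed

lemma inv_cocycle_section:
  assumes "section_of W u" shows "inv_cocycle W (coboundary W u)"
  unfolding inv_cocycle_def
proof (intro conjI)
  have u: "good W" "u \<in> cochains W" "tr W u = unit_cochain W" using assms by (simp_all add: section_of_def)
  show "good W" by fact
  show "coboundary W u \<in> inv_cochains W"
    using u tr_coboundary[OF u(1,2)] by (intro tr_zeroD) (auto simp: coboundary_cochains)
  show "coboundary W (coboundary W u) = (\<lambda>s. 0)" using u by simp
qed

text \<open>A section adapted to \<open>c\<close>. For \<open>c\<close> disjoint from its translate
  the value is 1 on members inside \<open>c\<close> and 0 on members inside the translate, and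
  elsewhere the arbitrary rule \<open>sel\<close> decides. Hence its coboundary vanishes on edges
  inside \<open>c\<close>, as needed for nilpotence.\<close>

definition usec :: "'a set set \<Rightarrow> 'a set \<Rightarrow> 'a set list \<Rightarrow> bit"
  where "usec W c s = (if s \<in> nerve W \<and> length s = 1 \<and> (hd s \<subseteq> c \<or> \<not> hd s \<subseteq> T ` c \<and> sel (hd s)) then 1 else 0)"

lemma section_usec:
  assumes W: "good W" and c: "c \<subseteq> topspace X" "c \<inter> T ` c = {}"
  shows "section_of W (usec W c)"
  unfolding section_of_def
proof (intro conjI)
  show "good W" by fact
  show "usec W c \<in> cochains W" by (rule cochainsI[of _ _ 1]) (auto simp: usec_def)
  show "trunc 1 (usec W c) = usec W c" by (auto simp: trunc_def usec_def fun_eq_iff)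
  show "tr W (usec W c) = unit_cochain W"
  proof
    fix s
    show "tr W (usec W c) s = unit_cochain W s"
    proof (cases "s \<in> nerve W \<and> length s = 1")
      case True
      then obtain w where s: "s = [w]" "[w] \<in> nerve W" by (auto simp: length_Suc_conv)
      then have w: "w \<in> W" by (auto simp: nerve_def)
      note wX = good_subset[OF W w]
      have Tw: "[T ` w] \<in> nerve W" using simplicial_T[OF W] s(2) unfolding simplicial_def by fastforce
      have 1: "T ` w \<subseteq> c \<longleftrightarrow> w \<subseteq> T ` c"
        using T_image_T_image[OF wX] T_image_T_image[OF c(1)] by (metis image_mono)
      have 2: "T ` w \<subseteq> T ` c \<longleftrightarrow> w \<subseteq> c"
        using T_image_T_image[OF wX] T_image_T_image[OF c(1)] by (metis image_mono)
      have 3: "\<not> (w \<subseteq> c \<and> w \<subseteq> T ` c)" using good_nonempty[OF W w] c(2) by blast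
      show ?thesis
        using s Tw 1 2 3 sel_T[OF W w] by (auto simp: tr_def pull_cochain_def usec_def unit_cochain_def)
    next
      case False
      then show ?thesis by (auto simp: tr_def pull_cochain_def usec_def unit_cochain_def)
    qed
  qed
qed

text \<open>For the empty set the adapted section is just the selector \<open>sel\<close>, as
  members of a good cover are nonempty.\<close>

lemma ex_section: "good W \<Longrightarrow> \<exists>u. section_of W u"
  using section_usec[of W "{}"] by auto

text \<open>On a common refinement the sum of two sections is invariant, because
  \<open>1 + 1 = 0\<close>; it is the invariant primitive of the sum of their coboundaries.\<close>

lemma section_class:
  assumes u: "section_of W u" and u': "section_of W' u'"
  shows "clsY W (coboundary W u) = clsY W' (coboundary W' u')"
proof -
  have g: "good W" "good W'" and uc: "u \<in> cochains W" "u' \<in> cochains W'" using u u' by (simp_all add: section_of_def)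
  obtain V F G where V: "good V" "refinement_map V W F" "equivariant V F"
    "refinement_map V W' G" "equivariant V G"
    using common_good[OF g open_cover_topspace] by metis
  note su = section_pull[OF u V(1-3)] and su' = section_pull[OF u' V(1,4,5)]
  let ?b = "\<lambda>s. pull_cochain V F u s + pull_cochain V G u' s"
  have "?b \<in> inv_cochains V"
    using su su' by (intro tr_zeroD) (auto simp: section_of_def tr_add)
  moreover have "pull_cochain V F (coboundary W u) s + pull_cochain V G (coboundary W' u') s = coboundary V ?b s" for s
    by (simp add: coboundary_add pull_cob[OF V(2) uc(1)] pull_cob[OF V(4) uc(2)])
  ultimately show ?thesis
    using clsY_eqI[OF inv_cocycle_pull[OF inv_cocycle_section[OF u] V(1-3)] inv_cocycle_pull[OF inv_cocycle_section[OF u'] V(1,4,5)]]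
      clsY_pull[OF inv_cocycle_section[OF u] V(1-3)] clsY_pull[OF inv_cocycle_section[OF u'] V(1,4,5)] by simp
qed

definition y_class :: "('b set set \<times> ('b set list \<Rightarrow> bit)) set"
  where "y_class = (case SOME p. section_of (fst p) (snd p) of (W, u) \<Rightarrow> clsY W (coboundary W u))"

lemma y_class_eq:
  assumes "section_of W u" shows "y_class = clsY W (coboundary W u)"
proof -
  have "section_of (fst (SOME p. section_of (fst p) (snd p))) (snd (SOME p. section_of (fst p) (snd p)))"
    by (rule someI[of _ "(W, u)"]) (simp add: assms)
  then show ?thesis unfolding y_class_def case_prod_beta by (rule section_class[OF _ assms])
qed

lemma ex_good: obtains W where "good W"
  using ex_good_refines[OF open_cover_topspace] by blast

lemma y_component: "y_class \<in> component (coho Y) 1"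
proof -
  obtain W u where u: "section_of W u" using ex_good ex_section by metis
  then have "trunc (Suc 1) (coboundary W u) = coboundary W u"
    using coboundary_trunc[of W 1 u] by (simp add: section_of_def)
  then show ?thesis unfolding y_class_eq[OF u] by (rule clsY_component[OF inv_cocycle_section[OF u]])
qed

lemma y_mult:
  assumes "section_of W u" "inv_cocycle W e"
  shows "y_class \<otimes>\<^bsub>coho Y\<^esub> clsY W e = clsY W (cup W (coboundary W u) e)"
  using y_class_eq[OF assms(1)] clsY_mult[OF inv_cocycle_section[OF assms(1)] assms(2)] by simp

text \<open>For an invariant cocycle \<open>e\<close> the cochain \<open>u e + e u\<close> is
  invariant: replacing \<open>u\<close> by \<open>u + 1\<close> adds \<open>e + e = 0\<close>. Its
  coboundary is the commutator of \<open>d u\<close> and \<open>e\<close>.\<close>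

lemma y_central:
  assumes "A \<in> carrier (coho Y)"
  shows "y_class \<otimes>\<^bsub>coho Y\<^esub> A = A \<otimes>\<^bsub>coho Y\<^esub> y_class"
proof -
  obtain W e where W: "inv_cocycle W e" "A = clsY W e" using coho_Y_rep[OF assms] by metis
  note g = inv_cocycleD(1)[OF W(1)] and ei = inv_cocycleD(2)[OF W(1)]
  have ec: "e \<in> cochains W" "Tc W e = e" using ei by (simp_all add: inv_cochains_def)
  obtain u where u: "section_of W u" using ex_section[OF g] by blast
  have uc: "u \<in> cochains W" and Tu: "(\<lambda>s. u s + Tc W u s) = unit_cochain W"
    using u by (simp_all add: section_of_def tr_def)
  have Tu': "Tc W u = (\<lambda>s. u s + unit_cochain W s)"
    using Tu by (simp add: fun_eq_iff flip: Tu)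
  let ?x = "\<lambda>s. cup W u e s + cup W e u s"
  have "?x \<in> inv_cochains W"
    unfolding inv_cochains_def using ec uc
    by (auto simp: pull_add Tc_cup[OF g] Tu' cup_add_left cup_add_right ac_simps)
  moreover have "cup W (coboundary W u) e s + cup W e (coboundary W u) s = coboundary W ?x s" for s
    using ec uc inv_cocycleD(3)[OF W(1)] by (simp add: coboundary_add coboundary_cup)
  ultimately have "clsY W (cup W (coboundary W u) e) = clsY W (cup W e (coboundary W u))"
    using clsY_eqI[OF inv_cocycle_cup[OF inv_cocycle_section[OF u] W(1)] inv_cocycle_cup[OF W(1) inv_cocycle_section[OF u]]] by blast
  then show ?thesis
    using y_class_eq[OF u] clsY_mult[OF inv_cocycle_section[OF u] W(1)] clsY_mult[OF W(1) inv_cocycle_section[OF u]] W(2) by simp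
qed

text \<open>Since \<open>x\<close> is invariant and \<open>T u = u + 1\<close>, the transfer of
  \<open>u x\<close> is \<open>x\<close>, which cancels that of \<open>a\<close>. This correction is
  used twice in the proofs of exactness.\<close>

lemma inv_section_cup:
  assumes u: "section_of W u" and a: "a \<in> cochains W" and x: "tr W a = x" "x \<in> cochains W"
  shows "(\<lambda>s. cup W u x s + a s) \<in> inv_cochains W"
proof (rule tr_zeroD)
  have g: "good W" and uc: "u \<in> cochains W" and Tu: "tr W u = unit_cochain W"
    using u by (simp_all add: section_of_def)
  have Tu': "Tc W u = (\<lambda>s. u s + unit_cochain W s)"
    by (simp add: fun_eq_iff tr_def flip: Tu)
  have "Tc W x = x" using tr_inv_cochains[OF g a] x(1) by (simp add: inv_cochains_def)
  then have "tr W (cup W u x) = x"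
    unfolding tr_def using x(2) by (simp add: Tc_cup[OF g] Tu' cup_add_left)
  then show "tr W (\<lambda>s. cup W u x s + a s) = (\<lambda>s. 0)" by (simp add: tr_add x(1))
  show "(\<lambda>s. cup W u x s + a s) \<in> cochains W" using a uc x(2) by (intro cochains_add cup_cochains)
qed

section \<open>Exactness of the Gysin sequence\<close>

text \<open>If \<open>(d u) a = d x\<close> with \<open>x\<close> invariant, then
  \<open>u a + x\<close> is a cocycle on \<open>X\<close> with transfer \<open>a\<close>. Conversely
  \<open>u (tr b) + b\<close> is invariant and has coboundary \<open>(d u) (tr b)\<close>.\<close>

lemma kernel_y:
  assumes A: "A \<in> component (coho Y) i"
  shows "y_class \<otimes>\<^bsub>coho Y\<^esub> A = \<zero>\<^bsub>coho Y\<^esub> \<longleftrightarrow> A \<in> transfer ` component (coho X) i"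
proof
  assume 0: "y_class \<otimes>\<^bsub>coho Y\<^esub> A = \<zero>\<^bsub>coho Y\<^esub>"
  obtain W0 a0 where W0: "inv_cocycle W0 a0" "A = clsY W0 a0" using coho_Y_rep[OF coho_component_carrier[OF A]] by metis
  obtain u0 where u0: "section_of W0 u0" using ex_section[OF inv_cocycleD(1)[OF W0(1)]] by blast
  have "clsY W0 (cup W0 (coboundary W0 u0) a0) = \<zero>\<^bsub>coho Y\<^esub>"
    using 0 W0(2) y_mult[OF u0 W0(1)] by simp
  then obtain W F x where W: "good W" "refinement_map W W0 F" "equivariant W F" "x \<in> inv_cochains W"
    "pull_cochain W F (cup W0 (coboundary W0 u0) a0) = coboundary W x"
    using clsY_zeroD[OF inv_cocycle_cup[OF inv_cocycle_section[OF u0] W0(1)]] by metis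
  define a where "a = pull_cochain W F a0"
  define u where "u = pull_cochain W F u0"
  have a: "inv_cocycle W a" "A = clsY W a" and u: "section_of W u"
    using inv_cocycle_pull[OF W0(1) W(1-3)] clsY_pull[OF W0(1) W(1-3)] W0(2) section_pull[OF u0 W(1-3)]
    by (simp_all add: a_def u_def)
  have uc: "u \<in> cochains W" and Tu: "tr W u = unit_cochain W" using u by (simp_all add: section_of_def)
  have Tu': "Tc W u = (\<lambda>s. u s + unit_cochain W s)"
    by (simp add: fun_eq_iff tr_def flip: Tu)
  have ac: "a \<in> cochains W" "Tc W a = a" using inv_cocycleD(2)[OF a(1)] by (simp_all add: inv_cochains_def)
  have "u0 \<in> cochains W0" using u0 by (simp add: section_of_def)
  then have cx: "cup W (coboundary W u) a = coboundary W x"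
    using W(5) pull_cup[OF refinement_map_simplicial[OF W(2)], of "coboundary W0 u0" a0]
    by (simp add: a_def u_def pull_cob[OF W(2)])
  define b where "b = (\<lambda>s. cup W u a s + x s)"
  have b: "b \<in> cochains W" unfolding b_def using uc ac(1) inv_cochains_subset[OF W(4)] by (intro cochains_add cup_cochains)
  have "coboundary W b = (\<lambda>s. 0)"
    unfolding b_def using uc ac inv_cocycleD(3)[OF a(1)] cx by (simp add: coboundary_add coboundary_cup)
  then have bc: "(W, b) \<in> cech_cocycles X" using b good_cover[OF W(1)] by (intro cocycleI)
  have "tr W (cup W u a) = a"
    unfolding tr_def using ac by (simp add: Tc_cup[OF W(1)] Tu' cup_add_left)
  then have "tr W b = a" unfolding b_def by (simp add: tr_add tr_inv[OF W(4)])
  then have "transfer (cech_class X W (trunc (Suc i) b)) = clsY W (trunc (Suc i) a)"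
    using transfer_class[OF W(1) cocycle_trunc[OF bc]] by (simp add: tr_trunc)
  also have "\<dots> = A" using clsY_component_trunc[OF a(1)] A a(2) by simp
  finally have "transfer (cech_class X W (trunc (Suc i) b)) = A" .
  moreover have "cech_class X W (trunc (Suc i) b) \<in> component (coho X) i"
    unfolding coho_component using cocycle_trunc[OF bc] trunc_trunc[of "Suc i" "Suc i" b] by auto
  ultimately show "A \<in> transfer ` component (coho X) i" by blast
next
  assume "A \<in> transfer ` component (coho X) i"
  then obtain B where B: "B \<in> component (coho X) i" "A = transfer B" by blast
  obtain W b where W: "good W" "(W, b) \<in> cech_cocycles X" "B = cech_class X W b"
    using coho_X_rep[OF coho_component_carrier[OF B(1)]] by metis
  obtain u where u: "section_of W u" using ex_section[OF W(1)] by blast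
  note bb = cocycleD[OF W(2)] and t = inv_cocycle_tr[OF W(1,2)]
  note tc = inv_cochains_subset[OF inv_cocycleD(2)[OF t]]
  have uc: "u \<in> cochains W" using u by (simp add: section_of_def)
  let ?x = "\<lambda>s. cup W u (tr W b) s + b s"
  have "?x \<in> inv_cochains W" using inv_section_cup[OF u bb(2) refl tc] .
  moreover have "cup W (coboundary W u) (tr W b) s + 0 = coboundary W ?x s" for s
    using uc tc bb(3) inv_cocycleD(3)[OF t] by (simp add: coboundary_add coboundary_cup)
  ultimately have "clsY W (cup W (coboundary W u) (tr W b)) = clsY W (\<lambda>s. 0)"
    using clsY_eqI[OF inv_cocycle_cup[OF inv_cocycle_section[OF u] t] inv_cocycle_zero[OF W(1)]] by blast
  then show "y_class \<otimes>\<^bsub>coho Y\<^esub> A = \<zero>\<^bsub>coho Y\<^esub>"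
    using y_mult[OF u t] transfer_class[OF W(1,2)] B(2) W(3) clsY_zero[OF W(1)] by simp
qed

text \<open>If \<open>tr b = d x\<close> with \<open>x\<close> invariant, then
  \<open>tr (u x) = x\<close>, so adding \<open>d (u x)\<close> to \<open>b\<close> gives an
  invariant cocycle in the same class. Conversely, the transfer doubles invariant cochains and so
  kills them.\<close>

lemma kernel_transfer:
  assumes B: "B \<in> component (coho X) i"
  shows "transfer B = \<zero>\<^bsub>coho Y\<^esub> \<longleftrightarrow> B \<in> pi_star ` component (coho Y) i"
proof
  assume 0: "transfer B = \<zero>\<^bsub>coho Y\<^esub>"
  obtain W0 b0 where W0: "good W0" "(W0, b0) \<in> cech_cocycles X" "B = cech_class X W0 b0"
    using coho_X_rep[OF coho_component_carrier[OF B]] by metis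
  have "clsY W0 (tr W0 b0) = \<zero>\<^bsub>coho Y\<^esub>" using 0 W0(3) transfer_class[OF W0(1,2)] by simp
  then obtain W F x where W: "good W" "refinement_map W W0 F" "equivariant W F" "x \<in> inv_cochains W"
    "pull_cochain W F (tr W0 b0) = coboundary W x"
    using clsY_zeroD[OF inv_cocycle_tr[OF W0(1,2)]] by metis
  define b where "b = pull_cochain W F b0"
  have b: "(W, b) \<in> cech_cocycles X" "B = cech_class X W b"
    using cocycle_pull[OF W0(2) good_cover[OF W(1)] W(2)] cech_class_pull[OF W0(2) good_cover[OF W(1)] W(2)] W0(3)
    by (simp_all add: b_def)
  note bb = cocycleD[OF b(1)]
  have tb: "tr W b = coboundary W x" using W(5) tr_pull[OF W(1) W0(1) W(2,3)] by (simp add: b_def)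
  obtain u where u: "section_of W u" using ex_section[OF W(1)] by blast
  have uc: "u \<in> cochains W" and Tu: "tr W u = unit_cochain W" using u by (simp_all add: section_of_def)
  have Tu': "Tc W u = (\<lambda>s. u s + unit_cochain W s)"
    by (simp add: fun_eq_iff tr_def flip: Tu)
  have xc: "x \<in> cochains W" "Tc W x = x" using W(4) by (simp_all add: inv_cochains_def)
  have ux: "cup W u x \<in> cochains W" using uc xc by auto
  have trux: "tr W (cup W u x) = x"
    unfolding tr_def using xc by (simp add: Tc_cup[OF W(1)] Tu' cup_add_left)
  define e where "e = (\<lambda>s. b s + coboundary W (cup W u x) s)"
  have ec: "e \<in> cochains W" unfolding e_def using bb ux by auto
  have "tr W e = (\<lambda>s. 0)"
    unfolding e_def by (simp add: tr_add tb tr_coboundary[OF W(1) ux] trux)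
  then have "e \<in> inv_cochains W" using ec by (intro tr_zeroD)
  moreover have de: "coboundary W e = (\<lambda>s. 0)" unfolding e_def using bb ux by (simp add: coboundary_add)
  ultimately have e: "inv_cocycle W e" using W(1) by (simp add: inv_cocycle_def)
  have "cech_class X W e = B"
    unfolding b(2) by (rule cech_class_eqI[OF inv_cocycle_cocycle_X[OF e] b(1) ux]) (simp add: e_def ac_simps)
  moreover have "cech_class X W (trunc (Suc i) e) = cech_class X W e"
    using clsX_component_trunc[OF inv_cocycle_cocycle_X[OF e]] B calculation by simp
  ultimately have "pi_star (clsY W (trunc (Suc i) e)) = B" using pi_star_clsY[OF inv_cocycle_trunc[OF e]] by simp
  moreover have "clsY W (trunc (Suc i) e) \<in> component (coho Y) i"
    using clsY_component[OF inv_cocycle_trunc[OF e], of i "Suc i"] by (simp add: trunc_trunc)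
  ultimately show "B \<in> pi_star ` component (coho Y) i" by blast
next
  assume "B \<in> pi_star ` component (coho Y) i"
  then obtain A where A: "A \<in> component (coho Y) i" "B = pi_star A" by blast
  obtain W a where W: "inv_cocycle W a" "A = clsY W a" using coho_Y_rep[OF coho_component_carrier[OF A(1)]] by metis
  then show "transfer B = \<zero>\<^bsub>coho Y\<^esub>"
    using A(2) by (simp add: pi_star_clsY transfer_class inv_cocycleD inv_cocycle_cocycle_X tr_inv clsY_zero)
qed

text \<open>On \<open>X\<close> the product \<open>(d u) a\<close> is the coboundary of
  \<open>u a\<close>. That primitive need not be invariant, so nothing follows on the orbit
  space.\<close>

lemma pi_star_y:
  assumes A: "A \<in> carrier (coho Y)"
  shows "pi_star (y_class \<otimes>\<^bsub>coho Y\<^esub> A) = \<zero>\<^bsub>coho X\<^esub>"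
proof -
  obtain W a where W: "inv_cocycle W a" "A = clsY W a" using coho_Y_rep[OF A] by metis
  note g = inv_cocycleD(1)[OF W(1)] and ac = inv_cochains_subset[OF inv_cocycleD(2)[OF W(1)]]
  obtain u where u: "section_of W u" using ex_section[OF g] by blast
  have uc: "u \<in> cochains W" using u by (simp add: section_of_def)
  note c = inv_cocycle_cup[OF inv_cocycle_section[OF u] W(1)]
  have "pi_star (y_class \<otimes>\<^bsub>coho Y\<^esub> A) = cech_class X W (cup W (coboundary W u) a)"
    using y_mult[OF u W(1)] W(2) pi_star_clsY[OF c] by simp
  also have "\<dots> = cech_class X W (\<lambda>s. 0)"
    by (rule cech_class_eqI[OF inv_cocycle_cocycle_X[OF c] cocycle_zero[OF good_cover[OF g]] cup_cochains[OF uc ac]])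
      (use uc ac inv_cocycleD(3)[OF W(1)] in \<open>simp add: coboundary_cup\<close>)
  finally show ?thesis by (simp add: coho_zero[OF good_cover[OF g]])
qed

text \<open>Let \<open>a = d E\<close>. Then \<open>x = tr E\<close> is an invariant cocycle because
  \<open>tr a = 0\<close>, and \<open>u x + E\<close> is invariant with coboundary
  \<open>(d u) x + a\<close>. So \<open>a\<close> represents \<open>y\<close> times the class of
  \<open>x\<close>.\<close>

lemma kernel_pi_star:
  assumes A: "A \<in> component (coho Y) i" and 0: "pi_star A = \<zero>\<^bsub>coho X\<^esub>"
  shows "A = \<zero>\<^bsub>coho Y\<^esub> \<or> (\<exists>j. i = Suc j \<and> A \<in> (\<lambda>B. y_class \<otimes>\<^bsub>coho Y\<^esub> B) ` component (coho Y) j)"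
proof -
  obtain W0 a0' where W0': "inv_cocycle W0 a0'" "A = clsY W0 a0'" using coho_Y_rep[OF coho_component_carrier[OF A]] by metis
  define a0 where "a0 = trunc (Suc i) a0'"
  have W0: "inv_cocycle W0 a0" "A = clsY W0 a0" "trunc (Suc i) a0 = a0"
    using inv_cocycle_trunc[OF W0'(1)] clsY_component_trunc[OF W0'(1), of i] A W0'(2)
    by (simp_all add: a0_def trunc_trunc)
  have "cech_class X W0 a0 = \<zero>\<^bsub>coho X\<^esub>" using 0 W0 pi_star_clsY by simp
  then obtain W F E' where W: "good W" "refinement_map W W0 F" "equivariant W F" "E' \<in> cochains W"
    "pull_cochain W F a0 = coboundary W E'"
    using clsX_zeroD[OF inv_cocycleD(1)[OF W0(1)] inv_cocycle_cocycle_X[OF W0(1)]] by metis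
  define a where "a = pull_cochain W F a0"
  \<comment> \<open>Lists of length \<open>i\<close> have degree \<open>i - 1\<close>, where a
    primitive of a cochain of degree \<open>i\<close> belongs.\<close>
  define E where "E = trunc i E'"
  have a: "inv_cocycle W a" "A = clsY W a"
    using inv_cocycle_pull[OF W0(1) W(1-3)] clsY_pull[OF W0(1) W(1-3)] W0(2) by (simp_all add: a_def)
  have E: "E \<in> cochains W" using W(4) by (auto simp: E_def)
  have "trunc (Suc i) a = a" using W0(3) pull_trunc[of W F "Suc i" a0] by (simp add: a_def)
  then have aE: "a = coboundary W E" using W(5) by (simp add: E_def coboundary_trunc a_def)
  show ?thesis
  proof (cases i)
    case 0
    \<comment> \<open>In degree zero the primitive is concentrated on the empty list, where cochains
      vanish.\<close>
    have "E = (\<lambda>s. 0)" unfolding E_def 0 using W(4) by (auto simp: trunc_def fun_eq_iff)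
    then have "a = (\<lambda>s. 0)" using aE by simp
    then show ?thesis using a(2) clsY_zero[OF W(1)] by simp
  next
    case (Suc j)
    define x where "x = tr W E"
    have xi: "x \<in> inv_cochains W" unfolding x_def using tr_inv_cochains[OF W(1) E] .
    note xc = inv_cochains_subset[OF xi]
    have "coboundary W x = (\<lambda>s. 0)"
      unfolding x_def using tr_coboundary[OF W(1) E] aE tr_inv[OF inv_cocycleD(2)[OF a(1)]] by simp
    then have x: "inv_cocycle W x" using W(1) xi by (simp add: inv_cocycle_def)
    have "trunc (Suc j) x = x" unfolding x_def E_def Suc by (simp add: trunc_trunc flip: tr_trunc)
    then have xcomp: "clsY W x \<in> component (coho Y) j" using clsY_component[OF x] by simp
    obtain u where u: "section_of W u" using ex_section[OF W(1)] by blast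
    have uc: "u \<in> cochains W" using u by (simp add: section_of_def)
    let ?z = "\<lambda>s. cup W u x s + E s"
    have "?z \<in> inv_cochains W" using inv_section_cup[OF u E _ xc] by (simp add: x_def)
    moreover have "cup W (coboundary W u) x s + a s = coboundary W ?z s" for s
      using uc xc inv_cocycleD(3)[OF x] by (simp add: coboundary_add coboundary_cup aE)
    ultimately have "clsY W (cup W (coboundary W u) x) = clsY W a"
      using clsY_eqI[OF inv_cocycle_cup[OF inv_cocycle_section[OF u] x] a(1)] by blast
    then have "A = y_class \<otimes>\<^bsub>coho Y\<^esub> clsY W x" using y_mult[OF u x] a(2) by simp
    then show ?thesis using xcomp Suc by blast
  qed
qed

section \<open>Nilpotence of the characteristic class\<close>

fun cup_list :: "'a set set \<Rightarrow> 'a set list \<Rightarrow> 'a set list \<Rightarrow> bit" where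
  "cup_list W [] = unit_cochain W"
| "cup_list W (c # cs) = cup W (coboundary W (usec W c)) (cup_list W cs)"

text \<open>A single factor that vanishes on all lists with vertices in \<open>S\<close> suffices:
  every front or back face of such a list again has its vertices in \<open>S\<close>.\<close>

lemma cup_list_vanish:
  assumes c: "c \<in> set cs" and v: "\<And>t. set t \<subseteq> S \<Longrightarrow> coboundary W (usec W c) t = 0" and t: "set t \<subseteq> S"
  shows "cup_list W cs t = 0"
  using c t
proof (induction cs arbitrary: t)
  case (Cons d cs)
  show ?case
  proof (cases "c = d")
    case True
    have "coboundary W (usec W d) (take (Suc i) t) = 0" for i
      using True v Cons.prems(2) set_take_subset[of "Suc i" t] by (meson subset_trans)
    then show ?thesis by (simp add: cup_def)
  next
    case False
    have "cup_list W cs (drop i t) = 0" for i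
      using False Cons set_drop_subset[of i t] by auto
    then show ?thesis by (simp add: cup_def)
  qed
qed simp

text \<open>The orbit space is covered by finitely many sets over which the double cover is trivial.
  For each of them the characteristic class has a representative that vanishes there, and the
  product of all these representatives is zero.\<close>

lemma y_nilpotent: "\<exists>N. y_class [^]\<^bsub>coho Y\<^esub> (N::nat) = \<zero>\<^bsub>coho Y\<^esub>"
proof -
  interpret ring "coho Y" by (rule ring_coho)
  obtain W0 where W0: "good W0" using ex_good by blast
  have "(\<forall>U \<in> W0. openin X U) \<and> topspace X \<subseteq> \<Union>W0" using good_cover[OF W0] unfolding open_cover_def by simp
  then obtain C where C: "finite C" "C \<subseteq> W0" "topspace X \<subseteq> \<Union>C"
    using compact unfolding compact_space_alt by meson
  have cov: "open_cover X C"
    using C good_cover[OF W0] unfolding open_cover_def by blast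
  have cc: "c \<subseteq> topspace X" "c \<inter> T ` c = {}" if "c \<in> C" for c
  proof -
    have c: "c \<in> W0" using that C by blast
    then obtain x where "x \<in> c" using good_nonempty[OF W0 c] by blast
    then show "c \<inter> T ` c = {}" using good_disjoint[OF W0 c c] by simp
    show "c \<subseteq> topspace X" using good_subset[OF W0 c] .
  qed
  obtain W where W: "good W" and star: "\<And>p. p \<in> topspace X \<Longrightarrow> \<exists>c \<in> C. \<forall>w \<in> W. p \<in> w \<longrightarrow> w \<subseteq> c"
    using ex_good_star_refinement[OF cov] by blast
  obtain cs where cs: "set cs = C" using finite_list[OF C(1)] by blast
  have "inv_cocycle W (cup_list W ds) \<and> clsY W (cup_list W ds) = y_class [^]\<^bsub>coho Y\<^esub> length ds" if "set ds \<subseteq> C" for ds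
    using that
  proof (induction ds)
    case Nil
    then show ?case by (simp add: inv_cocycle_unit[OF W] clsY_one[OF W])
  next
    case (Cons d ds)
    have d: "section_of W (usec W d)" using cc Cons.prems by (intro section_usec[OF W]) auto
    have "y_class \<in> carrier (coho Y)" using y_component coho_component_carrier by blast
    then show ?case
      using Cons inv_cocycle_cup[OF inv_cocycle_section[OF d]] y_mult[OF d, of "cup_list W ds"] nat_pow_Suc2 by auto
  qed
  then have *: "clsY W (cup_list W cs) = y_class [^]\<^bsub>coho Y\<^esub> length cs" using cs by blast
  have "cup_list W cs s = 0" for s
  proof (cases "s \<in> nerve W")
    case True
    then obtain p where p: "s \<noteq> []" "set s \<subseteq> W" "\<forall>w \<in> set s. p \<in> w" by (rule nerveE)
    then have "p \<in> topspace X" using good_subset[OF W] by (metis list.set_sel(1) subsetD)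
    then obtain c where c: "c \<in> C" "\<forall>w \<in> W. p \<in> w \<longrightarrow> w \<subseteq> c" using star by blast
    \<comment> \<open>All vertices of \<open>t\<close> contain \<open>p\<close> and so lie inside
      \<open>c\<close>, where the adapted section is constantly 1; on an edge its coboundary is
      \<open>1 + 1\<close>.\<close>
    have "coboundary W (usec W c) t = 0" if t: "set t \<subseteq> set s" for t
    proof (cases "t \<in> nerve W \<and> length t = 2")
      case True
      then obtain v w where vw: "t = [v, w]" by (auto simp: length_Suc_conv numeral_2_eq_2)
      then have "[v] \<in> nerve W" "[w] \<in> nerve W" using True nerve_subset[of t W] by auto
      moreover have "v \<subseteq> c" "w \<subseteq> c" using vw t p c by auto
      ultimately show ?thesis using True vw by (simp add: coboundary_bd usec_def)
    next
      case False
      have "bd (usec W c) t = bd (\<lambda>t. 0) t" if "length t \<noteq> 2"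
        using that by (intro bd_cong) (auto simp: usec_def)
      then show ?thesis using False by (auto simp: coboundary_bd)
    qed
    then show ?thesis using cup_list_vanish[of c cs "set s" W s] c(1) cs by blast
  next
    case False
    then show ?thesis by (cases cs) (simp_all add: unit_cochain_def cup_def)
  qed
  then have "cup_list W cs = (\<lambda>s. 0)" by auto
  then show ?thesis using * clsY_zero[OF W] by metis
qed

end

section \<open>Graded rings of characteristic two\<close>

text \<open>A graded algebra over \<open>bit\<close> whose multiplication may fail to commute. The
  projections \<open>pr\<close> express that the components form a direct sum.\<close>

locale f2_graded = ring R for R :: "(bit, 'a) graded_algebra" (structure) +
  fixes pr :: "nat \<Rightarrow> 'a \<Rightarrow> 'a"
  assumes double: "a \<in> carrier R \<Longrightarrow> a \<oplus> a = \<zero>"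
    and smult_cases: "a \<in> carrier R \<Longrightarrow> k \<odot> a = (if k = 0 then \<zero> else a)"
    and comp_carrier: "a \<in> component R i \<Longrightarrow> a \<in> carrier R"
    and comp_zero: "\<zero> \<in> component R i"
    and comp_add: "a \<in> component R i \<Longrightarrow> b \<in> component R i \<Longrightarrow> a \<oplus> b \<in> component R i"
    and one_comp: "\<one> \<in> component R 0"
    and mult_comp: "a \<in> component R i \<Longrightarrow> b \<in> component R j \<Longrightarrow> a \<otimes> b \<in> component R (i + j)"
    and pr_add: "a \<in> carrier R \<Longrightarrow> b \<in> carrier R \<Longrightarrow> pr i (a \<oplus> b) = pr i a \<oplus> pr i b"
    and pr_comp: "a \<in> carrier R \<Longrightarrow> pr i a \<in> component R i"
    and pr_on_comp: "a \<in> component R i \<Longrightarrow> pr j a = (if i = j then a else \<zero>)"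
    and pr_finsum: "a \<in> carrier R \<Longrightarrow> \<exists>N. a = finsum R (\<lambda>i. pr i a) {..<N}"
begin

lemma add_cancel_double: "a \<in> carrier R \<Longrightarrow> b \<in> carrier R \<Longrightarrow> a \<oplus> (a \<oplus> b) = b"
  by (simp add: double flip: a_assoc)

lemma add_eq_zero: "a \<in> carrier R \<Longrightarrow> b \<in> carrier R \<Longrightarrow> a \<oplus> b = \<zero> \<longleftrightarrow> a = b"
  by (metis add_cancel_double double r_zero)

definition sc :: "bit \<Rightarrow> 'a \<Rightarrow> 'a" where "sc b a = (if b = 0 then \<zero> else a)"

lemma sc_simps [simp]: "sc 0 a = \<zero>" "sc 1 a = a" by (simp_all add: sc_def)

lemma sc_closed [simp]: "a \<in> carrier R \<Longrightarrow> sc b a \<in> carrier R" by (simp add: sc_def)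

lemma sc_comp [simp]: "a \<in> component R i \<Longrightarrow> sc b a \<in> component R i" by (simp add: sc_def comp_zero)

lemma sc_zero [simp]: "sc b \<zero> = \<zero>" by (simp add: sc_def)

lemma sc_mult: "a \<in> carrier R \<Longrightarrow> x \<in> carrier R \<Longrightarrow> x \<otimes> sc b a = sc b (x \<otimes> a)"
  by (simp add: sc_def)

lemma sc_add: "a \<in> carrier R \<Longrightarrow> sc (b + b') a = sc b a \<oplus> sc b' a"
  by (cases b; cases b') (simp_all add: double)

end

lemma f2_graded_coho: "f2_graded (coho X) (coho_proj X)"
proof -
  interpret ring "coho X" by (rule ring_coho)
  show ?thesis
    by unfold_locales
      (simp_all add: coho_double coho_smult_cases coho_component_carrier coho_zero_component
        coho_component_add coho_one_component coho_mult_component coho_proj_add coho_proj_component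
        coho_proj_on_component coho_proj_finsum)
qed

text \<open>Image times kernel for a set closed under addition. In characteristic two
  \<open>a + s (f a)\<close> is the difference between \<open>a\<close> and the chosen preimage of
  its value, so it lies in the kernel.\<close>

lemma additive_card:
  fixes R :: "(bit, 'a) graded_algebra" and S :: "(bit, 'c) graded_algebra"
  assumes R: "f2_graded R pr" and S: "f2_graded S pr'"
    and G: "G \<subseteq> carrier R" "\<And>a b. a \<in> G \<Longrightarrow> b \<in> G \<Longrightarrow> a \<oplus>\<^bsub>R\<^esub> b \<in> G"
    and f: "\<And>a. a \<in> G \<Longrightarrow> f a \<in> carrier S" "\<And>a b. a \<in> G \<Longrightarrow> b \<in> G \<Longrightarrow> f (a \<oplus>\<^bsub>R\<^esub> b) = f a \<oplus>\<^bsub>S\<^esub> f b"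
    and fin: "finite {a \<in> G. f a = \<zero>\<^bsub>S\<^esub>}" "finite (f ` G)"
  shows "finite G" "card G = card (f ` G) * card {a \<in> G. f a = \<zero>\<^bsub>S\<^esub>}"
proof -
  interpret R: f2_graded R pr by (rule R)
  interpret S: f2_graded S pr' by (rule S)
  define K where "K = {a \<in> G. f a = \<zero>\<^bsub>S\<^esub>}"
  define s where "s b = (SOME a. a \<in> G \<and> f a = b)" for b
  have s: "s b \<in> G" "f (s b) = b" if "b \<in> f ` G" for b
    using someI_ex[of "\<lambda>a. a \<in> G \<and> f a = b"] that unfolding s_def by blast+
  have fk: "f (k \<oplus>\<^bsub>R\<^esub> s b) = b" if "b \<in> f ` G" "k \<in> K" for b k
    using that f s[OF that(1)] by (auto simp: K_def)
  have bij: "bij_betw (\<lambda>(b, k). k \<oplus>\<^bsub>R\<^esub> s b) (f ` G \<times> K) G"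
  proof (rule bij_betwI')
    fix x y assume x: "x \<in> f ` G \<times> K" and y: "y \<in> f ` G \<times> K"
    obtain b k where bk: "x = (b, k)" by fastforce
    obtain b' k' where bk': "y = (b', k')" by fastforce
    have c: "k \<in> carrier R" "k' \<in> carrier R" "s b \<in> carrier R"
      using x y bk bk' G(1) s(1)[of b] by (auto simp: K_def)
    show "(case x of (b, k) \<Rightarrow> k \<oplus>\<^bsub>R\<^esub> s b) = (case y of (b, k) \<Rightarrow> k \<oplus>\<^bsub>R\<^esub> s b) \<longleftrightarrow> x = y"
    proof
      assume "(case x of (b, k) \<Rightarrow> k \<oplus>\<^bsub>R\<^esub> s b) = (case y of (b, k) \<Rightarrow> k \<oplus>\<^bsub>R\<^esub> s b)"
      then have e: "k \<oplus>\<^bsub>R\<^esub> s b = k' \<oplus>\<^bsub>R\<^esub> s b'" by (simp add: bk bk')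
      have "b = b'" using fk[of b k] fk[of b' k'] x y bk bk' e by auto
      then show "x = y" using e c R.add.right_cancel by (auto simp: bk bk')
    qed simp
  next
    fix x assume "x \<in> f ` G \<times> K"
    then show "(case x of (b, k) \<Rightarrow> k \<oplus>\<^bsub>R\<^esub> s b) \<in> G" using s(1) G(2) by (auto simp: K_def)
  next
    fix a assume a: "a \<in> G"
    then have b: "f a \<in> f ` G" by simp
    note sb = s[OF b]
    have c: "a \<in> carrier R" "s (f a) \<in> carrier R" using a sb G(1) by auto
    have "a \<oplus>\<^bsub>R\<^esub> s (f a) \<in> K" using a sb f G(2) S.double by (simp add: K_def)
    moreover have "a = (a \<oplus>\<^bsub>R\<^esub> s (f a)) \<oplus>\<^bsub>R\<^esub> s (f a)" using c by (simp add: R.a_assoc R.double)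
    ultimately show "\<exists>x \<in> f ` G \<times> K. a = (case x of (b, k) \<Rightarrow> k \<oplus>\<^bsub>R\<^esub> s b)"
      using b by (intro bexI[of _ "(f a, a \<oplus>\<^bsub>R\<^esub> s (f a))"]) auto
  qed
  have fK: "finite K" using fin(1) by (simp add: K_def)
  then show "finite G" using bij_betw_finite[OF bij] fin(2) by blast
  show "card G = card (f ` G) * card {a \<in> G. f a = \<zero>\<^bsub>S\<^esub>}"
    using bij_betw_same_card[OF bij] by (simp add: card_cartesian_product K_def)
qed

text \<open>The numerical content of the Gysin sequence of a double cover whose total space has
  cohomology of order \<open>2 ^ \<alpha> i\<close> in degree \<open>i\<close>.\<close>

locale gysin_ring = f2_graded R pr for R :: "(bit, 'a) graded_algebra" (structure) and pr +
  fixes y :: 'a and \<alpha> :: "nat \<Rightarrow> nat"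
  assumes y_comp: "y \<in> component R 1"
    and y_central: "a \<in> carrier R \<Longrightarrow> y \<otimes> a = a \<otimes> y"
    and y_nil: "\<exists>N::nat. y [^] N = \<zero>"
    and finite_ker: "finite {a \<in> component R i. y \<otimes> a = \<zero>}"
    and exact0: "\<exists>\<kappa>. \<kappa> * card {a \<in> component R 0. y \<otimes> a = \<zero>} = 2 ^ \<alpha> 0 \<and>
        finite (component R 0) \<and> card (component R 0) = \<kappa>"
    and exact: "finite (component R i) \<Longrightarrow>
        \<exists>\<kappa>. \<kappa> * card {a \<in> component R (Suc i). y \<otimes> a = \<zero>} = 2 ^ \<alpha> (Suc i) \<and>
        finite (component R (Suc i)) \<and>
        card (component R (Suc i)) = \<kappa> * card ((\<lambda>a. y \<otimes> a) ` component R i)"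

context free_involution
begin

text \<open>The number \<open>\<kappa>\<close> of \<open>gysin_ring\<close> is the order of the
  image of \<open>pi_star\<close>. Image times kernel, for the transfer, is the order of a component
  of H(X), and for \<open>pi_star\<close> that of a component of H(Y); exactness identifies both
  kernels and the image of the transfer.\<close>

lemma gysin_ring_orbit:
  assumes \<alpha>: "\<And>i. card (component (coho X) i) = 2 ^ \<alpha> i"
  shows "gysin_ring (coho Y) (coho_proj Y) y_class \<alpha>"
proof -
  interpret X: f2_graded "coho X" "coho_proj X" by (rule f2_graded_coho)
  interpret Y: f2_graded "coho Y" "coho_proj Y" by (rule f2_graded_coho)
  note fX = f2_graded_coho[of X] and fY = f2_graded_coho[of Y]
  have finX: "finite (component (coho X) i)" for i
    using \<alpha>[of i] by (intro card_ge_0_finite) simp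
  have yc: "y_class \<in> carrier (coho Y)" using y_component coho_component_carrier by blast
  have K: "{a \<in> component (coho Y) i. y_class \<otimes>\<^bsub>coho Y\<^esub> a = \<zero>\<^bsub>coho Y\<^esub>} = transfer ` component (coho X) i" for i
    using kernel_y[of _ i] transfer_component[of _ i] by blast
  have I: "{a \<in> component (coho X) i. transfer a = \<zero>\<^bsub>coho Y\<^esub>} = pi_star ` component (coho Y) i" for i
    using kernel_transfer[of _ i] pi_star_component[of _ i] by blast
  have finI: "finite (pi_star ` component (coho Y) i)" for i
    using finX[of i] I[of i] by (metis (no_types, lifting) finite_subset mem_Collect_eq subsetI)
  have cardX: "card (pi_star ` component (coho Y) i) * card (transfer ` component (coho X) i) = 2 ^ \<alpha> i" for i
    using additive_card(2)[OF fX fY, of "component (coho X) i" transfer] finX[of i] finI[of i] \<alpha>[of i]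
    by (simp add: I coho_component_carrier subsetI coho_component_add transfer_add transfer_component[THEN coho_component_carrier] mult.commute)
  have cardY: "finite (component (coho Y) i) \<and> card (component (coho Y) i) =
      card (pi_star ` component (coho Y) i) * card {a \<in> component (coho Y) i. pi_star a = \<zero>\<^bsub>coho X\<^esub>}"
    if "finite {a \<in> component (coho Y) i. pi_star a = \<zero>\<^bsub>coho X\<^esub>}" for i
    using additive_card[OF fY fX, of "component (coho Y) i" pi_star] finI[of i] that
    by (simp add: coho_component_carrier subsetI coho_component_add pi_star_add pi_star_component[THEN coho_component_carrier])
  have pi_star_0: "pi_star \<zero>\<^bsub>coho Y\<^esub> = \<zero>\<^bsub>coho X\<^esub>"
    using pi_star_y[OF Y.zero_closed] yc by simp
  have ker0: "{a \<in> component (coho Y) 0. pi_star a = \<zero>\<^bsub>coho X\<^esub>} = {\<zero>\<^bsub>coho Y\<^esub>}"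
    using kernel_pi_star[of _ 0] pi_star_0 coho_zero_component by blast
  have kerS: "{a \<in> component (coho Y) (Suc i). pi_star a = \<zero>\<^bsub>coho X\<^esub>} = (\<lambda>a. y_class \<otimes>\<^bsub>coho Y\<^esub> a) ` component (coho Y) i" for i
  proof (intro subset_antisym subsetI)
    fix a assume "a \<in> {a \<in> component (coho Y) (Suc i). pi_star a = \<zero>\<^bsub>coho X\<^esub>}"
    then have "a = \<zero>\<^bsub>coho Y\<^esub> \<or> a \<in> (\<lambda>a. y_class \<otimes>\<^bsub>coho Y\<^esub> a) ` component (coho Y) i"
      using kernel_pi_star[of a "Suc i"] by auto
    moreover have "\<zero>\<^bsub>coho Y\<^esub> = y_class \<otimes>\<^bsub>coho Y\<^esub> \<zero>\<^bsub>coho Y\<^esub>" using yc by simp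
    ultimately show "a \<in> (\<lambda>a. y_class \<otimes>\<^bsub>coho Y\<^esub> a) ` component (coho Y) i"
      using coho_zero_component by blast
  next
    fix a assume "a \<in> (\<lambda>a. y_class \<otimes>\<^bsub>coho Y\<^esub> a) ` component (coho Y) i"
    then obtain b where b: "b \<in> component (coho Y) i" "a = y_class \<otimes>\<^bsub>coho Y\<^esub> b" by blast
    have "a \<in> component (coho Y) (1 + i)" unfolding b(2) by (rule coho_mult_component[OF y_component b(1)])
    then show "a \<in> {a \<in> component (coho Y) (Suc i). pi_star a = \<zero>\<^bsub>coho X\<^esub>}"
      using b pi_star_y[OF coho_component_carrier[OF b(1)]] by simp
  qed
  show ?thesis
  proof unfold_locales
    show "y_class \<in> component (coho Y) 1" by (rule y_component)
    show "y_class \<otimes>\<^bsub>coho Y\<^esub> a = a \<otimes>\<^bsub>coho Y\<^esub> y_class" if "a \<in> carrier (coho Y)" for a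
      using y_central[OF that] .
    show "\<exists>N::nat. y_class [^]\<^bsub>coho Y\<^esub> N = \<zero>\<^bsub>coho Y\<^esub>" by (rule y_nilpotent)
    show "finite {a \<in> component (coho Y) i. y_class \<otimes>\<^bsub>coho Y\<^esub> a = \<zero>\<^bsub>coho Y\<^esub>}" for i
      unfolding K using finX by simp
    show "\<exists>\<kappa>. \<kappa> * card {a \<in> component (coho Y) 0. y_class \<otimes>\<^bsub>coho Y\<^esub> a = \<zero>\<^bsub>coho Y\<^esub>} = 2 ^ \<alpha> 0 \<and>
        finite (component (coho Y) 0) \<and> card (component (coho Y) 0) = \<kappa>"
      unfolding K using cardX[of 0] cardY[of 0] by (simp add: ker0)
    show "\<exists>\<kappa>. \<kappa> * card {a \<in> component (coho Y) (Suc i). y_class \<otimes>\<^bsub>coho Y\<^esub> a = \<zero>\<^bsub>coho Y\<^esub>} = 2 ^ \<alpha> (Suc i) \<and>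
        finite (component (coho Y) (Suc i)) \<and>
        card (component (coho Y) (Suc i)) = \<kappa> * card ((\<lambda>a. y_class \<otimes>\<^bsub>coho Y\<^esub> a) ` component (coho Y) i)"
      if "finite (component (coho Y) i)" for i
      unfolding K using cardX[of "Suc i"] cardY[of "Suc i"] that
      by (intro exI[of _ "card (pi_star ` component (coho Y) (Suc i))"]) (simp add: kerS)
  qed
qed

end

section \<open>The structure of the cohomology of the orbit space\<close>

lemma dvd_two_power: "(d::nat) dvd 2 ^ n \<Longrightarrow> \<exists>i\<le>n. d = 2 ^ i"
  using divides_primepow_nat[of 2 d n] two_is_prime_nat by blast

lemma two_power_cancel: "(a::nat) * 2 ^ k = 2 ^ n \<Longrightarrow> k \<le> n \<Longrightarrow> a = 2 ^ (n - k)"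
  by (metis le_add_diff_inverse2 mult_cancel_right power_add power_not_zero zero_neq_numeral)

context gysin_ring
begin

abbreviation Hc :: "nat \<Rightarrow> 'a set" where "Hc \<equiv> component R"
definition Ker :: "nat \<Rightarrow> 'a set" where "Ker i = {a \<in> Hc i. y \<otimes> a = \<zero>}"

lemma y_carrier [simp]: "y \<in> carrier R" using y_comp comp_carrier by blast

lemma pow_comp: "y [^] (i::nat) \<in> Hc i"
proof (induction i)
  case (Suc i)
  then show ?case using mult_comp[OF Suc y_comp] by simp
qed (simp add: one_comp)

lemma y_mult_pow: "a \<in> carrier R \<Longrightarrow> y \<otimes> (y [^] (i::nat) \<otimes> a) = y [^] Suc i \<otimes> a"
  using nat_pow_Suc2[OF y_carrier, of i] by (simp add: m_assoc)

lemma finite_Hc: "finite (Hc i)"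
proof (induction i)
  case 0
  then show ?case using exact0 by blast
next
  case (Suc i)
  then show ?case using exact[OF Suc] by blast
qed

lemma card_Hc_split: "card (Hc i) = card ((\<lambda>a. y \<otimes> a) ` Hc i) * card (Ker i)"
  unfolding Ker_def
  using finite_Hc comp_carrier comp_add finite_ker
  by (intro additive_card(2)[OF f2_graded_axioms f2_graded_axioms])
    (auto simp: r_distr)

text \<open>Dimensions are exponents of orders, which replaces linear algebra by counting. The order
  is a power of two because by exactness it divides \<open>2 ^ \<alpha> i\<close>.\<close>

definition kdim :: "nat \<Rightarrow> nat" where "kdim i = (SOME k. card (Ker i) = 2 ^ k)"

text \<open>By exactness this is the dimension of the cokernel of multiplication by \<open>y\<close> into degree \<open>i\<close>.\<close>

definition cdim :: "nat \<Rightarrow> nat" where "cdim i = \<alpha> i - kdim i"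

lemma card_Ker: "card (Ker i) = 2 ^ kdim i" "kdim i \<le> \<alpha> i"
proof -
  have "card (Ker i) dvd 2 ^ \<alpha> i"
    unfolding Ker_def
    using exact0 exact[OF finite_Hc, of "i - 1"] by (cases i) (metis dvd_triv_right, metis diff_Suc_1 dvd_triv_right)
  then obtain j where j: "j \<le> \<alpha> i" "card (Ker i) = 2 ^ j" using dvd_two_power by blast
  then have "card (Ker i) = 2 ^ kdim i" unfolding kdim_def by (intro someI[of "\<lambda>k. card (Ker i) = 2 ^ k" j])
  with j show "card (Ker i) = 2 ^ kdim i" "kdim i \<le> \<alpha> i" by simp_all
qed

lemma kc: "kdim i + cdim i = \<alpha> i" using card_Ker(2)[of i] by (simp add: cdim_def)

lemma card_Hc_0: "card (Hc 0) = 2 ^ cdim 0"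
proof -
  obtain \<kappa> where "\<kappa> * 2 ^ kdim 0 = 2 ^ \<alpha> 0" "card (Hc 0) = \<kappa>"
    using exact0 card_Ker(1)[of 0] unfolding Ker_def by metis
  then show ?thesis using two_power_cancel card_Ker(2) by (simp add: cdim_def)
qed

lemma card_Hc_Suc: "card (Hc (Suc i)) = 2 ^ cdim (Suc i) * card ((\<lambda>a. y \<otimes> a) ` Hc i)"
proof -
  obtain \<kappa> where "\<kappa> * 2 ^ kdim (Suc i) = 2 ^ \<alpha> (Suc i)" "card (Hc (Suc i)) = \<kappa> * card ((\<lambda>a. y \<otimes> a) ` Hc i)"
    using exact[OF finite_Hc, of i] card_Ker(1)[of "Suc i"] unfolding Ker_def by metis
  then show ?thesis using two_power_cancel card_Ker(2) by (simp add: cdim_def)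
qed

text \<open>With \<open>h\<close> the dimension in degree \<open>i\<close>, multiplication by
  \<open>y\<close> has an image of dimension \<open>h - kdim i\<close>, to which
  \<open>cdim (Suc i)\<close> is added in the next degree; the recursion telescopes.\<close>

lemma card_sum: "\<exists>h. card (Hc i) = 2 ^ h \<and> (\<Sum>j\<le>i. cdim j) = (\<Sum>j<i. kdim j) + h"
proof (induction i)
  case 0
  then show ?case using card_Hc_0 by simp
next
  case (Suc i)
  then obtain h where h: "card (Hc i) = 2 ^ h" "(\<Sum>j\<le>i. cdim j) = (\<Sum>j<i. kdim j) + h" by blast
  have e: "card ((\<lambda>a. y \<otimes> a) ` Hc i) * 2 ^ kdim i = 2 ^ h" using card_Hc_split[of i] h(1) card_Ker(1)[of i] by simp
  then have "2 ^ kdim i dvd (2::nat) ^ h" by (metis dvd_triv_right)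
  then have le: "kdim i \<le> h" by (simp add: dvd_power_iff_le)
  have "card (Hc (Suc i)) = 2 ^ (cdim (Suc i) + (h - kdim i))"
    using card_Hc_Suc[of i] two_power_cancel[OF e le] by (simp add: power_add)
  then show ?case using h(2) le by (intro exI[of _ "cdim (Suc i) + (h - kdim i)"]) simp
qed

lemma Ker_zero: "\<zero> \<in> Ker i" by (simp add: Ker_def comp_zero)

text \<open>From degree \<open>i\<close> on multiplication by \<open>y\<close> has no kernel, so a
  nonzero element would have nonzero products with all powers of \<open>y\<close>, against
  nilpotence.\<close>

lemma Hc_zero:
  assumes "\<And>j. i \<le> j \<Longrightarrow> \<alpha> j = 0" shows "Hc i = {\<zero>}"
proof -
  have K: "Ker j = {\<zero>}" if "i \<le> j" for j
  proof -
    have "card (Ker j) = 1" using card_Ker[of j] assms[OF that] by simp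
    then show ?thesis using Ker_zero[of j] by (metis card_1_singletonE singletonD)
  qed
  obtain N :: nat where N: "y [^] N = \<zero>" using y_nil by blast
  have "a = \<zero>" if a: "a \<in> Hc i" for a
  proof -
    have ac: "a \<in> carrier R" using a comp_carrier by blast
    have *: "y [^] n \<otimes> a = \<zero> \<Longrightarrow> a = \<zero>" for n :: nat
    proof (induction n)
      case (Suc n)
      have "y [^] n \<otimes> a \<in> Ker (n + i)"
        unfolding Ker_def using mult_comp[OF pow_comp a, of n] Suc.prems y_mult_pow[OF ac, of n] by simp
      then show ?case using K[of "n + i"] Suc.IH by auto
    qed (use ac in simp)
    show ?thesis using *[of N] N ac by simp
  qed
  then show ?thesis using comp_zero by blast
qed

lemma Hc_eq_image: "cdim (Suc i) = 0 \<Longrightarrow> Hc (Suc i) = (\<lambda>a. y \<otimes> a) ` Hc i"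
proof -
  assume "cdim (Suc i) = 0"
  then have "card ((\<lambda>a. y \<otimes> a) ` Hc i) = card (Hc (Suc i))" using card_Hc_Suc[of i] by simp
  moreover have "(\<lambda>a. y \<otimes> a) ` Hc i \<subseteq> Hc (Suc i)" using mult_comp[OF y_comp, of _ i] by auto
  ultimately show ?thesis using card_subset_eq[OF finite_Hc] by metis
qed

end

text \<open>The conclusion of the analysis: as a module over the subring generated by \<open>y\<close>, the ring is
  the sum of two cyclic modules, one generated by \<open>1\<close> with top degree \<open>p\<close>, and one generated by
  an element \<open>z\<close> of degree \<open>q\<close> with top degree \<open>r\<close>.\<close>

locale two_block = f2_graded R pr for R :: "(bit, 'a) graded_algebra" (structure) and pr +
  fixes y z and p q r :: nat and a0 a1 :: bit
  assumes y1: "y \<in> component R 1" and zq: "z \<in> component R q"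
    and y_central: "a \<in> carrier R \<Longrightarrow> y \<otimes> a = a \<otimes> y"
    and qr: "q \<le> r"
    and y_top: "y [^] (p + 1) = \<zero>" and z_top: "y [^] (r - q + 1) \<otimes> z = \<zero>"
    and z_square: "z \<otimes> z = sc a0 (y [^] (2 * q)) \<oplus> sc a1 (y [^] q \<otimes> z)"
    and y_indep: "i \<le> p \<Longrightarrow> y [^] i \<noteq> \<zero>"
    and z_indep: "q \<le> i \<Longrightarrow> i \<le> r \<Longrightarrow> y [^] (i - q) \<otimes> z \<noteq> \<zero>"
    and yz_indep: "q \<le> i \<Longrightarrow> i \<le> r \<Longrightarrow> i \<le> p \<Longrightarrow> y [^] i \<noteq> y [^] (i - q) \<otimes> z"
    and span: "a \<in> component R i \<Longrightarrow> \<exists>b b'. a = sc b (y [^] i) \<oplus> (if i < q then \<zero> else sc b' (y [^] (i - q) \<otimes> z))"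


section \<open>Matching the degrees \<open>p\<close>, \<open>q\<close>, \<open>r\<close> with
  \<open>n\<close>, \<open>m\<close>, \<open>l\<close>\<close>

lemma of_bool_pair:
  fixes q r m l :: nat
  assumes "\<And>i. of_bool (i = r) + of_bool (i = q) = (of_bool (i = m) + of_bool (i = l) :: nat)"
    and "m \<le> l" "q \<le> r"
  shows "q = m \<and> r = l"
proof -
  have "m = r \<or> m = q" using assms(1)[of m] by (cases "m = r"; cases "m = q") simp_all
  moreover have "l = r \<or> l = q" using assms(1)[of l] by (cases "l = r"; cases "l = q") simp_all
  moreover have "r = m \<or> r = l" using assms(1)[of r] by (cases "r = m"; cases "r = l") simp_all
  moreover have "q = m \<or> q = l" using assms(1)[of q] by (cases "q = m"; cases "q = l") simp_all
  ultimately show ?thesis using assms(2,3) by linarith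
qed

text \<open>Sums of indicator functions stand for multisets. Of the six matchings of the two
  triples, \<open>q \<le> r\<close> leaves three, which become the three cases of the
  theorem.\<close>

lemma of_bool_triple:
  fixes p q r n m l :: nat
  assumes tri: "\<And>i. of_bool (i = p) + of_bool (i = r) + of_bool (i = q) = (of_bool (i = n) + of_bool (i = m) + of_bool (i = l) :: nat)"
    and le: "n \<le> m" "m \<le> l" "q \<le> r"
  shows "(p = l \<and> q = n \<and> r = m) \<or> (p = n \<and> q = m \<and> r = l) \<or> (p = m \<and> q = n \<and> r = l)"
proof -
  have "p = n \<or> p = m \<or> p = l" using tri[of p] by (cases "p = n"; cases "p = m"; cases "p = l") simp_all
  then consider "p = n" | "p = m" | "p = l" by blast
  then show ?thesis
  proof cases
    case 1
    have "of_bool (i = r) + of_bool (i = q) = (of_bool (i = m) + of_bool (i = l) :: nat)" for i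
      using tri[of i] unfolding 1 by linarith
    then show ?thesis using of_bool_pair[of r q m l] le 1 by blast
  next
    case 2
    have "of_bool (i = r) + of_bool (i = q) = (of_bool (i = n) + of_bool (i = l) :: nat)" for i
      using tri[of i] unfolding 2 by linarith
    then show ?thesis using of_bool_pair[of r q n l] le 2 by simp
  next
    case 3
    have "of_bool (i = r) + of_bool (i = q) = (of_bool (i = n) + of_bool (i = m) :: nat)" for i
      using tri[of i] unfolding 3 by linarith
    then show ?thesis using of_bool_pair[of r q n m] le 3 by simp
  qed
qed

context gysin_ring
begin

text \<open>At first the second generator may be any element \<open>z0\<close> of degree
  \<open>q\<close> outside the multiples of \<open>y\<close>. It is then adjusted so that the second
  kernel class \<open>u\<close> becomes its last nonzero multiple. The conditions on
  \<open>a0\<close> and \<open>a1\<close> come from setting the coefficient of a vanishing monomial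
  to zero.\<close>

lemma ex_two_block:
  assumes nml: "1 \<le> n" "n \<le> m" "m \<le> l"
    and \<alpha>: "\<And>i. \<alpha> i = of_bool (i = 0) + of_bool (i = n) + of_bool (i = m) + of_bool (i = l)"
  obtains z p q r a0 a1 where "two_block R pr y z p q r a0 a1"
    "(p = l \<and> q = n \<and> r = m) \<or> (p = n \<and> q = m \<and> r = l) \<or> (p = m \<and> q = n \<and> r = l)"
    "p < 2 * q \<Longrightarrow> a0 = 0" "r < 2 * q \<Longrightarrow> a1 = 0"
proof -
  have \<alpha>0: "\<alpha> 0 = 1" using nml \<alpha>[of 0] by simp
  have triv: "Hc i = {\<zero>}" if "\<one> = \<zero>" for i
    using comp_zero comp_carrier that one_zeroD by blast
  have c0: "cdim 0 = 1"
  proof (rule ccontr)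
    assume "cdim 0 \<noteq> 1"
    \<comment> \<open>Otherwise degree zero of the ring would vanish and yet contain a kernel of
      order two.\<close>
    then have c: "cdim 0 = 0" "kdim 0 = 1" using kc[of 0] \<alpha>0 by linarith+
    have "card (Hc 0) = 1" using card_Hc_0 c by simp
    then have "Hc 0 = {\<zero>}" using comp_zero by (metis card_1_singletonE singletonD)
    then have "Ker 0 \<subseteq> {\<zero>}" by (auto simp: Ker_def)
    then have "card (Ker 0) \<le> 1" using card_mono[of "{\<zero>}" "Ker 0"] by simp
    then show False using card_Ker(1)[of 0] c by simp
  qed
  then have k0: "kdim 0 = 0" using kc[of 0] \<alpha>0 by simp
  have one: "\<one> \<noteq> \<zero>" using triv[of 0] card_Hc_0 c0 by auto
  have Hc0: "Hc 0 = {\<zero>, \<one>}"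
  proof -
    have "card {\<zero>, \<one>} = card (Hc 0)" using one card_Hc_0 c0 by simp
    then show ?thesis using card_subset_eq[OF finite_Hc, of "{\<zero>, \<one>}" 0] comp_zero one_comp by auto
  qed
  have \<alpha>l: "\<alpha> j = 0" if "l < j" for j using that nml \<alpha>[of j] by simp
  have sums: "(\<Sum>j\<le>l. cdim j) = 2" "(\<Sum>j\<le>l. kdim j) = 2"
  proof -
    obtain h where h: "card (Hc (Suc l)) = 2 ^ h" "(\<Sum>j\<le>Suc l. cdim j) = (\<Sum>j<Suc l. kdim j) + h"
      using card_sum by blast
    \<comment> \<open>Beyond degree \<open>l\<close> nothing is left, so \<open>card_sum\<close> has
      no remainder and the totals of \<open>cdim\<close> and \<open>kdim\<close> agree; together
      they make four.\<close>
    have "Hc (Suc l) = {\<zero>}" using \<alpha>l by (intro Hc_zero) simp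
    then have "h = 0" using h(1) by (cases h) simp_all
    moreover have "cdim (Suc l) = 0" using kc[of "Suc l"] \<alpha>l by simp
    ultimately have eq: "(\<Sum>j\<le>l. cdim j) = (\<Sum>j\<le>l. kdim j)" using h(2) by (simp add: lessThan_Suc_atMost)
    have "(\<Sum>j\<le>l. kdim j) + (\<Sum>j\<le>l. cdim j) = (\<Sum>j\<le>l. \<alpha> j)" by (simp add: kc flip: sum.distrib)
    also have "\<dots> = (\<Sum>j\<le>l. of_bool (j = 0)) + (\<Sum>j\<le>l. of_bool (j = n)) + (\<Sum>j\<le>l. of_bool (j = m)) + (\<Sum>j\<le>l. of_bool (j = l))"
      by (simp only: \<alpha> sum.distrib)
    also have "\<dots> = 4" using nml by (simp add: of_bool_def sum.delta)
    finally show "(\<Sum>j\<le>l. cdim j) = 2" "(\<Sum>j\<le>l. kdim j) = 2" using eq by linarith+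
  qed
  have ex_single: "\<exists>q\<le>l. \<forall>j. f j = of_bool (j = q)"
    if f: "(\<Sum>j\<le>l. f j) = 1" "\<And>j. l < j \<Longrightarrow> f j = 0" for f :: "nat \<Rightarrow> nat"
  proof -
    obtain q where q: "q \<in> {..l}" "f q = 1" "\<forall>j \<in> {..l}. q \<noteq> j \<longrightarrow> f j = 0"
      using f(1) sum_eq_1_iff[of "{..l}" f] by auto
    have "f j = of_bool (j = q)" for j
      using q f(2)[of j] by (cases "l < j") auto
    then show ?thesis using q(1) by (intro exI[of _ q]) simp
  qed
  have "(\<Sum>j\<le>l. cdim j - of_bool (j = 0)) = (\<Sum>j\<le>l. cdim j) - (\<Sum>j\<le>l. of_bool (j = 0))"
    using c0 by (intro sum_subtractf_nat) auto
  also have "\<dots> = 1" using sums(1) by (simp add: of_bool_def sum.delta)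
  finally have s1: "(\<Sum>j\<le>l. cdim j - of_bool (j = 0)) = 1" .
  have cl: "cdim j = 0" "kdim j = 0" if "l < j" for j using kc[of j] \<alpha>l[OF that] by simp_all
  obtain q where q: "q \<le> l" "\<And>j. cdim j - of_bool (j = 0) = of_bool (j = q)"
    using ex_single[OF s1] cl(1) by auto
  have q0: "q \<noteq> 0" using q(2)[of 0] c0 by auto
  have cq: "cdim j = of_bool (j = 0) + of_bool (j = q)" for j
    using q(2)[of j] c0 q0 by (cases "j = 0") auto
  \<comment> \<open>The largest exponent of a nonzero power of \<open>y\<close>. The subtraction is
    harmless: the least vanishing exponent is positive as
    \<open>\<one> \<noteq> \<zero>\<close>.\<close>
  define p where "p = (LEAST N. y [^] (N::nat) = \<zero>) - 1"
  have P: "y [^] (LEAST N. y [^] (N::nat) = \<zero>) = \<zero>" using LeastI_ex[OF y_nil] .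
  then have P0: "(LEAST N. y [^] (N::nat) = \<zero>) \<noteq> 0" using one by (metis nat_pow_0)
  have ytop: "y [^] Suc p = \<zero>" using P P0 by (simp add: p_def)
  have ynz: "y [^] p \<noteq> \<zero>" using not_less_Least[of p "\<lambda>N. y [^] N = \<zero>"] P0 by (simp add: p_def)
  have pow_split: "y [^] (i + j) \<otimes> x = y [^] i \<otimes> (y [^] j \<otimes> x)" if "x \<in> carrier R" for i j :: nat and x
    using that by (simp add: m_assoc flip: nat_pow_mult)
  have yz: "y [^] i = \<zero>" if "p < i" for i
    using nat_pow_mult[OF y_carrier, of "Suc p" "i - Suc p"] that ytop by simp
  have yn: "y [^] i \<noteq> \<zero>" if "i \<le> p" for i
    using nat_pow_mult[OF y_carrier, of i "p - i"] that ynz by auto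
  have Ker_1: "kdim i \<ge> 1" if "x \<in> Ker i" "x \<noteq> \<zero>" for i x
  proof (rule ccontr)
    assume "\<not> kdim i \<ge> 1"
    then have "card (Ker i) = 1" using card_Ker(1)[of i] by simp
    then show False using that Ker_zero[of i] by (metis card_1_singletonE singletonD)
  qed
  \<comment> \<open>This class takes up one of the two kernel dimensions; the other one sits in a
    degree \<open>r\<close>, possibly equal to \<open>p\<close>.\<close>
  have "y [^] p \<in> Ker p"
    unfolding Ker_def using pow_comp ytop nat_pow_Suc2[OF y_carrier, of p] by simp
  then have kp: "kdim p \<ge> 1" using Ker_1 ynz by blast
  have pl: "p \<le> l" using cl(2)[of p] kp by (cases "p \<le> l") auto
  have "(\<Sum>j\<le>l. kdim j - of_bool (j = p)) = (\<Sum>j\<le>l. kdim j) - (\<Sum>j\<le>l. of_bool (j = p))"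
    using kp by (intro sum_subtractf_nat) auto
  also have "\<dots> = 1" using sums(2) pl by (simp add: of_bool_def sum.delta)
  finally have s2: "(\<Sum>j\<le>l. kdim j - of_bool (j = p)) = 1" .
  obtain r where r: "r \<le> l" "\<And>j. kdim j - of_bool (j = p) = of_bool (j = r)"
    using ex_single[OF s2] cl(2) by auto
  have kr: "kdim j = of_bool (j = p) + of_bool (j = r)" for j
    using r(2)[of j] kp by (cases "j = p") auto
  \<comment> \<open>The contribution of the unit in degree zero cancels from
    \<open>kdim i + cdim i = \<alpha> i\<close>.\<close>
  have tri: "of_bool (i = p) + of_bool (i = r) + of_bool (i = q)
      = (of_bool (i = n) + of_bool (i = m) + of_bool (i = l) :: nat)" for i
    using kc[of i] \<alpha>[of i] cq[of i] kr[of i] by simp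

  have span1: "\<exists>b. a = sc b (y [^] i)" if "i < q" "a \<in> Hc i" for i a
    using that
  proof (induction i arbitrary: a)
    case 0
    then have "a = \<zero> \<or> a = \<one>" using Hc0 by blast
    then show ?case by (auto intro: exI[of _ 0] exI[of _ 1])
  next
    case (Suc i)
    then have "a \<in> (\<lambda>a. y \<otimes> a) ` Hc i" using Hc_eq_image[of i] cq[of "Suc i"] by simp
    then obtain a' where a': "a' \<in> Hc i" "a = y \<otimes> a'" by blast
    then obtain b where "a' = sc b (y [^] i)" using Suc by auto
    then have "a = sc b (y [^] Suc i)"
      using a' sc_mult[of "y [^] i" y b] nat_pow_Suc2[OF y_carrier, of i] by simp
    then show ?case by blast
  qed
  obtain q' where q': "q = Suc q'" using q0 not0_implies_Suc by blast
  \<comment> \<open>The multiples of \<open>y\<close> have index two in degree \<open>q\<close>,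
    because the cokernel has dimension one there.\<close>
  define Wd where "Wd = (\<lambda>a. y \<otimes> a) ` Hc q'"
  have Wd: "Wd \<subseteq> Hc q" unfolding Wd_def q' using mult_comp[OF y_comp, of _ q'] by auto
  have finWd: "finite Wd" unfolding Wd_def using finite_Hc by simp
  have cardq: "card (Hc q) = 2 * card Wd"
    using card_Hc_Suc[of q'] cq[of q] q0 by (simp add: q' Wd_def)
  have WdS: "\<exists>b. a = sc b (y [^] q)" if a: "a \<in> Wd" for a
  proof -
    obtain a' where a': "a' \<in> Hc q'" "a = y \<otimes> a'" using a unfolding Wd_def by blast
    then obtain b where "a' = sc b (y [^] q')" using span1[of q' a'] q' by auto
    then have "a = sc b (y [^] q)"
      using a' sc_mult[of "y [^] q'" y b] nat_pow_Suc2[OF y_carrier, of q'] by (simp add: q')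
    then show ?thesis by blast
  qed
  have "card Wd \<noteq> 0" using finWd comp_zero[of q'] by (auto simp: Wd_def)
  then have "Wd \<noteq> Hc q" using cardq by auto
  then obtain z0 where z0: "z0 \<in> Hc q" "z0 \<notin> Wd" using Wd by blast
  have z0c: "z0 \<in> carrier R" using z0 comp_carrier by blast
  have WdX: "a \<in> Wd \<or> a \<oplus> z0 \<in> Wd" if a: "a \<in> Hc q" for a
  proof -
    have Wc: "x \<in> carrier R" if "x \<in> Wd" for x using that Wd comp_carrier by blast
    have Wadd: "x \<oplus> x' \<in> Wd" if "x \<in> Wd" "x' \<in> Wd" for x x'
      using that comp_add comp_carrier unfolding Wd_def by (force simp flip: r_distr)
    have inj: "inj_on (\<lambda>x. x \<oplus> z0) Wd"
      by (rule inj_onI) (use Wc z0c add.right_cancel in metis)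
    have "Wd \<inter> (\<lambda>x. x \<oplus> z0) ` Wd = {}"
    proof (rule ccontr)
      assume "Wd \<inter> (\<lambda>x. x \<oplus> z0) ` Wd \<noteq> {}"
      then obtain x where x: "x \<in> Wd" "x \<oplus> z0 \<in> Wd" by blast
      then have "z0 \<in> Wd" using Wadd[OF x] add_cancel_double[OF Wc[OF x(1)] z0c] by simp
      then show False using z0 by simp
    qed
    \<comment> \<open>Two disjoint cosets, each of half the order of the component, exhaust
      it.\<close>
    then have "card (Wd \<union> (\<lambda>x. x \<oplus> z0) ` Wd) = card (Hc q)"
      using card_Un_disjoint[OF finWd, of "(\<lambda>x. x \<oplus> z0) ` Wd"] finWd card_image[OF inj] cardq by simp
    moreover have "Wd \<union> (\<lambda>x. x \<oplus> z0) ` Wd \<subseteq> Hc q" using Wd comp_add z0(1) by blast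
    ultimately have "Wd \<union> (\<lambda>x. x \<oplus> z0) ` Wd = Hc q" using card_subset_eq[OF finite_Hc] by metis
    then show ?thesis using a Wc z0c by (auto simp: a_assoc double)
  qed
  have span2: "\<exists>b b'. a = sc b (y [^] (q + j)) \<oplus> sc b' (y [^] j \<otimes> z0)" if "a \<in> Hc (q + j)" for a j
    using that
  proof (induction j arbitrary: a)
    case 0
    then have a: "a \<in> Hc q" "a \<in> carrier R" using comp_carrier by auto
    consider "a \<in> Wd" | "a \<oplus> z0 \<in> Wd" using WdX[OF a(1)] by blast
    then show ?case
    proof cases
      case 1
      then obtain b where "a = sc b (y [^] q)" using WdS by blast
      then show ?thesis by (intro exI[of _ b] exI[of _ 0]) simp
    next
      case 2
      then obtain b where b: "a \<oplus> z0 = sc b (y [^] q)" using WdS by blast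
      have "a = (a \<oplus> z0) \<oplus> z0" using a z0c by (simp add: a_assoc double)
      then show ?thesis using b z0c by (intro exI[of _ b] exI[of _ 1]) simp
    qed
  next
    case (Suc j)
    have "Hc (q + Suc j) = (\<lambda>a. y \<otimes> a) ` Hc (q + j)"
      using Hc_eq_image[of "q + j"] cq[of "Suc (q + j)"] by simp
    then obtain a' where a': "a' \<in> Hc (q + j)" "a = y \<otimes> a'" using Suc.prems by blast
    then obtain b b' where "a' = sc b (y [^] (q + j)) \<oplus> sc b' (y [^] j \<otimes> z0)" using Suc.IH by blast
    then have "a = sc b (y \<otimes> y [^] (q + j)) \<oplus> sc b' (y \<otimes> (y [^] j \<otimes> z0))"
      using a'(2) z0c by (simp add: r_distr sc_mult)
    then have "a = sc b (y [^] (q + Suc j)) \<oplus> sc b' (y [^] Suc j \<otimes> z0)"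
      using nat_pow_Suc2[OF y_carrier, of "q + j"] y_mult_pow[OF z0c, of j] by simp
    then show ?case by blast
  qed

  \<comment> \<open>For \<open>r = p\<close> the kernel has order four, leaving room beside
    \<open>\<zero>\<close> and \<open>y [^] r\<close>. Otherwise its nonzero element cannot be
    \<open>y [^] r\<close>, as \<open>p\<close> is the only exponent at which a nonzero power of
    \<open>y\<close> is killed by \<open>y\<close>.\<close>
  have "\<exists>u \<in> Ker r. u \<noteq> \<zero> \<and> u \<noteq> y [^] r"
  proof (cases "r = p")
    case True
    then have "card (Ker r) = 4" using card_Ker(1)[of r] kr[of r] by simp
    moreover have "card {\<zero>, y [^] r} \<le> 2" by (simp add: card_insert_if)
    ultimately have "\<not> Ker r \<subseteq> {\<zero>, y [^] r}" using card_mono[of "{\<zero>, y [^] r}" "Ker r"] by auto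
    then show ?thesis by blast
  next
    case False
    then have "card (Ker r) = 2" using card_Ker(1)[of r] kr[of r] by simp
    then have "\<not> Ker r \<subseteq> {\<zero>}" using card_mono[of "{\<zero>}" "Ker r"] by auto
    then obtain u where u: "u \<in> Ker r" "u \<noteq> \<zero>" by blast
    have "u \<noteq> y [^] r"
    proof
      assume e: "u = y [^] r"
      then have "r \<le> p" using yz[of r] u(2) by (cases "r \<le> p") auto
      moreover have "y [^] Suc r = \<zero>" using u(1) e nat_pow_Suc2[OF y_carrier, of r] by (simp add: Ker_def)
      ultimately show False using yn[of "Suc r"] False by auto
    qed
    then show ?thesis using u by blast
  qed
  then obtain u where u: "u \<in> Hc r" "y \<otimes> u = \<zero>" "u \<noteq> \<zero>" "u \<noteq> y [^] r" by (auto simp: Ker_def)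
  \<comment> \<open>Below degree \<open>q\<close> there are only multiples of powers of
    \<open>y\<close>, which \<open>u\<close> avoids.\<close>
  have qr: "q \<le> r"
  proof (rule ccontr)
    assume "\<not> q \<le> r"
    then obtain b where "u = sc b (y [^] r)" using span1[of r u] u(1) by auto
    then show False using u(3,4) by (cases b) auto
  qed
  obtain b b' where bb: "u = sc b (y [^] r) \<oplus> sc b' (y [^] (r - q) \<otimes> z0)"
    using span2[of u "r - q"] u(1) qr by auto
  have b': "b' = 1" using bb u(3,4) by (cases b'; cases b) auto
  \<comment> \<open>The expansion of \<open>u\<close> contains
    \<open>y [^] (r - q) \<otimes> z0\<close>, and its possible further term \<open>y [^] r\<close>
    is a multiple of \<open>y [^] q\<close>; absorbing that into the generator gives
    \<open>y [^] (r - q) \<otimes> z = u\<close>.\<close>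
  define z where "z = sc b (y [^] q) \<oplus> z0"
  have z: "z \<in> Hc q" "z \<in> carrier R"
    unfolding z_def using z0 pow_comp comp_add comp_carrier by auto
  have uz: "y [^] (r - q) \<otimes> z = u"
    unfolding z_def bb b' using z0c nat_pow_mult[OF y_carrier, of "r - q" q] qr by (simp add: r_distr sc_mult)
  have z0z: "z0 = sc b (y [^] q) \<oplus> z" unfolding z_def using z0c by (simp add: add_cancel_double)
  have span3: "\<exists>b b'. a = sc b (y [^] (q + j)) \<oplus> sc b' (y [^] j \<otimes> z)" if "a \<in> Hc (q + j)" for a j
  proof -
    obtain d d' where d: "a = sc d (y [^] (q + j)) \<oplus> sc d' (y [^] j \<otimes> z0)" using span2 \<open>a \<in> Hc (q + j)\<close> by blast
    have "y [^] j \<otimes> z0 = sc b (y [^] (q + j)) \<oplus> y [^] j \<otimes> z"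
      unfolding z0z using z nat_pow_mult[OF y_carrier, of j q] by (simp add: r_distr sc_mult add.commute)
    then have "a = sc (d + d' * b) (y [^] (q + j)) \<oplus> sc d' (y [^] j \<otimes> z)"
      using d z by (cases d') (simp_all add: sc_add a_assoc)
    then show ?thesis by blast
  qed
  have ztop: "y [^] Suc (r - q) \<otimes> z = \<zero>" using y_mult_pow[OF z(2), of "r - q"] uz u(2) by simp
  have zzero: "y [^] j \<otimes> z = \<zero>" if "r - q < j" for j
    using pow_split[OF z(2), of "j - Suc (r - q)" "Suc (r - q)"] that ztop by simp
  have znz: "y [^] j \<otimes> z \<noteq> \<zero>" if "j \<le> r - q" for j
  proof
    assume "y [^] j \<otimes> z = \<zero>"
    moreover have "y [^] (r - q) \<otimes> z = y [^] (r - q - j) \<otimes> (y [^] j \<otimes> z)"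
      using pow_split[OF z(2), of "r - q - j" j] le_add_diff_inverse2[OF that] by metis
    ultimately show False using uz u(3) by simp
  qed
  \<comment> \<open>An equality would persist under multiplication by powers of \<open>y\<close>.
    For \<open>r\<close> different from \<open>p\<close> one side then dies before the other; for
    \<open>r = p\<close> it would end in \<open>u = y [^] r\<close>.\<close>
  have yzi: "y [^] i \<noteq> y [^] (i - q) \<otimes> z" if i: "q \<le> i" "i \<le> r" "i \<le> p" for i
  proof
    assume e: "y [^] i = y [^] (i - q) \<otimes> z"
    have mul: "y [^] (t + i) = y [^] (t + (i - q)) \<otimes> z" for t :: nat
      using pow_split[OF z(2), of t "i - q"] nat_pow_mult[OF y_carrier, of t i] e by simp
    consider "r < p" | "r = p" | "p < r" by linarith
    then show False
    proof cases
      case 1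
      then show False using mul[of "Suc r - i"] zzero[of "Suc r - i + (i - q)"] yn[of "Suc r"] i by simp
    next
      case 2
      then show False using mul[of "r - i"] uz u(4) i by simp
    next
      case 3
      have "r - q \<ge> Suc p - i + (i - q)" using 3 i by simp
      then show False using mul[of "Suc p - i"] znz[of "Suc p - i + (i - q)"] yz[of "Suc p"] i by simp
    qed
  qed
  obtain e0 e1 where e: "z \<otimes> z = sc e0 (y [^] (q + q)) \<oplus> sc e1 (y [^] q \<otimes> z)"
    using span3[of "z \<otimes> z" q] mult_comp[OF z(1) z(1)] by blast
  \<comment> \<open>Both changes are invisible in the ring: \<open>y [^] (2 * q)\<close> vanishes
    when \<open>p < 2 * q\<close>, and \<open>y [^] q \<otimes> z\<close> vanishes when
    \<open>r - q < q\<close>.\<close>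
  define a0 where "a0 = (if p < 2 * q then 0 else e0)"
  define a1 where "a1 = (if r < 2 * q then 0 else e1)"
  have "sc e0 (y [^] (q + q)) = sc a0 (y [^] (2 * q))"
    using yz[of "q + q"] by (auto simp: a0_def mult_2)
  moreover have "sc e1 (y [^] q \<otimes> z) = sc a1 (y [^] q \<otimes> z)"
    using zzero[of q] qr by (auto simp: a1_def)
  ultimately have zz: "z \<otimes> z = sc a0 (y [^] (2 * q)) \<oplus> sc a1 (y [^] q \<otimes> z)" using e by simp
  have "two_block R pr y z p q r a0 a1"
  proof unfold_locales
    show "\<exists>b b'. a = sc b (y [^] i) \<oplus> (if i < q then \<zero> else sc b' (y [^] (i - q) \<otimes> z))" if a: "a \<in> component R i" for a i
    proof (cases "i < q")
      case True
      then obtain b where "a = sc b (y [^] i)" using span1[OF True a] by blast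
      then show ?thesis using True by (intro exI[of _ b]) simp
    next
      case False
      then show ?thesis using span3[of a "i - q"] a by simp
    qed
    show "y \<in> component R 1" by (rule y_comp)
    show "z \<in> component R q" by (rule z(1))
    show "y [^] (p + 1) = \<zero>" using ytop by simp
    show "y [^] (r - q + 1) \<otimes> z = \<zero>" using ztop by simp
    show "y [^] (i - q) \<otimes> z \<noteq> \<zero>" if "q \<le> i" "i \<le> r" for i using that by (intro znz) simp
  qed (use y_central qr zz yn yzi in auto)
  moreover have "(p = l \<and> q = n \<and> r = m) \<or> (p = n \<and> q = m \<and> r = l) \<or> (p = m \<and> q = n \<and> r = l)"
    using of_bool_triple[OF tri nml(2,3) qr] .
  ultimately show ?thesis by (rule that) (simp_all add: a0_def a1_def)
qed

end

section \<open>Presented algebras\<close>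

lemma mpoly_induct [case_names zero add]:
  fixes p :: "('v, 'k::comm_ring_1) mpoly"
  assumes "P 0" and "\<And>p t k. P p \<Longrightarrow> P (p + Poly_Mapping.single t k)"
  shows "P p"
proof -
  have "P (\<Sum>t\<in>A. Poly_Mapping.single t (Poly_Mapping.lookup p t))" if "finite A" for A
    using that
  proof (induction A)
    case (insert t A)
    then show ?case using assms(2)[OF insert.IH, of t "Poly_Mapping.lookup p t"] by (simp add: add.commute)
  qed (simp add: assms(1))
  moreover have "(\<Sum>t\<in>Poly_Mapping.keys p. Poly_Mapping.single t (Poly_Mapping.lookup p t)) = p"
  proof (rule poly_mapping_eqI)
    fix s
    show "Poly_Mapping.lookup (\<Sum>t\<in>Poly_Mapping.keys p. Poly_Mapping.single t (Poly_Mapping.lookup p t)) s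
        = Poly_Mapping.lookup p s"
      by (simp add: lookup_sum lookup_single when_def in_keys_iff)
  qed
  ultimately show ?thesis by (metis finite_keys)
qed

lemma poly_ring_simps [simp]:
  "carrier poly_ring = UNIV" "p \<otimes>\<^bsub>poly_ring\<^esub> q = p * q" "\<one>\<^bsub>poly_ring\<^esub> = 1"
  "\<zero>\<^bsub>poly_ring\<^esub> = 0" "p \<oplus>\<^bsub>poly_ring\<^esub> q = p + q"
  by (simp_all add: poly_ring_def)

lemma ideal_poly_ringI:
  fixes I :: "('v, 'k::comm_ring_1) mpoly set"
  assumes 0: "0 \<in> I" and add: "\<And>a b. a \<in> I \<Longrightarrow> b \<in> I \<Longrightarrow> a + b \<in> I" and mult: "\<And>a x. a \<in> I \<Longrightarrow> x * a \<in> I"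
  shows "ideal I poly_ring"
proof (rule idealI)
  interpret cring "poly_ring :: ('v, 'k) mpoly ring" by (rule cring_poly_ring)
  show "ring (poly_ring :: ('v, 'k) mpoly ring)" ..
  show "subgroup I (add_monoid (poly_ring :: ('v, 'k) mpoly ring))"
  proof (rule add.subgroupI)
    show "I \<noteq> {}" using 0 by blast
    fix a assume a: "a \<in> I"
    have "\<ominus>\<^bsub>poly_ring\<^esub> a = (- 1) * a" by (rule minus_equality) simp_all
    then show "\<ominus>\<^bsub>poly_ring\<^esub> a \<in> I" using mult[OF a, of "- 1"] by simp
  qed (use add in simp_all)
  fix a x assume "a \<in> I"
  then show "x \<otimes>\<^bsub>poly_ring\<^esub> a \<in> I" "a \<otimes>\<^bsub>poly_ring\<^esub> x \<in> I" using mult[of a x] by (simp_all add: mult.commute)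
qed

context
  fixes S :: "('v, 'k::comm_ring_1) mpoly set"
begin

lemma ideal_Idl: "ideal (Idl\<^bsub>poly_ring\<^esub> S) poly_ring"
  using cring.axioms(1)[OF cring_poly_ring] by (intro ring.genideal_ideal) auto

lemma Idl_gen: "s \<in> S \<Longrightarrow> s \<in> Idl\<^bsub>poly_ring\<^esub> S"
  using cring.axioms(1)[OF cring_poly_ring] ring.genideal_self[of poly_ring S] by auto

lemma Idl_zero: "0 \<in> Idl\<^bsub>poly_ring\<^esub> S"
  using additive_subgroup.zero_closed[OF ideal.axioms(1)[OF ideal_Idl]] by simp

lemma Idl_add: "a \<in> Idl\<^bsub>poly_ring\<^esub> S \<Longrightarrow> b \<in> Idl\<^bsub>poly_ring\<^esub> S \<Longrightarrow> a + b \<in> Idl\<^bsub>poly_ring\<^esub> S"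
  using additive_subgroup.a_closed[OF ideal.axioms(1)[OF ideal_Idl], of a b] by simp

lemma Idl_mult: "a \<in> Idl\<^bsub>poly_ring\<^esub> S \<Longrightarrow> x * a \<in> Idl\<^bsub>poly_ring\<^esub> S"
  using ideal.I_l_closed[OF ideal_Idl, of a x] by simp

lemma Idl_diff: "a \<in> Idl\<^bsub>poly_ring\<^esub> S \<Longrightarrow> b \<in> Idl\<^bsub>poly_ring\<^esub> S \<Longrightarrow> a - b \<in> Idl\<^bsub>poly_ring\<^esub> S"
  using Idl_add[OF _ Idl_mult[of b "- 1"], of a] by simp

lemma Idl_minimal:
  assumes "S \<subseteq> I" "0 \<in> I" "\<And>a b. a \<in> I \<Longrightarrow> b \<in> I \<Longrightarrow> a + b \<in> I" "\<And>a x. a \<in> I \<Longrightarrow> x * a \<in> I"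
  shows "Idl\<^bsub>poly_ring\<^esub> S \<subseteq> I"
  using cring.axioms(1)[OF cring_poly_ring] ideal_poly_ringI[of I] assms by (intro ring.genideal_minimal) auto

lemma mem_coset: "q \<in> Idl\<^bsub>poly_ring\<^esub> S +>\<^bsub>poly_ring\<^esub> p \<longleftrightarrow> q - p \<in> Idl\<^bsub>poly_ring\<^esub> S"
  unfolding a_r_coset_def' by (auto intro!: bexI[of _ "q - p"])

lemma coset_eq_iff:
  "Idl\<^bsub>poly_ring\<^esub> S +>\<^bsub>poly_ring\<^esub> p = Idl\<^bsub>poly_ring\<^esub> S +>\<^bsub>poly_ring\<^esub> q \<longleftrightarrow> p - q \<in> Idl\<^bsub>poly_ring\<^esub> S"
proof
  assume eq: "Idl\<^bsub>poly_ring\<^esub> S +>\<^bsub>poly_ring\<^esub> p = Idl\<^bsub>poly_ring\<^esub> S +>\<^bsub>poly_ring\<^esub> q"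
  have "p \<in> Idl\<^bsub>poly_ring\<^esub> S +>\<^bsub>poly_ring\<^esub> p" by (simp add: mem_coset Idl_zero)
  then show "p - q \<in> Idl\<^bsub>poly_ring\<^esub> S" unfolding eq mem_coset .
next
  assume pq: "p - q \<in> Idl\<^bsub>poly_ring\<^esub> S"
  have "x - p \<in> Idl\<^bsub>poly_ring\<^esub> S \<longleftrightarrow> x - q \<in> Idl\<^bsub>poly_ring\<^esub> S" for x
    using Idl_add[OF _ pq, of "x - p"] Idl_diff[OF _ pq, of "x - q"] by auto
  then show "Idl\<^bsub>poly_ring\<^esub> S +>\<^bsub>poly_ring\<^esub> p = Idl\<^bsub>poly_ring\<^esub> S +>\<^bsub>poly_ring\<^esub> q"
    by (auto simp: mem_coset)
qed

lemma presented_algebra_simps: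
  fixes d
  defines "Q \<equiv> presented_algebra d S" and "C \<equiv> \<lambda>p. Idl\<^bsub>poly_ring\<^esub> S +>\<^bsub>poly_ring\<^esub> p"
  shows "carrier Q = range C" "C p \<otimes>\<^bsub>Q\<^esub> C q = C (p * q)" "\<one>\<^bsub>Q\<^esub> = C 1"
    "C p \<oplus>\<^bsub>Q\<^esub> C q = C (p + q)" "k \<odot>\<^bsub>Q\<^esub> C p = C (Const k * p)"
    "component Q i = C ` {p. homogeneous d i p}"
proof -
  interpret ideal "Idl\<^bsub>poly_ring\<^esub> S" "poly_ring" by (rule ideal_Idl)
  show "carrier Q = range C"
    unfolding Q_def C_def presented_algebra_def Let_def FactRing_def A_RCOSETS_def' by auto
  show "C p \<otimes>\<^bsub>Q\<^esub> C q = C (p * q)" "\<one>\<^bsub>Q\<^esub> = C 1" "C p \<oplus>\<^bsub>Q\<^esub> C q = C (p + q)"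
    unfolding Q_def C_def presented_algebra_def Let_def FactRing_def
    using rcoset_mult_add[of p q] a_rcos_sum[of p q] by simp_all
  show "component Q i = C ` {p. homogeneous d i p}"
    unfolding Q_def C_def presented_algebra_def Let_def by auto
  have "C (Const k * p') = C (Const k * p)" if "p' \<in> C p" for p'
  proof -
    have "p' - p \<in> Idl\<^bsub>poly_ring\<^esub> S" using that by (simp add: C_def mem_coset)
    then have "Const k * p' - Const k * p \<in> Idl\<^bsub>poly_ring\<^esub> S"
      using Idl_mult[of "p' - p" "Const k"] by (simp add: right_diff_distrib)
    then show ?thesis by (simp add: C_def coset_eq_iff)
  qed
  moreover have "p \<in> C p" by (simp add: C_def mem_coset Idl_zero)
  ultimately have "(\<Union>p\<in>C p. C (Const k * p)) = C (Const k * p)" by blast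
  then show "k \<odot>\<^bsub>Q\<^esub> C p = C (Const k * p)"
    unfolding Q_def C_def presented_algebra_def Let_def by simp
qed

end

text \<open>The isomorphism sends an element to its fibre under \<open>ev\<close>. That fibre is a
  coset of the ideal, hence already an element of the quotient, and no representative has to be
  chosen.\<close>

lemma presented_algebra_iso:
  fixes R :: "('k::comm_ring_1, 'a) graded_algebra" and ev :: "('v, 'k) mpoly \<Rightarrow> 'a"
  assumes mult: "\<And>p q. ev (p * q) = ev p \<otimes>\<^bsub>R\<^esub> ev q" and add: "\<And>p q. ev (p + q) = ev p \<oplus>\<^bsub>R\<^esub> ev q"
    and one: "ev 1 = \<one>\<^bsub>R\<^esub>" and smult: "\<And>k p. ev (Const k * p) = k \<odot>\<^bsub>R\<^esub> ev p"
    and surj: "range ev = carrier R"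
    and ker: "\<And>p q. ev p = ev q \<longleftrightarrow> p - q \<in> Idl\<^bsub>poly_ring\<^esub> S"
    and comp: "\<And>i. ev ` {p. homogeneous d i p} = component R i"
  shows "R \<cong>\<^sub>g\<^sub>r presented_algebra d S"
proof -
  define C where "C p = Idl\<^bsub>poly_ring\<^esub> S +>\<^bsub>poly_ring\<^esub> p" for p
  define h where "h a = {p. ev p = a}" for a
  note Q = presented_algebra_simps[of d S, folded C_def]
  have hev: "h (ev p) = C p" for p
    unfolding h_def C_def by (auto simp: mem_coset ker)
  have rep: "\<exists>p. a = ev p" if "a \<in> carrier R" for a using that surj by blast
  have "h \<in> ring_iso R (presented_algebra d S)"
  proof (rule ring_iso_memI)
    show "h a \<in> carrier (presented_algebra d S)" if "a \<in> carrier R" for a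
      using rep[OF that] by (auto simp: hev Q)
    show "h (a \<otimes>\<^bsub>R\<^esub> b) = h a \<otimes>\<^bsub>presented_algebra d S\<^esub> h b" if "a \<in> carrier R" "b \<in> carrier R" for a b
      using rep[OF that(1)] rep[OF that(2)] by (auto simp: hev Q simp flip: mult)
    show "h (a \<oplus>\<^bsub>R\<^esub> b) = h a \<oplus>\<^bsub>presented_algebra d S\<^esub> h b" if "a \<in> carrier R" "b \<in> carrier R" for a b
      using rep[OF that(1)] rep[OF that(2)] by (auto simp: hev Q simp flip: add)
    show "h \<one>\<^bsub>R\<^esub> = \<one>\<^bsub>presented_algebra d S\<^esub>" by (simp add: hev Q flip: one)
    show "bij_betw h (carrier R) (carrier (presented_algebra d S))"
    proof (rule bij_betw_imageI)
      show "inj_on h (carrier R)"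
      proof (rule inj_onI)
        fix a b assume ab: "a \<in> carrier R" "b \<in> carrier R" "h a = h b"
        obtain p where p: "a = ev p" using rep[OF ab(1)] by blast
        then have "p \<in> h b" unfolding ab(3)[symmetric] by (simp add: h_def)
        then show "a = b" by (simp add: h_def p)
      qed
      show "h ` carrier R = carrier (presented_algebra d S)"
        unfolding Q surj[symmetric] by (simp add: image_image hev)
    qed
  qed
  moreover have "h (k \<odot>\<^bsub>R\<^esub> a) = k \<odot>\<^bsub>presented_algebra d S\<^esub> h a" if "a \<in> carrier R" for k a
    using rep[OF that] by (auto simp: hev Q simp flip: smult)
  moreover have "h ` component R i = component (presented_algebra d S) i" for i
    unfolding Q comp[symmetric] by (simp add: image_image hev)
  ultimately show ?thesis unfolding graded_algebra_iso_def by blast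
qed

lemma uminus_mpoly_bit [simp]: "- p = p" for p :: "('v, bit) mpoly"
  by (rule poly_mapping_eqI) simp

lemma diff_mpoly_bit: "p - q = p + q" for p :: "('v, bit) mpoly"
  by (metis uminus_mpoly_bit diff_conv_add_uminus)

lemma double_mpoly_bit [simp]: "p + p = 0" for p :: "('v, bit) mpoly"
  using diff_mpoly_bit[of p p] by simp

lemma Const_simps [simp]: "Const 0 = 0" "Const 1 = 1"
  by (simp_all add: Const_def)

lemma Const_add: "Const (a + b) = Const a + Const b"
  by (simp add: Const_def single_add)

lemma Var_power: "Var v ^ i = Poly_Mapping.single (Poly_Mapping.single v i) 1"
  by (induction i) (simp_all add: Var_def mult_single single_add[symmetric])

lemma single_yz:
  "Poly_Mapping.single t k = Const k * Var gen_y ^ Poly_Mapping.lookup t gen_y * Var gen_z ^ Poly_Mapping.lookup t gen_z"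
proof -
  have "t = Poly_Mapping.single gen_y (Poly_Mapping.lookup t gen_y) + Poly_Mapping.single gen_z (Poly_Mapping.lookup t gen_z)"
  proof (rule poly_mapping_eqI)
    fix v show "Poly_Mapping.lookup t v = Poly_Mapping.lookup (Poly_Mapping.single gen_y (Poly_Mapping.lookup t gen_y)
        + Poly_Mapping.single gen_z (Poly_Mapping.lookup t gen_z)) v"
      by (cases v) (simp_all add: lookup_add lookup_single)
  qed
  then show ?thesis by (simp add: Var_power Const_def mult_single)
qed

lemma degree_yz:
  fixes t :: "yz \<Rightarrow>\<^sub>0 nat"
  shows "(\<Sum>v \<in> Poly_Mapping.keys t. (case v of gen_y \<Rightarrow> 1 | gen_z \<Rightarrow> q) * Poly_Mapping.lookup t v)
    = Poly_Mapping.lookup t gen_y + q * Poly_Mapping.lookup t gen_z"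
proof -
  have U: "(UNIV :: yz set) = {gen_y, gen_z}" using yz.exhaust by auto
  have fin: "finite (UNIV :: yz set)" unfolding U by simp
  have "(\<Sum>v \<in> Poly_Mapping.keys t. (case v of gen_y \<Rightarrow> 1 | gen_z \<Rightarrow> q) * Poly_Mapping.lookup t v)
      = (\<Sum>v \<in> UNIV. (case v of gen_y \<Rightarrow> 1 | gen_z \<Rightarrow> q) * Poly_Mapping.lookup t v)"
    using fin by (intro sum.mono_neutral_left) (simp_all add: in_keys_iff)
  then show ?thesis by (simp add: U)
qed

lemma homogeneous_add: "homogeneous d i p \<Longrightarrow> homogeneous d i q \<Longrightarrow> homogeneous d i (p + q)"
  unfolding homogeneous_def using keys_add[of p q] by blast

lemma homogeneous_single:
  "(\<Sum>v \<in> Poly_Mapping.keys t. d v * Poly_Mapping.lookup t v) = i \<Longrightarrow> homogeneous d i (Poly_Mapping.single t k)"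
  unfolding homogeneous_def by (simp split: if_splits)

section \<open>The presentation of a ring with two blocks\<close>

context two_block
begin

abbreviation Yv :: "(yz, bit) mpoly" where "Yv \<equiv> Var gen_y"
abbreviation Zv :: "(yz, bit) mpoly" where "Zv \<equiv> Var gen_z"

lemma yc [simp]: "y \<in> carrier R" and zc [simp]: "z \<in> carrier R"
  using y1 zq comp_carrier by blast+

lemma pow_y_central: "a \<in> carrier R \<Longrightarrow> y [^] (i::nat) \<otimes> a = a \<otimes> y [^] i"
proof (induction i)
  case (Suc i)
  have "y [^] Suc i \<otimes> a = y [^] i \<otimes> (y \<otimes> a)" using Suc.prems by (simp add: m_assoc)
  also have "\<dots> = (y [^] i \<otimes> a) \<otimes> y" using Suc.prems by (simp add: y_central m_assoc)
  finally show ?case using Suc by (simp add: m_assoc)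
qed simp

lemma pow_y_comp: "y [^] (i::nat) \<in> component R i"
proof (induction i)
  case (Suc i)
  then show ?case using mult_comp[OF Suc y1] by simp
qed (simp add: one_comp)

lemma pow_z_comp: "z [^] (i::nat) \<in> component R (q * i)"
proof (induction i)
  case (Suc i)
  then show ?case using mult_comp[OF Suc zq] by (simp add: add.commute)
qed (simp add: one_comp)

text \<open>Since \<open>y ^ (p + 1)\<close> vanishes in the ring, it annihilates \<open>z\<close> as well.\<close>

lemma blocks_le: "r \<le> p + q"
proof (rule ccontr)
  assume "\<not> r \<le> p + q"
  then have "y [^] (p + 1) \<otimes> z \<noteq> \<zero>" using z_indep[of "p + 1 + q"] by simp
  then show False unfolding y_top by simp
qed

definition mon :: "(yz \<Rightarrow>\<^sub>0 nat) \<Rightarrow> 'a"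
  where "mon t = y [^] Poly_Mapping.lookup t gen_y \<otimes> z [^] Poly_Mapping.lookup t gen_z"

lemma mon_carrier [simp]: "mon t \<in> carrier R"
  by (simp add: mon_def)

text \<open>Centrality of the powers of \<open>y\<close> is what allows the two middle factors to be
  exchanged; the powers of \<open>z\<close> keep their order.\<close>

lemma mon_add: "mon (s + t) = mon s \<otimes> mon t"
proof -
  let ?a = "y [^] Poly_Mapping.lookup s gen_y" and ?b = "y [^] Poly_Mapping.lookup t gen_y"
  let ?c = "z [^] Poly_Mapping.lookup s gen_z" and ?d = "z [^] Poly_Mapping.lookup t gen_z"
  have "mon (s + t) = (?a \<otimes> ?b) \<otimes> (?c \<otimes> ?d)" by (simp add: mon_def lookup_add nat_pow_mult)
  also have "\<dots> = ?a \<otimes> ((?b \<otimes> ?c) \<otimes> ?d)" by (simp add: m_assoc)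
  also have "\<dots> = ?a \<otimes> ((?c \<otimes> ?b) \<otimes> ?d)" by (simp add: pow_y_central)
  also have "\<dots> = mon s \<otimes> mon t" by (simp add: mon_def m_assoc)
  finally show ?thesis .
qed

definition ev :: "(yz, bit) mpoly \<Rightarrow> 'a"
  where "ev f = finsum R (\<lambda>t. sc (Poly_Mapping.lookup f t) (mon t)) (Poly_Mapping.keys f)"

lemma ev_superset:
  assumes "finite A" "Poly_Mapping.keys f \<subseteq> A"
  shows "ev f = finsum R (\<lambda>t. sc (Poly_Mapping.lookup f t) (mon t)) A"
  unfolding ev_def using assms
  by (intro add.finprod_mono_neutral_cong_left) (auto simp: in_keys_iff)

lemma ev_carrier [simp]: "ev f \<in> carrier R"
  unfolding ev_def by (rule finsum_closed) simp

lemma ev_add: "ev (f + g) = ev f \<oplus> ev g"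
proof -
  let ?A = "Poly_Mapping.keys f \<union> Poly_Mapping.keys g"
  have "ev (f + g) = finsum R (\<lambda>t. sc (Poly_Mapping.lookup f t) (mon t) \<oplus> sc (Poly_Mapping.lookup g t) (mon t)) ?A"
    using keys_add[of f g] by (simp add: ev_superset[of ?A] lookup_add sc_add)
  also have "\<dots> = ev f \<oplus> ev g"
    by (simp add: ev_superset[of ?A] finsum_addf)
  finally show ?thesis .
qed

lemma ev_single: "ev (Poly_Mapping.single t b) = sc b (mon t)"
  using ev_superset[of "{t}" "Poly_Mapping.single t b"] by simp

lemma ev_zero [simp]: "ev 0 = \<zero>"
  by (simp add: ev_def)

lemma ev_single_mult: "ev (Poly_Mapping.single t b * g) = ev (Poly_Mapping.single t b) \<otimes> ev g"
proof (induction g rule: mpoly_induct)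
  case (add g s k)
  have "sc (b * k) (mon (t + s)) = sc b (mon t) \<otimes> sc k (mon s)"
    by (cases b; cases k) (simp_all add: mon_add)
  then show ?case using add by (simp add: distrib_left ev_add r_distr mult_single ev_single)
qed simp

lemma ev_mult: "ev (f * g) = ev f \<otimes> ev g"
proof (induction f rule: mpoly_induct)
  case (add f t b)
  then show ?case by (simp add: distrib_right ev_add l_distr ev_single_mult)
qed simp

lemma ev_one [simp]: "ev 1 = \<one>"
  using ev_single[of 0 1] by (simp add: mon_def)

lemma ev_Const: "ev (Const b * f) = sc b (ev f)"
  by (cases b) simp_all

lemma ev_Const_mult [simp]: "a \<in> carrier R \<Longrightarrow> ev (Const b) \<otimes> a = sc b a"
  by (cases b) simp_all

lemma ev_Y [simp]: "ev Yv = y" and ev_Z [simp]: "ev Zv = z"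
  by (simp_all add: Var_def ev_single mon_def lookup_single)

lemma ev_pow: "ev (f ^ i) = ev f [^] i"
proof (induction i)
  case (Suc i)
  then show ?case using nat_pow_Suc2[of "ev f" i] by (simp add: ev_mult del: nat_pow_Suc)
qed simp

lemma ev_diff: "ev f = ev g \<longleftrightarrow> ev (f - g) = \<zero>"
  by (simp add: diff_mpoly_bit ev_add add_eq_zero)

definition rels :: "(yz, bit) mpoly set"
  where "rels = {Yv ^ (p + 1), Zv ^ 2 + Const a0 * Yv ^ (2 * q) + Const a1 * Yv ^ q * Zv, Yv ^ (r - q + 1) * Zv}"

abbreviation J :: "(yz, bit) mpoly set" where "J \<equiv> Idl\<^bsub>poly_ring\<^esub> rels"

lemma ev_J: "f \<in> J \<Longrightarrow> ev f = \<zero>"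
proof -
  have "J \<subseteq> {f. ev f = \<zero>}"
  proof (rule Idl_minimal)
    have "ev (Zv ^ 2 + Const a0 * Yv ^ (2 * q) + Const a1 * Yv ^ q * Zv)
        = z \<otimes> z \<oplus> sc a0 (y [^] (2 * q)) \<oplus> sc a1 (y [^] q \<otimes> z)"
      by (simp add: ev_add ev_mult ev_Const ev_pow power2_eq_square mult.assoc)
    also have "\<dots> = (z \<otimes> z) \<oplus> (z \<otimes> z)"
      by (subst (2) z_square) (simp add: a_assoc)
    also have "\<dots> = \<zero>" by (simp add: double)
    finally show "rels \<subseteq> {f. ev f = \<zero>}"
      using y_top z_top by (simp add: rels_def ev_mult ev_pow del: power_Suc)
  qed (simp_all add: ev_add ev_mult)
  then show "f \<in> J \<Longrightarrow> ev f = \<zero>" by blast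
qed

section \<open>Normal forms modulo the relations\<close>

definition nf :: "(nat \<Rightarrow> bit) \<Rightarrow> (nat \<Rightarrow> bit) \<Rightarrow> (yz, bit) mpoly"
  where "nf \<beta> \<gamma> = (\<Sum>i\<le>p. Const (\<beta> i) * Yv ^ i) + (\<Sum>j\<le>r - q. Const (\<gamma> j) * (Yv ^ j * Zv))"

text \<open>Congruence to a normal form, with the sum in place of the difference. Once it holds for
  every polynomial, the kernel of \<open>ev\<close> is decided on normal forms.\<close>

definition reducible :: "(yz, bit) mpoly set"
  where "reducible = {f. \<exists>\<beta> \<gamma>. f + nf \<beta> \<gamma> \<in> J}"

lemma reducible_add:
  assumes "f \<in> reducible" "g \<in> reducible" shows "f + g \<in> reducible"
proof -
  obtain \<beta> \<gamma> \<beta>' \<gamma>' where "f + nf \<beta> \<gamma> \<in> J" "g + nf \<beta>' \<gamma>' \<in> J" using assms by (auto simp: reducible_def)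
  then have "(f + nf \<beta> \<gamma>) + (g + nf \<beta>' \<gamma>') \<in> J" by (rule Idl_add)
  moreover have "nf \<beta> \<gamma> + nf \<beta>' \<gamma>' = nf (\<lambda>i. \<beta> i + \<beta>' i) (\<lambda>j. \<gamma> j + \<gamma>' j)"
    unfolding nf_def Const_add distrib_right sum.distrib by (simp only: ac_simps)
  ultimately have "(f + g) + nf (\<lambda>i. \<beta> i + \<beta>' i) (\<lambda>j. \<gamma> j + \<gamma>' j) \<in> J"
    by (metis add.assoc add.left_commute)
  then show ?thesis unfolding reducible_def by blast
qed

lemma reducible_J: "f \<in> J \<Longrightarrow> f \<in> reducible"
  unfolding reducible_def nf_def by (auto intro!: exI[of _ "\<lambda>i. 0"])

lemma reducible_sum: "(\<And>i. i \<in> A \<Longrightarrow> f i \<in> reducible) \<Longrightarrow> sum f A \<in> reducible"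
  by (induction A rule: infinite_finite_induct) (auto intro: reducible_add reducible_J Idl_zero)

lemma reducible_Const: "f \<in> reducible \<Longrightarrow> Const b * f \<in> reducible"
  by (cases b) (auto intro: reducible_J Idl_zero)

lemma reducible_Y: "Yv ^ i \<in> reducible"
proof (cases "i \<le> p")
  case True
  have "Const (if k = i then 1 else 0) * Yv ^ k = (if k = i then Yv ^ i else 0)" for k by simp
  then have "nf (\<lambda>k. if k = i then 1 else 0) (\<lambda>k. 0) = Yv ^ i"
    using True by (simp add: nf_def sum.delta)
  then have "Yv ^ i + nf (\<lambda>k. if k = i then 1 else 0) (\<lambda>k. 0) \<in> J" by (simp add: Idl_zero)
  then show ?thesis unfolding reducible_def by blast
next
  case False
  have "Yv ^ (i - (p + 1)) * Yv ^ (p + 1) \<in> J" by (intro Idl_mult Idl_gen) (simp add: rels_def)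
  moreover have "Yv ^ (i - (p + 1)) * Yv ^ (p + 1) = Yv ^ i" unfolding power_add[symmetric] using False by simp
  ultimately show ?thesis using reducible_J by simp
qed

lemma reducible_YZ: "Yv ^ i * Zv \<in> reducible"
proof (cases "i \<le> r - q")
  case True
  have "Const (if k = i then 1 else 0) * (Yv ^ k * Zv) = (if k = i then Yv ^ i * Zv else 0)" for k by simp
  then have "nf (\<lambda>k. 0) (\<lambda>k. if k = i then 1 else 0) = Yv ^ i * Zv"
    using True by (simp add: nf_def sum.delta)
  then have "Yv ^ i * Zv + nf (\<lambda>k. 0) (\<lambda>k. if k = i then 1 else 0) \<in> J" by (simp add: Idl_zero)
  then show ?thesis unfolding reducible_def by blast
next
  case False
  have "Yv ^ (i - (r - q + 1)) * (Yv ^ (r - q + 1) * Zv) \<in> J" by (intro Idl_mult Idl_gen) (simp add: rels_def)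
  moreover have "Yv ^ (i - (r - q + 1)) * (Yv ^ (r - q + 1) * Zv) = Yv ^ i * Zv"
    unfolding mult.assoc[symmetric] power_add[symmetric] using False by simp
  ultimately show ?thesis using reducible_J by simp
qed

text \<open>Multiplying the second relation by a power of \<open>y\<close> trades the square of
  \<open>z\<close> for terms at most linear in \<open>z\<close>, which are reducible
  already.\<close>

lemma reducible_YZZ: "Yv ^ i * Zv ^ 2 \<in> reducible"
proof -
  let ?g = "Zv ^ 2 + Const a0 * Yv ^ (2 * q) + Const a1 * Yv ^ q * Zv"
  have "Yv ^ i * ?g \<in> J" by (intro Idl_mult Idl_gen) (simp add: rels_def)
  then have "Yv ^ i * ?g + Const a0 * Yv ^ (i + 2 * q) + Const a1 * (Yv ^ (i + q) * Zv) \<in> reducible"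
    by (intro reducible_add reducible_J reducible_Const reducible_Y reducible_YZ)
  moreover have "Yv ^ i * ?g = Yv ^ i * Zv ^ 2 + (Const a0 * Yv ^ (i + 2 * q) + Const a1 * (Yv ^ (i + q) * Zv))"
    by (simp add: algebra_simps power_add)
  moreover have "a + b + c + b + c = a" for a b c :: "(yz, bit) mpoly"
    by (metis (no_types, opaque_lifting) add.assoc add.commute add.right_neutral double_mpoly_bit)
  ultimately show ?thesis by (simp add: add.assoc[symmetric])
qed

text \<open>Normal forms are at most linear in \<open>z\<close>, so multiplying one by
  \<open>z\<close> produces nothing beyond its square. This carries the induction on the exponent of
  \<open>z\<close>.\<close>

lemma reducible_Z:
  assumes "f \<in> reducible" shows "Zv * f \<in> reducible"
proof -
  obtain \<beta> \<gamma> where f: "f + nf \<beta> \<gamma> \<in> J" using assms by (auto simp: reducible_def)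
  have "Zv * nf \<beta> \<gamma> = (\<Sum>i\<le>p. Const (\<beta> i) * (Yv ^ i * Zv)) + (\<Sum>j\<le>r - q. Const (\<gamma> j) * (Yv ^ j * Zv ^ 2))"
    by (simp add: nf_def distrib_left sum_distrib_left power2_eq_square ac_simps)
  also have "\<dots> \<in> reducible"
    by (intro reducible_add reducible_sum reducible_Const reducible_YZ reducible_YZZ)
  finally have "Zv * (f + nf \<beta> \<gamma>) + Zv * nf \<beta> \<gamma> \<in> reducible"
    by (rule reducible_add[OF reducible_J[OF Idl_mult[OF f]]])
  moreover have "Zv * (f + nf \<beta> \<gamma>) + Zv * nf \<beta> \<gamma> = Zv * f" by (simp add: distrib_left add.assoc)
  ultimately show ?thesis by simp
qed

lemma reducible_UNIV: "f \<in> reducible"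
proof (induction f rule: mpoly_induct)
  case zero
  then show ?case by (intro reducible_J Idl_zero)
next
  case (add f t k)
  have "Zv ^ j * Yv ^ i \<in> reducible" for i j
    by (induction j) (simp_all add: reducible_Y reducible_Z mult.assoc)
  then have "Const k * (Zv ^ Poly_Mapping.lookup t gen_z * Yv ^ Poly_Mapping.lookup t gen_y) \<in> reducible"
    by (rule reducible_Const)
  then have "Poly_Mapping.single t k \<in> reducible" by (simp add: single_yz[of t] ac_simps)
  then show ?case using add reducible_add by blast
qed

lemma additive_sum_delta:
  assumes "\<And>f g. F (f + g) = F f \<oplus> F g" "F 0 = \<zero>" "\<And>f. F f \<in> carrier R"
    and "finite A" "\<And>i. i \<in> A \<Longrightarrow> i \<noteq> k \<Longrightarrow> F (g i) = \<zero>"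
  shows "F (sum g A) = (if k \<in> A then F (g k) else \<zero>)"
  using assms(4,5)
proof (induction A)
  case (insert i A)
  then show ?case using assms(1-3) by auto
qed (simp add: assms(2))

lemma pr_zero: "pr k \<zero> = \<zero>"
  using pr_on_comp[OF comp_zero] by simp

text \<open>Projection to degree \<open>k\<close> isolates at most one term of each block. The
  independence conditions of \<open>two_block\<close> then kill the coefficient in the block of the
  unit, and after it the one in the block of \<open>z\<close>.\<close>

lemma ev_nf_zero:
  assumes "ev (nf \<beta> \<gamma>) = \<zero>" shows "nf \<beta> \<gamma> = 0"
proof -
  have key: "(if k \<le> p then sc (\<beta> k) (y [^] k) else \<zero>) \<oplus>
      (if q \<le> k \<and> k \<le> r then sc (\<gamma> (k - q)) (y [^] (k - q) \<otimes> z) else \<zero>) = \<zero>" for k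
  proof -
    let ?F = "\<lambda>f. pr k (ev f)"
    have F: "?F (f + g) = ?F f \<oplus> ?F g" "?F 0 = \<zero>" "?F f \<in> carrier R" for f g
      by (simp_all add: ev_add pr_add pr_zero comp_carrier[OF pr_comp])
    have ev1: "ev (Const (\<beta> i) * Yv ^ i) = sc (\<beta> i) (y [^] i)" for i by (simp add: ev_Const ev_pow)
    have ev2: "ev (Const (\<gamma> j) * (Yv ^ j * Zv)) = sc (\<gamma> j) (y [^] j \<otimes> z)" for j
      by (simp add: ev_Const ev_pow ev_mult)
    have c1: "sc (\<beta> i) (y [^] i) \<in> component R i" for i by (simp add: pow_y_comp)
    have c2: "sc (\<gamma> j) (y [^] j \<otimes> z) \<in> component R (j + q)" for j by (simp add: mult_comp pow_y_comp zq)
    have 1: "?F (\<Sum>i\<le>p. Const (\<beta> i) * Yv ^ i) = (if k \<in> {..p} then ?F (Const (\<beta> k) * Yv ^ k) else \<zero>)"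
      by (rule additive_sum_delta[OF F]) (simp_all add: ev1 pr_on_comp[OF c1])
    have 2: "?F (\<Sum>j\<le>r - q. Const (\<gamma> j) * (Yv ^ j * Zv)) = (if q \<le> k \<and> k \<le> r then ?F (Const (\<gamma> (k - q)) * (Yv ^ (k - q) * Zv)) else \<zero>)"
    proof (cases "q \<le> k")
      case True
      have "?F (\<Sum>j\<le>r - q. Const (\<gamma> j) * (Yv ^ j * Zv)) = (if k - q \<in> {..r - q} then ?F (Const (\<gamma> (k - q)) * (Yv ^ (k - q) * Zv)) else \<zero>)"
        by (rule additive_sum_delta[OF F]) (use True in \<open>auto simp: ev2 pr_on_comp[OF c2]\<close>)
      then show ?thesis using True qr by auto
    next
      case False
      \<comment> \<open>Below degree \<open>q\<close> every summand projects to zero; the index just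
        beyond the range makes \<open>additive_sum_delta\<close> say so.\<close>
      have "?F (\<Sum>j\<le>r - q. Const (\<gamma> j) * (Yv ^ j * Zv)) = (if Suc (r - q) \<in> {..r - q} then ?F (Const (\<gamma> (Suc (r - q))) * (Yv ^ (Suc (r - q)) * Zv)) else \<zero>)"
        by (rule additive_sum_delta[OF F]) (use False in \<open>auto simp: ev2 pr_on_comp[OF c2]\<close>)
      then show ?thesis using False by simp
    qed
    have "\<zero> = ?F (nf \<beta> \<gamma>)" using assms pr_zero by simp
    also have "\<dots> = ?F (\<Sum>i\<le>p. Const (\<beta> i) * Yv ^ i) \<oplus> ?F (\<Sum>j\<le>r - q. Const (\<gamma> j) * (Yv ^ j * Zv))"
      unfolding nf_def by (rule F(1))
    finally show ?thesis
      unfolding 1 2 ev1 ev2 using pr_on_comp[OF c1] pr_on_comp[OF c2[of "k - q"], of k] by auto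
  qed
  have b: "\<beta> k = 0" if "k \<le> p" for k
  proof (rule ccontr)
    assume "\<beta> k \<noteq> 0"
    then have "\<beta> k = 1" by simp
    then show False
      using key[of k] that y_indep[of k] yz_indep[of k] add_eq_zero[of "y [^] k" "y [^] (k - q) \<otimes> z"]
      by (cases "\<gamma> (k - q)") (auto split: if_splits)
  qed
  have g: "\<gamma> j = 0" if "j \<le> r - q" for j
  proof (rule ccontr)
    assume "\<gamma> j \<noteq> 0"
    then have "\<gamma> j = 1" by simp
    then show False
      using key[of "j + q"] that b[of "j + q"] z_indep[of "j + q"] qr by (auto split: if_splits)
  qed
  show ?thesis unfolding nf_def using b g by simp
qed

lemma ev_kernel: "ev f = \<zero> \<longleftrightarrow> f \<in> J"
proof
  assume f: "ev f = \<zero>"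
  obtain \<beta> \<gamma> where nf: "f + nf \<beta> \<gamma> \<in> J" using reducible_UNIV[of f] by (auto simp: reducible_def)
  then have "ev (nf \<beta> \<gamma>) = \<zero>" using ev_J[OF nf] f by (simp add: ev_add)
  then have "nf \<beta> \<gamma> = 0" by (rule ev_nf_zero)
  then show "f \<in> J" using nf by simp
qed (rule ev_J)

lemma ev_homogeneous:
  assumes "homogeneous (\<lambda>v. case v of gen_y \<Rightarrow> 1 | gen_z \<Rightarrow> q) i f"
  shows "ev f \<in> component R i"
proof -
  have fs: "finsum R g A \<in> component R i" if "finite A" "\<And>t. t \<in> A \<Longrightarrow> g t \<in> component R i" for g and A :: "(yz \<Rightarrow>\<^sub>0 nat) set"
    using that
  proof (induction A)
    case (insert t A)
    then have "g \<in> A \<rightarrow> carrier R" "g t \<in> carrier R" using comp_carrier by auto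
    then show ?case using insert comp_add by simp
  qed (simp add: comp_zero)
  show ?thesis unfolding ev_def
  proof (rule fs)
    fix t assume "t \<in> Poly_Mapping.keys f"
    then have "i = Poly_Mapping.lookup t gen_y + q * Poly_Mapping.lookup t gen_z"
      using assms degree_yz[of q t] unfolding homogeneous_def by simp
    then show "sc (Poly_Mapping.lookup f t) (mon t) \<in> component R i"
      unfolding mon_def using mult_comp[OF pow_y_comp pow_z_comp] by simp
  qed simp
qed

lemma component_ev:
  assumes a: "a \<in> component R i"
  shows "\<exists>f. homogeneous (\<lambda>v. case v of gen_y \<Rightarrow> 1 | gen_z \<Rightarrow> q) i f \<and> a = ev f"
proof -
  let ?h = "homogeneous (\<lambda>v. case v of gen_y \<Rightarrow> 1 | gen_z \<Rightarrow> q) i"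
  obtain b b' where ab: "a = sc b (y [^] i) \<oplus> (if i < q then \<zero> else sc b' (y [^] (i - q) \<otimes> z))"
    using span[OF a] by blast
  let ?t = "Poly_Mapping.single gen_y i"
  let ?s = "Poly_Mapping.single gen_y (i - q) + Poly_Mapping.single gen_z 1"
  have t: "?h (Poly_Mapping.single ?t b)"
    by (rule homogeneous_single) (simp only: degree_yz, simp add: lookup_single)
  have evt: "ev (Poly_Mapping.single ?t b) = sc b (y [^] i)"
    by (simp add: ev_single mon_def lookup_single)
  show ?thesis
  proof (cases "i < q")
    case True
    then show ?thesis using ab t evt by (intro exI[of _ "Poly_Mapping.single ?t b"]) simp
  next
    case False
    have s: "?h (Poly_Mapping.single ?s b')"
      using False by (intro homogeneous_single) (simp only: degree_yz, simp add: lookup_single lookup_add)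
    have "ev (Poly_Mapping.single ?s b') = sc b' (y [^] (i - q) \<otimes> z)"
      by (simp add: ev_single mon_def lookup_single lookup_add)
    then show ?thesis using ab False evt homogeneous_add[OF t s]
      by (intro exI[of _ "Poly_Mapping.single ?t b + Poly_Mapping.single ?s b'"]) (simp add: ev_add)
  qed
qed

lemma ev_surj: "range ev = carrier R"
proof (intro subset_antisym subsetI)
  fix a assume a: "a \<in> carrier R"
  then obtain N where N: "a = finsum R (\<lambda>i. pr i a) {..<N}" using pr_finsum by blast
  have "finsum R (\<lambda>i. pr i a) {..<k} \<in> range ev" for k
  proof (induction k)
    case 0
    then show ?case by (simp add: image_iff) (metis ev_zero)
  next
    case (Suc k)
    then obtain f where f: "finsum R (\<lambda>i. pr i a) {..<k} = ev f" by blast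
    obtain g where g: "pr k a = ev g" using component_ev[OF pr_comp[OF a]] by blast
    have "finsum R (\<lambda>i. pr i a) {..<Suc k} = ev (g + f)"
      unfolding lessThan_Suc using a comp_carrier[OF pr_comp[OF a]] f g by (simp add: ev_add)
    then show ?case by simp
  qed
  then show "a \<in> range ev" using N by metis
qed auto

theorem two_block_presentation: "R \<cong>\<^sub>g\<^sub>r yz_algebra q rels"
  unfolding yz_algebra_def
proof (rule presented_algebra_iso)
  show "ev (Const k * f) = k \<odot> ev f" for k f by (simp add: ev_Const smult_cases sc_def)
  show "ev f = ev g \<longleftrightarrow> f - g \<in> J" for f g by (simp add: ev_diff ev_kernel)
  show "ev ` {f. homogeneous (\<lambda>v. case v of gen_y \<Rightarrow> 1 | gen_z \<Rightarrow> q) i f} = component R i" for i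
    using ev_homogeneous[of i] component_ev[of _ i] by auto
qed (simp_all add: ev_mult ev_add ev_surj)

end

section \<open>The order of the components of the wedge algebra\<close>

text \<open>By \<open>wedge_ideal\<close> exactly these monomials survive in the wedge algebra,
  where their classes form a basis.\<close>

definition low_monomials :: "(abc \<Rightarrow>\<^sub>0 nat) set"
  where "low_monomials = insert 0 (range (\<lambda>v. Poly_Mapping.single v 1))"

definition wedge_relations :: "(abc, bit) mpoly set"
  where "wedge_relations = {Var gen_a ^ 2, Var gen_b ^ 2, Var gen_c ^ 2,
    Var gen_a * Var gen_b, Var gen_b * Var gen_c, Var gen_a * Var gen_c}"

lemma UNIV_abc: "UNIV = {gen_a, gen_b, gen_c}"
  using abc.exhaust by auto

lemma finite_low_monomials [simp]: "finite low_monomials"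
  unfolding low_monomials_def UNIV_abc by simp

text \<open>Read backwards, multiplication never turns a high monomial into a low one; hence the
  polynomials without low monomials form an ideal.\<close>

lemma low_monomials_add:
  assumes "s + t \<in> low_monomials" shows "t \<in> low_monomials"
proof -
  have sum: "Poly_Mapping.lookup (s + t) v = Poly_Mapping.lookup s v + Poly_Mapping.lookup t v" for v
    by (rule lookup_add)
  from assms consider "s + t = 0" | v where "s + t = Poly_Mapping.single v 1"
    unfolding low_monomials_def by blast
  then show ?thesis
  proof cases
    case 1
    have "t = 0"
    proof (rule poly_mapping_eqI)
      fix v show "Poly_Mapping.lookup t v = Poly_Mapping.lookup 0 v" using sum[of v] 1 by simp
    qed
    then show ?thesis by (simp add: low_monomials_def)
  next
    case (2 v)
    have off: "Poly_Mapping.lookup t v' = 0" if "v' \<noteq> v" for v'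
      using sum[of v'] that by (simp add: 2 lookup_single)
    have "Poly_Mapping.lookup t v \<le> 1" using sum[of v] by (simp add: 2 lookup_single)
    then have "Poly_Mapping.lookup t v = 0 \<or> Poly_Mapping.lookup t v = 1" by linarith
    then have "t = 0 \<or> t = Poly_Mapping.single v 1"
    proof (rule disj_forward)
      assume z: "Poly_Mapping.lookup t v = 0"
      show "t = 0"
      proof (rule poly_mapping_eqI)
        fix u show "Poly_Mapping.lookup t u = Poly_Mapping.lookup 0 u" using off[of u] z by (cases "u = v") simp_all
      qed
    next
      assume z: "Poly_Mapping.lookup t v = 1"
      show "t = Poly_Mapping.single v 1"
      proof (rule poly_mapping_eqI)
        fix u show "Poly_Mapping.lookup t u = Poly_Mapping.lookup (Poly_Mapping.single v 1) u"
          using off[of u] z by (cases "u = v") (simp_all add: lookup_single)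
      qed
    qed
    then show ?thesis by (auto simp: low_monomials_def)
  qed
qed

lemma single_remove:
  fixes t :: "'v \<Rightarrow>\<^sub>0 nat"
  assumes "Poly_Mapping.lookup t v \<noteq> 0"
  shows "t = Poly_Mapping.single v 1 + (t - Poly_Mapping.single v 1)"
proof (rule poly_mapping_eqI)
  fix u show "Poly_Mapping.lookup t u = Poly_Mapping.lookup (Poly_Mapping.single v 1 + (t - Poly_Mapping.single v 1)) u"
    using assms by (cases "u = v") (simp_all add: lookup_add lookup_minus lookup_single)
qed

lemma high_monomial:
  assumes "t \<notin> low_monomials"
  shows "\<exists>u v s. t = Poly_Mapping.single u 1 + (Poly_Mapping.single v 1 + s)"
proof -
  have nz: "\<exists>u. Poly_Mapping.lookup s u \<noteq> 0" if "s \<noteq> 0" for s :: "abc \<Rightarrow>\<^sub>0 nat"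
  proof (rule ccontr)
    assume "\<nexists>u. Poly_Mapping.lookup s u \<noteq> 0"
    then have "s = 0" by (intro poly_mapping_eqI) simp
    then show False using that by simp
  qed
  have "t \<noteq> 0" using assms by (auto simp: low_monomials_def)
  then obtain u where u: "Poly_Mapping.lookup t u \<noteq> 0" using nz by blast
  define t' where "t' = t - Poly_Mapping.single u 1"
  have t: "t = Poly_Mapping.single u 1 + t'" using single_remove[OF u] by (simp add: t'_def)
  have "t' \<noteq> 0"
  proof
    assume "t' = 0"
    then have "t = Poly_Mapping.single u 1" using t by simp
    then show False using assms by (auto simp: low_monomials_def)
  qed
  then obtain v where v: "Poly_Mapping.lookup t' v \<noteq> 0" using nz by blast
  then show ?thesis using t single_remove[OF v] by metis
qed

lemma Var_Var_relation: "Var u * Var v \<in> Idl\<^bsub>poly_ring\<^esub> wedge_relations"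
proof -
  have "Var u * Var v \<in> wedge_relations"
    by (cases u; cases v) (simp_all add: wedge_relations_def power2_eq_square mult.commute)
  then show ?thesis by (rule Idl_gen)
qed

text \<open>An ideal generated by monomials is recognized on supports. Its generators, the products
  of two variables, are not low, and one of them divides every monomial that is not low.\<close>

lemma wedge_ideal: "p \<in> Idl\<^bsub>poly_ring\<^esub> wedge_relations \<longleftrightarrow> Poly_Mapping.keys p \<inter> low_monomials = {}"
proof
  have sq: "Poly_Mapping.single v 2 \<notin> low_monomials" for v :: abc
  proof
    assume "Poly_Mapping.single v 2 \<in> low_monomials"
    then consider "Poly_Mapping.single v 2 = (0 :: abc \<Rightarrow>\<^sub>0 nat)" | u where "Poly_Mapping.single v (2::nat) = Poly_Mapping.single u 1"
      unfolding low_monomials_def by blast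
    then show False
    proof cases
      case (2 u)
      then have "Poly_Mapping.lookup (Poly_Mapping.single v (2::nat)) v = Poly_Mapping.lookup (Poly_Mapping.single u 1) v" by simp
      then show ?thesis by (simp add: lookup_single when_def split: if_splits)
    qed (metis lookup_single_eq lookup_zero zero_neq_numeral)
  qed
  have mix: "Poly_Mapping.single v 1 + Poly_Mapping.single w 1 \<notin> low_monomials" if "v \<noteq> w" for v w :: abc
  proof
    assume "Poly_Mapping.single v 1 + Poly_Mapping.single w 1 \<in> low_monomials"
    then consider "Poly_Mapping.single v 1 + Poly_Mapping.single w 1 = (0 :: abc \<Rightarrow>\<^sub>0 nat)"
      | u where "Poly_Mapping.single v (1::nat) + Poly_Mapping.single w 1 = Poly_Mapping.single u 1"
      unfolding low_monomials_def by blast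
    then show False
    proof cases
      case 1
      then have "Poly_Mapping.lookup (Poly_Mapping.single v (1::nat) + Poly_Mapping.single w 1) v = 0" by simp
      then show ?thesis by (simp add: lookup_add)
    next
      case (2 u)
      then have "Poly_Mapping.lookup (Poly_Mapping.single v (1::nat) + Poly_Mapping.single w 1) x
          = Poly_Mapping.lookup (Poly_Mapping.single u 1) x" for x by simp
      from this[of v] this[of w] that show ?thesis
        by (simp add: lookup_add lookup_single when_def split: if_splits)
    qed
  qed
  have VV: "Var v * Var w = Poly_Mapping.single (Poly_Mapping.single v 1 + Poly_Mapping.single w 1) (1::bit)" for v w :: abc
    by (simp add: Var_def mult_single)
  have "Idl\<^bsub>poly_ring\<^esub> wedge_relations \<subseteq> {p. Poly_Mapping.keys p \<inter> low_monomials = {}}"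
  proof (rule Idl_minimal)
    show "wedge_relations \<subseteq> {p. Poly_Mapping.keys p \<inter> low_monomials = {}}"
      unfolding wedge_relations_def VV Var_power using sq mix by simp
    show "a + b \<in> {p. Poly_Mapping.keys p \<inter> low_monomials = {}}"
      if "a \<in> {p. Poly_Mapping.keys p \<inter> low_monomials = {}}" "b \<in> {p. Poly_Mapping.keys p \<inter> low_monomials = {}}"
      for a b :: "(abc, bit) mpoly"
      using that keys_add[of a b] by blast
    show "x * a \<in> {p. Poly_Mapping.keys p \<inter> low_monomials = {}}"
      if "a \<in> {p. Poly_Mapping.keys p \<inter> low_monomials = {}}" for a x :: "(abc, bit) mpoly"
    proof -
      have "t \<notin> low_monomials" if "t \<in> Poly_Mapping.keys (x * a)" for t
        using that keys_mult[of x a] \<open>a \<in> _\<close> low_monomials_add by blast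
      then show ?thesis by blast
    qed
  qed simp
  then show "p \<in> Idl\<^bsub>poly_ring\<^esub> wedge_relations \<Longrightarrow> Poly_Mapping.keys p \<inter> low_monomials = {}" by blast
next
  assume p: "Poly_Mapping.keys p \<inter> low_monomials = {}"
  have mono: "Poly_Mapping.single t k \<in> Idl\<^bsub>poly_ring\<^esub> wedge_relations" if t: "t \<notin> low_monomials" for t and k :: bit
  proof -
    obtain u v s where "t = Poly_Mapping.single u 1 + (Poly_Mapping.single v 1 + s)" using high_monomial[OF t] by blast
    then have "Poly_Mapping.single t k = Poly_Mapping.single s k * (Var u * Var v)"
      by (simp add: Var_def mult_single ac_simps)
    then show ?thesis using Idl_mult[OF Var_Var_relation] by simp
  qed
  have "(\<Sum>t\<in>A. Poly_Mapping.single t (Poly_Mapping.lookup p t)) \<in> Idl\<^bsub>poly_ring\<^esub> wedge_relations"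
    if "finite A" "A \<inter> low_monomials = {}" for A
    using that by (induction A) (auto simp: Idl_zero intro!: Idl_add mono)
  moreover have "(\<Sum>t\<in>Poly_Mapping.keys p. Poly_Mapping.single t (Poly_Mapping.lookup p t)) = p"
    by (rule poly_mapping_eqI) (simp add: lookup_sum lookup_single when_def in_keys_iff)
  ultimately show "p \<in> Idl\<^bsub>poly_ring\<^esub> wedge_relations" using p by (metis finite_keys)
qed

lemma card_image_eq:
  assumes "\<And>x y. x \<in> A \<Longrightarrow> y \<in> A \<Longrightarrow> f x = f y \<longleftrightarrow> g x = g y"
  shows "card (f ` A) = card (g ` A)"
proof -
  have "bij_betw (\<lambda>b. g (inv_into A f b)) (f ` A) (g ` A)"
  proof (rule bij_betwI')
    fix b b' assume b: "b \<in> f ` A" "b' \<in> f ` A"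
    then show "g (inv_into A f b) = g (inv_into A f b') \<longleftrightarrow> b = b'"
      using assms[of "inv_into A f b" "inv_into A f b'"] inv_into_into[of b f A] inv_into_into[of b' f A]
        f_inv_into_f[of b f A] f_inv_into_f[of b' f A] by metis
  next
    fix b assume "b \<in> f ` A" then show "g (inv_into A f b) \<in> g ` A" by (simp add: inv_into_into)
  next
    fix y assume "y \<in> g ` A"
    then obtain x where x: "x \<in> A" "y = g x" by blast
    then have "g (inv_into A f (f x)) = g x"
      using assms[of "inv_into A f (f x)" x] inv_into_into[of "f x" f A] f_inv_into_f[of "f x" f A] by simp
    then show "\<exists>b \<in> f ` A. y = g (inv_into A f b)" using x by (intro bexI[of _ "f x"]) simp_all
  qed
  then show ?thesis by (rule bij_betw_same_card)
qed

text \<open>With coefficients in \<open>bit\<close>, a coset is determined by the low monomials in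
  the support of a representative. A component thus corresponds to the power set of the low
  monomials of its degree.\<close>

lemma card_wedge_component:
  assumes nml: "1 \<le> n" "1 \<le> m" "1 \<le> l"
  shows "card (component (wedge_algebra n m l :: (bit, _) graded_algebra) i)
    = 2 ^ (of_bool (i = 0) + of_bool (i = n) + of_bool (i = m) + of_bool (i = l))"
proof -
  define d where "d v = (case v of gen_a \<Rightarrow> n | gen_b \<Rightarrow> m | gen_c \<Rightarrow> l)" for v
  define wt where "wt t = (\<Sum>v \<in> Poly_Mapping.keys t. d v * Poly_Mapping.lookup t v)" for t :: "abc \<Rightarrow>\<^sub>0 nat"
  let ?H = "{p :: (abc, bit) mpoly. homogeneous d i p}"
  let ?B = "{t \<in> low_monomials. wt t = i}"
  have W: "wedge_algebra n m l = (presented_algebra d wedge_relations :: (bit, _) graded_algebra)"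
    by (simp add: wedge_algebra_def wedge_relations_def d_def[abs_def] Let_def)
  have eq: "p - q \<in> Idl\<^bsub>poly_ring\<^esub> wedge_relations \<longleftrightarrow>
      Poly_Mapping.keys p \<inter> low_monomials = Poly_Mapping.keys q \<inter> low_monomials" for p q :: "(abc, bit) mpoly"
  proof -
    have "t \<in> Poly_Mapping.keys (p - q) \<longleftrightarrow> (t \<in> Poly_Mapping.keys p) \<noteq> (t \<in> Poly_Mapping.keys q)" for t
      unfolding in_keys_iff lookup_minus
      by (cases "Poly_Mapping.lookup p t"; cases "Poly_Mapping.lookup q t") simp_all
    then show ?thesis unfolding wedge_ideal by blast
  qed
  have "card (component (wedge_algebra n m l :: (bit, _) graded_algebra) i)
      = card ((\<lambda>p. Poly_Mapping.keys p \<inter> low_monomials) ` ?H)"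
    unfolding W presented_algebra_simps(6) by (rule card_image_eq) (simp add: coset_eq_iff eq)
  also have "(\<lambda>p. Poly_Mapping.keys p \<inter> low_monomials) ` ?H = Pow ?B"
  proof (intro subset_antisym subsetI)
    fix A assume "A \<in> (\<lambda>p. Poly_Mapping.keys p \<inter> low_monomials) ` ?H"
    then show "A \<in> Pow ?B" by (auto simp: homogeneous_def wt_def)
  next
    fix A assume A: "A \<in> Pow ?B"
    then have fin: "finite A" using finite_subset[of A low_monomials] by auto
    define p :: "(abc, bit) mpoly" where "p = (\<Sum>t\<in>A. Poly_Mapping.single t 1)"
    have "Poly_Mapping.lookup p t = of_bool (t \<in> A)" for t
      using fin by (simp add: p_def lookup_sum lookup_single when_def)
    then have k: "Poly_Mapping.keys p = A" by (auto simp: in_keys_iff)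
    then have "homogeneous d i p" using A by (auto simp: homogeneous_def wt_def)
    then show "A \<in> (\<lambda>p. Poly_Mapping.keys p \<inter> low_monomials) ` ?H"
      using k A by (intro image_eqI[of _ _ p]) auto
  qed
  also have "card (Pow ?B) = 2 ^ card ?B" by (simp add: card_Pow)
  also have "card ?B = (\<Sum>t\<in>low_monomials. of_bool (wt t = i))"
    by (simp add: sum_of_bool_eq Int_def)
  also have "\<dots> = of_bool (i = 0) + of_bool (i = n) + of_bool (i = m) + of_bool (i = l)"
  proof -
    have wt: "wt (Poly_Mapping.single v 1) = d v" "wt 0 = 0" for v
      by (simp_all add: wt_def)
    have ne: "Poly_Mapping.single v (1::nat) \<noteq> 0" for v :: abc
      by (metis lookup_single_eq lookup_zero zero_neq_one)
    have inj: "inj (\<lambda>v::abc. Poly_Mapping.single v (1::nat))"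
    proof (rule injI)
      fix u v :: abc assume "Poly_Mapping.single u (1::nat) = Poly_Mapping.single v 1"
      then have "Poly_Mapping.lookup (Poly_Mapping.single u (1::nat)) u = Poly_Mapping.lookup (Poly_Mapping.single v 1) u" by simp
      then show "u = v" by (simp add: lookup_single when_def split: if_splits)
    qed
    have "(\<Sum>t\<in>low_monomials. of_bool (wt t = i) :: nat) = of_bool (0 = i) + (\<Sum>v\<in>UNIV. of_bool (d v = i))"
    proof -
      have "0 \<notin> range (\<lambda>v::abc. Poly_Mapping.single v (1::nat))" using ne by (metis imageE)
      moreover have "finite (range (\<lambda>v::abc. Poly_Mapping.single v (1::nat)))" unfolding UNIV_abc by simp
      moreover have "(\<Sum>t\<in>range (\<lambda>v::abc. Poly_Mapping.single v (1::nat)). of_bool (wt t = i) :: nat) = (\<Sum>v\<in>UNIV. of_bool (d v = i))"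
        by (subst sum.reindex[OF inj]) (simp only: comp_def wt)
      ultimately show ?thesis unfolding low_monomials_def by (subst sum.insert) (simp_all add: wt)
    qed
    also have "\<dots> = of_bool (i = 0) + of_bool (i = n) + of_bool (i = m) + of_bool (i = l)"
      unfolding UNIV_abc by (auto simp: d_def of_bool_def)
    finally show ?thesis .
  qed
  finally show ?thesis .
qed

section \<open>Compactness of finite CW complexes\<close>

text \<open>\<open>Euclidean_space k\<close> lies in an infinite product as the functions vanishing
  from \<open>k\<close> on. The disk is closed in a product of compact intervals and points, which
  is compact by Tychonoff.\<close>

lemma compact_disk: "compactin (Euclidean_space k) (topspace (disk k))"
proof -
  let ?P = "powertop_real (UNIV :: nat set)"
  let ?K = "PiE UNIV (\<lambda>i. if i < k then {-1..1} else {0 :: real})"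
  have K: "compactin ?P ?K"
    unfolding compactin_PiE by auto
  have cont: "continuous_map ?P euclideanreal (\<lambda>x. \<Sum>i<k. x i ^ 2)"
    by (intro continuous_intros) auto
  have "closedin ?P {x \<in> topspace ?P. (\<Sum>i<k. x i ^ 2) \<in> {..1}}"
    by (rule closedin_continuous_map_preimage[OF cont]) simp
  then have "compactin ?P (?K \<inter> {x \<in> topspace ?P. (\<Sum>i<k. x i ^ 2) \<in> {..1}})"
    by (rule compact_Int_closedin[OF K])
  moreover have "?K \<inter> {x \<in> topspace ?P. (\<Sum>i<k. x i ^ 2) \<in> {..1}} = topspace (disk k)"
  proof -
    have "x i \<in> {-1..1}" if "(\<Sum>i<k. x i ^ 2) \<le> 1" "i < k" for x :: "nat \<Rightarrow> real" and i
    proof -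
      have "x i ^ 2 \<le> (\<Sum>i<k. x i ^ 2)" using that(2) by (intro member_le_sum) auto
      then have "x i ^ 2 \<le> 1" using that(1) by linarith
      then show ?thesis by (simp add: abs_square_le_1 abs_le_iff)
    qed
    then show ?thesis
      by (auto simp: disk_def topspace_Euclidean_space PiE_iff split: if_splits)
  qed
  ultimately have "compactin ?P (topspace (disk k))" by simp
  then show ?thesis
    unfolding Euclidean_space_def compactin_subtopology
    by (auto simp: disk_def topspace_Euclidean_space)
qed

text \<open>The space is a finite union of continuous images of closed disks.\<close>

lemma finite_CW_complex_compact:
  assumes "finite_CW_complex X" shows "compact_space X" "Hausdorff_space X"
proof -
  have "\<exists>(N::nat) (dim :: nat \<Rightarrow> nat) (\<Phi> :: nat \<Rightarrow> (nat \<Rightarrow> real) \<Rightarrow> 'a).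
      (\<forall>i<N. continuous_map (disk (dim i)) X (\<Phi> i)) \<and>
      (\<Union>i<N. \<Phi> i ` topspace (open_disk (dim i))) = topspace X"
    using assms unfolding finite_CW_complex_def Let_def
    by (elim conjE exE) (intro exI conjI, assumption+)
  then obtain N :: nat and dim :: "nat \<Rightarrow> nat" and \<Phi> :: "nat \<Rightarrow> (nat \<Rightarrow> real) \<Rightarrow> 'a"
    where cont: "\<forall>i<N. continuous_map (disk (dim i)) X (\<Phi> i)"
      and cells: "(\<Union>i<N. \<Phi> i ` topspace (open_disk (dim i))) = topspace X"
    by (elim exE conjE)
  have "compactin X (\<Phi> i ` topspace (disk (dim i)))" if "i < N" for i
  proof (rule image_compactin)
    show "compactin (disk (dim i)) (topspace (disk (dim i)))"
      using compact_disk[of "dim i"] by (simp add: disk_def compactin_subtopology)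
  qed (use cont that in blast)
  then have "compactin X (\<Union>i\<in>{..<N}. \<Phi> i ` topspace (disk (dim i)))"
    by (intro compactin_Union) auto
  moreover have "(\<Union>i\<in>{..<N}. \<Phi> i ` topspace (disk (dim i))) = topspace X"
  proof
    show "(\<Union>i\<in>{..<N}. \<Phi> i ` topspace (disk (dim i))) \<subseteq> topspace X"
      using cont continuous_map_image_subset_topspace by blast
    have "topspace (open_disk k) \<subseteq> topspace (disk k)" for k
      by (auto simp: disk_def open_disk_def)
    then show "topspace X \<subseteq> (\<Union>i\<in>{..<N}. \<Phi> i ` topspace (disk (dim i)))"
      unfolding cells[symmetric] by blast
  qed
  ultimately show "compact_space X" by (simp add: compact_space_def)
  show "Hausdorff_space X" using assms by (simp add: finite_CW_complex_def)
qed

text \<open>The involution is the action of the nonzero group element, and the fibre condition holds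
  because an orbit is the pair of \<open>x\<close> and \<open>\<phi> 1 x\<close>.\<close>

lemma free_involution_orbit_space:
  assumes "compact_space X" "Hausdorff_space X" and free: "free_action (integer_mod_group 2) X \<phi>"
  shows "free_involution X (\<phi> 1) (orbit_space (integer_mod_group 2) X \<phi>) (orbit (integer_mod_group 2) \<phi>)"
proof -
  let ?G = "integer_mod_group 2"
  have G: "carrier ?G = {0, 1}" by (auto simp: carrier_integer_mod_group)
  have act: "group_action ?G (topspace X) \<phi>" and cont: "continuous_map X X (\<phi> 1)"
    and fr: "\<And>g x. g \<in> carrier ?G \<Longrightarrow> x \<in> topspace X \<Longrightarrow> \<phi> g x = x \<Longrightarrow> g = \<one>\<^bsub>?G\<^esub>"
    using free by (auto simp: free_action_def continuous_action_def G)
  interpret group_action ?G "topspace X" \<phi> by (rule act)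
  have id: "\<phi> 0 x = x" if "x \<in> topspace X" for x
    using fun_cong[OF id_eq_one, of x] that by simp
  have TT: "\<phi> 1 (\<phi> 1 x) = x" if "x \<in> topspace X" for x
    using composition_rule[OF that, of 1 1] G id[OF that] by simp
  have orb: "orbit ?G \<phi> x = {x, \<phi> 1 x}" if "x \<in> topspace X" for x
  proof -
    have "orbit ?G \<phi> x = (\<lambda>g. \<phi> g x) ` {0, 1}" unfolding orbit_def G by blast
    then show ?thesis using id[OF that] by simp
  qed
  have top: "\<phi> 1 x \<in> topspace X" if "x \<in> topspace X" for x
    using cont that by (auto simp: continuous_map_def)
  show ?thesis
  proof
    show "orbit ?G \<phi> x = orbit ?G \<phi> x' \<longleftrightarrow> x' = x \<or> x' = \<phi> 1 x" if "x \<in> topspace X" "x' \<in> topspace X" for x x'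
      unfolding orb[OF that(1)] orb[OF that(2)] using TT[OF that(1)] TT[OF that(2)] by (auto simp: doubleton_eq_iff)
    show "\<phi> 1 x \<noteq> x" if "x \<in> topspace X" for x
      using fr[of 1 x] that G by auto
  qed (use assms cont TT quotient_map_orbit_space in auto)
qed

theorem theorem4p2:
  fixes X :: "'a topology" and \<phi> :: "int \<Rightarrow> 'a \<Rightarrow> 'a" and n m l :: nat
  assumes "1 \<le> n" and "n \<le> m" and "m \<le> l"
    and "finite_CW_complex X"
    and "free_action (integer_mod_group 2) X \<phi>"
    and "(cech_cohomology X :: (bit, _) graded_algebra) \<cong>\<^sub>g\<^sub>r wedge_algebra n m l"
  shows
    "let y = Var gen_y; z = Var gen_z in
     (\<exists>a0 a1 a2 :: bit.
        (l < 2 * n \<longrightarrow> a0 = 0) \<and> (m < 2 * n \<longrightarrow> a1 = 0) \<and> (l = m \<longrightarrow> a2 = 0) \<and>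
        cech_cohomology (orbit_space (integer_mod_group 2) X \<phi>) \<cong>\<^sub>g\<^sub>r
          yz_algebra n {y ^ (l + 1),
                        z ^ 2 + Const a0 * y ^ (2 * n) + Const a1 * y ^ n * z,
                        y ^ (m - n + 1) * z + Const a2 * y ^ (m + 1)})
   \<or> (\<exists>a0 :: bit.
        (n < m \<or> (l < 2 * n \<and> n = m) \<longrightarrow> a0 = 0) \<and>
        cech_cohomology (orbit_space (integer_mod_group 2) X \<phi>) \<cong>\<^sub>g\<^sub>r
          yz_algebra m {y ^ (n + 1),
                        z ^ 2 + Const a0 * y ^ n * z,
                        y ^ (l - m + 1) * z})
   \<or> (\<exists>a0 a1 :: bit.
        (m < 2 * n \<longrightarrow> a0 = 0) \<and> (l < 2 * n \<longrightarrow> a1 = 0) \<and>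
        cech_cohomology (orbit_space (integer_mod_group 2) X \<phi>) \<cong>\<^sub>g\<^sub>r
          yz_algebra n {y ^ (m + 1),
                        z ^ 2 + Const a0 * y ^ (2 * n) + Const a1 * y ^ n * z,
                        y ^ (l - n + 1) * z})"
proof -
  let ?Y = "orbit_space (integer_mod_group 2) X \<phi>"
  define \<alpha> :: "nat \<Rightarrow> nat" where "\<alpha> i = of_bool (i = 0) + of_bool (i = n) + of_bool (i = m) + of_bool (i = l)" for i
  interpret free_involution X "\<phi> 1" ?Y "orbit (integer_mod_group 2) \<phi>"
    by (rule free_involution_orbit_space[OF finite_CW_complex_compact[OF assms(4)] assms(5)])
  obtain h where h: "h \<in> ring_iso (coho X) (wedge_algebra n m l)"
    "\<forall>i. h ` component (coho X) i = component (wedge_algebra n m l :: (bit, _) graded_algebra) i"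
    using assms(6) unfolding graded_algebra_iso_def by blast
  have cardX: "card (component (coho X) i) = 2 ^ \<alpha> i" for i
  proof -
    have "inj_on h (component (coho X) i)"
      using h(1) coho_component_carrier by (auto simp: ring_iso_def bij_betw_def intro: inj_on_subset)
    then have "card (component (coho X) i) = card (component (wedge_algebra n m l :: (bit, _) graded_algebra) i)"
      using card_image h(2) by metis
    then show ?thesis using card_wedge_component[of n m l i] assms(1-3) by (simp add: \<alpha>_def)
  qed
  have \<alpha>: "\<alpha> i = of_bool (i = 0) + of_bool (i = n) + of_bool (i = m) + of_bool (i = l)" for i
    by (rule \<alpha>_def)
  obtain z p q r a0 a1 where tb: "two_block (coho ?Y) (coho_proj ?Y) y_class z p q r a0 a1"
    and pqr: "(p = l \<and> q = n \<and> r = m) \<or> (p = n \<and> q = m \<and> r = l) \<or> (p = m \<and> q = n \<and> r = l)"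
    and a0: "p < 2 * q \<Longrightarrow> a0 = 0" and a1: "r < 2 * q \<Longrightarrow> a1 = 0"
    by (rule gysin_ring.ex_two_block[OF gysin_ring_orbit[OF cardX] assms(1-3) \<alpha>]) blast
  note pres = two_block.two_block_presentation[OF tb, unfolded two_block.rels_def[OF tb]]
  from pqr consider (1) "p = l" "q = n" "r = m" | (2) "p = n" "q = m" "r = l" | (3) "p = m" "q = n" "r = l"
    by blast
  then show ?thesis
  proof cases
    case 1
    then show ?thesis
      unfolding Let_def using pres a0 a1
      by (intro disjI1 exI[of _ a0] exI[of _ a1] exI[of _ 0]) simp
  next
    case 2
    \<comment> \<open>Here \<open>p = n\<close> is less than \<open>2 * q = 2 * m\<close>.\<close>
    have "a0 = 0" using a0 2 assms(1,2) by simp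
    show ?thesis
    proof (cases "n = m")
      case True
      \<comment> \<open>The coefficient \<open>a1\<close> of the block presentation takes the role
        of the \<open>a0\<close> in the statement, and \<open>l < 2 * n\<close> reads
        \<open>r < 2 * q\<close>.\<close>
      then show ?thesis
        unfolding Let_def using pres a1 2 \<open>a0 = 0\<close>
        by (intro disjI2 disjI1 exI[of _ a1]) simp
    next
      case False
      \<comment> \<open>The bound \<open>r \<le> p + q\<close> reads \<open>l \<le> n + m\<close>,
        which is less than \<open>2 * m\<close> when \<open>n < m\<close>; so the mixed term
        disappears for every such \<open>l\<close>.\<close>
      have "r < 2 * q" using two_block.blocks_le[OF tb] 2 False assms(2) by simp
      then have "a1 = 0" by (rule a1)
      then show ?thesis
        unfolding Let_def using pres 2 \<open>a0 = 0\<close>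
        by (intro disjI2 disjI1 exI[of _ 0]) simp
    qed
  next
    case 3
    then show ?thesis
      unfolding Let_def using pres a0 a1
      by (intro disjI2 exI[of _ a0] exI[of _ a1]) simp
  qed
qed

end
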